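(* We have $\underline{\rho}(4)\ge\frac{2}{\sqrt7}>0.755$, $\underline{\rho}(6)\ge\frac{2\sqrt2}{\sqrt{15}}>0.730$, $\underline{\rho}(8)\ge\frac{2}{\sqrt7}>0.755$, $\underline{\rho}(10)\ge\frac{7}{3\sqrt{10}}>0.737$, $\underline{\rho}(12)\ge\frac{\sqrt3}{\sqrt5}>0.774$, $\underline{\rho}(14)\ge\frac{11}{\sqrt{210}}>0.759$, $\underline{\rho}(16)\ge\frac{17}{4\sqrt{30}}>0.775$, $\underline{\rho}(18)\ge\frac{4}{3\sqrt3}>0.769$, $\underline{\rho}(20)\ge\frac{2\sqrt5}{\sqrt{33}}>0.778$, $\underline{\rho}(22)\ge\frac{18}{5\sqrt{22}}>0.767$, and for any integer $g\ge12$, $$\underline{\rho}(2g)\ge\frac{g+2\lfloor g/3\rfloor+\lfloor g/6\rfloor}{\sqrt{6g^2-2g\lfloor g/3\rfloor+2g}}.$$ In particular, for any $\delta>0$ we have $R(g,n)>\left(\frac{11}{8\sqrt3}-\delta\right)\sqrt{gn}$ if both $g$ and $\frac ng$ are sufficiently large in terms of $\delta$.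
   Context: A set $S$ of integers is called a $B^\ast[g]$ set if for every integer $m$ there are at most $g$ ordered pairs $(s_1,s_2)\in S\times S$ with $s_1+s_2=m$. For positive integers $g,n$, $R(g,n)$ denotes the largest cardinality of a $B^\ast[g]$ set contained in $\{1,2,\dots,n\}$. Further, $\underline{\rho}(g):=\liminf_{n\to\infty}\frac{R(g,n)}{\sqrt{gn}}$. *)

theory Defs
  imports Complex_Main "HOL-Library.Extended_Real"
begin

(* The finiteness conjunct is needed for infinite S, since card is 0 on infinite sets. *)
definition B_star :: "nat \<Rightarrow> int set \<Rightarrow> bool" where
  "B_star g S \<longleftrightarrow>
     (\<forall>m. finite {(s1, s2) \<in> S \<times> S. s1 + s2 = m} \<and>
          card {(s1, s2) \<in> S \<times> S. s1 + s2 = m} \<le> g)"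

(* The maximum is over a finite set, which contains 0 because of the empty set. *)
definition R :: "nat \<Rightarrow> nat \<Rightarrow> nat" where
  "R g n = Max {card S | S. S \<subseteq> {1..int n} \<and> B_star g S}"

(* The lower limit is taken in the extended reals, so that it always exists and
   no boundedness of the ratio is presupposed. *)
definition rho_lower :: "nat \<Rightarrow> ereal" where
  "rho_lower g = liminf (\<lambda>n. ereal (real (R g n) / sqrt (real g * real n)))"

end

theory Submission
  imports Defs "HOL-Complex_Analysis.Complex_Analysis" "HOL-Number_Theory.Number_Theory"
    "HOL-Real_Asymp.Real_Asymp"
begin

text \<open>
Two facts carry the proof.

\<^bold>\<open>Interleaving.\<close> Let \<open>S\<close> be a Sidon set of residues modulo \<open>N\<close>, so that a sum \<open>s\<^sub>1 + s\<^sub>2\<close> modulo \<open>N\<close>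
determines the unordered pair, and let \<open>A \<subseteq> [0, m)\<close> be a \<open>B\<^sup>*[g]\<close> set. In the set of all \<open>1 + s + N a\<close>
the residue of a sum leaves at most two ordered pairs \<open>(s\<^sub>1, s\<^sub>2)\<close>, and each of them leaves at most \<open>g\<close>
pairs \<open>(a\<^sub>1, a\<^sub>2)\<close>. The result is a \<open>B\<^sup>*[2g]\<close> set in \<open>[1, m N]\<close> with \<open>|A| |S|\<close> elements
(\<open>interleave_B_star\<close>). Ruzsa's set \<open>{x : x \<equiv> i (mod p - 1), x \<equiv> \<theta>\<^sup>i (mod p)}\<close>, for a primitive root \<open>\<theta>\<close> of the prime \<open>p\<close>,
is such an \<open>S\<close> with \<open>p - 1\<close> elements modulo \<open>p (p - 1)\<close>. If \<open>p\<close> is close to \<open>sqrt (n / m)\<close>, this gives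
\<open>R(2g, n) \<ge> (1 - \<epsilon>) |A| sqrt (n / m)\<close>, hence \<open>\<rho>(2g) \<ge> |A| / sqrt (2 g m)\<close> (\<open>R_lower\<close>, \<open>rho_lower_ge\<close>).
Each constant in the bounds for \<open>\<rho>\<close> is \<open>|A| / sqrt (2 g m)\<close> for one good set \<open>A\<close>: ten explicit sets, checked by
evaluation, and a family of unions of three intervals and an arithmetic progression of difference two
(\<open>block_set_B_star\<close>). The threshold on \<open>n / m\<close> in \<open>R_lower\<close> does not depend on \<open>g\<close> or \<open>A\<close>; this
uniformity yields the final claim when \<open>g\<close> grows together with \<open>n\<close>.

\<^bold>\<open>Primes in short intervals.\<close> The lower limit runs over all \<open>n\<close>, so the construction needs a prime in \<open>[x, (1 + \<epsilon>) x]\<close>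
for every large \<open>x\<close> (\<open>prime_short_interval\<close>). This is weaker than the prime number theorem, and the
following Wiener-Ikehara style argument gives it. The function \<open>-\<zeta>'/\<zeta> - \<zeta>\<close>, whose Dirichlet coefficients are
\<open>\<Lambda>(n) - 1\<close>, extends holomorphically to a neighbourhood of \<open>Re s \<ge> 1\<close>, because \<open>\<zeta>\<close> has no zero on the line
\<open>Re s = 1\<close>. Integrating it against \<open>(1 - |t|/\<lambda>) e\<^bsup>iLt\<^esup>\<close> on a vertical segment replaces each term \<open>n\<^bsup>-it\<^esup>\<close> by the
Fejer kernel at \<open>log n - L\<close>, while one integration by parts shows that the integral is \<open>O(1/L)\<close>, uniformly as the
segment approaches the line. So the Fejer-weighted sums of \<open>\<Lambda>(n)/n\<close> and of \<open>1/n\<close> around \<open>e\<^sup>L\<close> agree asymptotically,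
and the second one is bounded below (\<open>fejer_sum_lower\<close>). The decay of the kernel and an upper bound for
\<open>\<Lambda>\<close> in windows, obtained from the same comparison (\<open>mangoldt_window_sum\<close>), show that for large \<open>\<lambda>\<close> only a small part of
the first sum comes from \<open>|log n - L| > \<epsilon>\<close>. What remains is too much for proper prime powers, so there is a prime.
\<close>

section \<open>Dirichlet series to the right of the line Re s = 1\<close>

lemma norm_nat_powr: "norm (of_nat n powr (s :: complex)) = real n powr Re s"
  by (subst norm_powr_real_powr) auto

lemma summable_ln_mult_powr:
  assumes "c > 1"
  shows "summable (\<lambda>n. ln (real n) * real n powr (-c))"
proof (rule summable_comparison_test_ev)
  \<comment> \<open>Half of the excess of \<open>c\<close> over 1 pays for the logarithm, the other half for convergence.\<close>
  define d where "d = (c - 1) / 2"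
  have d: "d > 0" "d - c < -1" using assms by (auto simp: d_def field_simps)
  show "summable (\<lambda>n. 1 / d * real n powr (d - c))"
    using d by (intro summable_mult) (simp add: summable_real_powr_iff)
  show "\<forall>\<^sub>F n in sequentially. norm (ln (real n) * real n powr (-c)) \<le> 1 / d * real n powr (d - c)"
    using eventually_gt_at_top[of 0]
  proof eventually_elim
    case (elim n)
    have "ln (real n) * real n powr (-c) \<le> real n powr d / d * real n powr (-c)"
      using elim d by (intro mult_right_mono ln_powr_bound) auto
    also have "\<dots> = 1 / d * real n powr (d - c)"
      using powr_add[of "real n" d "-c"] by simp
    finally show ?case using elim by simp
  qed
qed

text \<open>The index starts at 0, but the term there vanishes because \<open>0 powr s = 0\<close>.\<close>
definition dirichlet_series :: "(nat \<Rightarrow> real) \<Rightarrow> complex \<Rightarrow> complex" where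
  "dirichlet_series a s = (\<Sum>n. of_real (a n) * of_nat n powr (-s))"

lemma norm_dirichlet_term: "norm (of_real (a n) * of_nat n powr (-s) :: complex) = \<bar>a n\<bar> * real n powr (- Re s)"
  by (simp add: norm_mult norm_nat_powr)

text \<open>The bound \<open>1 + log n\<close> on the coefficients covers all series used below: those with
coefficients 1, \<open>log n\<close>, \<open>\<Lambda>(n)\<close> and \<open>\<Lambda>(n) - 1\<close>.\<close>
lemma dirichlet_summable_abs:
  assumes a: "\<And>n. n > 0 \<Longrightarrow> \<bar>a n\<bar> \<le> 1 + ln (real n)" and c: "c > 1"
  shows "summable (\<lambda>n. \<bar>a n\<bar> * real n powr (-c))"
proof (rule summable_comparison_test')
  show "summable (\<lambda>n. real n powr (-c) + ln (real n) * real n powr (-c))"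
    using c by (intro summable_add summable_ln_mult_powr) (auto simp: summable_real_powr_iff)
  fix n :: nat assume "n \<ge> 1"
  then have "\<bar>a n\<bar> * real n powr (-c) \<le> (1 + ln (real n)) * real n powr (-c)"
    by (intro mult_right_mono a) auto
  then show "norm (\<bar>a n\<bar> * real n powr (-c)) \<le> real n powr (-c) + ln (real n) * real n powr (-c)"
    by (simp add: algebra_simps abs_mult)
qed

lemma dirichlet_summable:
  assumes a: "\<And>n. n > 0 \<Longrightarrow> \<bar>a n\<bar> \<le> 1 + ln (real n)" and s: "Re s > 1"
  shows "summable (\<lambda>n. norm (of_real (a n) * of_nat n powr (-s) :: complex))"
  unfolding norm_dirichlet_term using dirichlet_summable_abs[OF a, of "Re s"] s by simp

lemma dirichlet_sums:
  assumes a: "\<And>n. n > 0 \<Longrightarrow> \<bar>a n\<bar> \<le> 1 + ln (real n)" and s: "Re s > 1"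
  shows "(\<lambda>n. of_real (a n) * of_nat n powr (-s)) sums dirichlet_series a s"
  unfolding dirichlet_series_def by (rule summable_sums[OF summable_norm_cancel[OF dirichlet_summable[OF a s]]])

lemma norm_dirichlet_series_le:
  assumes a: "\<And>n. n > 0 \<Longrightarrow> \<bar>a n\<bar> \<le> 1 + ln (real n)" and s: "Re s \<ge> c" and c: "c > 1"
  shows "norm (dirichlet_series a s) \<le> (\<Sum>n. \<bar>a n\<bar> * real n powr (-c))"
proof -
  have s1: "Re s > 1" using s c by simp
  have "norm (dirichlet_series a s) \<le> (\<Sum>n. norm (of_real (a n) * of_nat n powr (-s) :: complex))"
    unfolding dirichlet_series_def by (rule summable_norm[OF dirichlet_summable[OF a s1]])
  also have "\<dots> \<le> (\<Sum>n. \<bar>a n\<bar> * real n powr (-c))"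
  proof (rule suminf_le[OF _ dirichlet_summable[OF a s1] dirichlet_summable_abs[OF a c]])
    fix n
    show "norm (of_real (a n) * of_nat n powr (-s) :: complex) \<le> \<bar>a n\<bar> * real n powr (-c)"
      unfolding norm_dirichlet_term using s by (cases "n = 0") (auto intro!: mult_left_mono powr_mono)
  qed auto
  finally show ?thesis .
qed

abbreviation zeta :: "complex \<Rightarrow> complex" where "zeta \<equiv> dirichlet_series (\<lambda>_. 1)"
abbreviation mangoldt_series :: "complex \<Rightarrow> complex" where "mangoldt_series \<equiv> dirichlet_series mangoldt"

lemma ln_nat_nonneg: "0 \<le> ln (real n)"
  by (cases "n = 0") auto

lemma mangoldt_coeff_bound: "n > 0 \<Longrightarrow> \<bar>mangoldt n :: real\<bar> \<le> 1 + ln (real n)"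
  using mangoldt_le[of n] by simp

lemma one_coeff_bound: "n > 0 \<Longrightarrow> \<bar>1 :: real\<bar> \<le> 1 + ln (real n)"
  using ln_nat_nonneg[of n] by simp

lemma ln_coeff_bound: "n > 0 \<Longrightarrow> \<bar>ln (real n)\<bar> \<le> 1 + ln (real n)"
  using ln_nat_nonneg[of n] by simp

lemma zeta_deriv:
  assumes s: "Re s > 1"
  shows "(zeta has_field_derivative - dirichlet_series (\<lambda>n. ln (real n)) s) (at s)"
proof -
  let ?S = "{s. Re s > 1}"
  have op: "open ?S" by (simp add: open_halfspace_Re_gt)
  have "\<exists>g g'. \<forall>x \<in> ?S. ((\<lambda>n. of_nat n powr (-x)) sums g x) \<and>
          ((\<lambda>n. - (of_real (ln (real n)) * of_nat n powr (-x))) sums g' x) \<and>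
          (g has_field_derivative g' x) (at x)"
  proof (rule series_and_derivative_comparison_complex[OF op])
    fix n :: nat and x :: complex assume "x \<in> ?S"
    show "((\<lambda>x. of_nat n powr (-x)) has_field_derivative
            - (of_real (ln (real n)) * of_nat n powr (-x))) (at x)"
    proof (cases "n = 0")
      case False
      then have "((\<lambda>x. of_nat n powr (-x)) has_field_derivative
              Ln (of_nat n) * of_nat n powr (-x) * (-1)) (at x)"
        by (intro DERIV_chain2[OF has_field_derivative_powr_right]) (auto intro!: derivative_eq_intros)
      then show ?thesis using False by (simp add: Ln_of_nat)
    qed auto
  next
    fix x :: complex assume x: "x \<in> ?S"
    define d where "d = (Re x - 1) / 2"
    have d: "d > 0" "Re x - d > 1" using x by (auto simp: d_def field_simps)
    have "cmod (of_nat n powr - y) \<le> cmod (of_real (real n powr (- (Re x - d))))"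
      if "y \<in> ball x d \<inter> ?S" for y n
    proof -
      have "\<bar>Re x - Re y\<bar> < d" using that abs_Re_le_cmod[of "x - y"] by (simp add: dist_norm)
      then have "real n powr - Re y \<le> real n powr (- (Re x - d))"
        by (cases "n = 0") (auto intro!: powr_mono)
      then show ?thesis by (simp add: norm_nat_powr)
    qed
    moreover have "summable (\<lambda>n. complex_of_real (real n powr (- (Re x - d))))"
      using d by (subst summable_complex_of_real) (simp add: summable_real_powr_iff)
    ultimately show "\<exists>d h. 0 < d \<and> summable h \<and> range h \<subseteq> \<real>\<^sub>\<ge>\<^sub>0 \<and>
        (\<forall>\<^sub>F n in sequentially. \<forall>y\<in>ball x d \<inter> ?S. cmod (of_nat n powr - y) \<le> cmod (h n))"
      using d(1) by (intro exI[of _ d] exI[of _ "\<lambda>n. of_real (real n powr (- (Re x - d)))"]) auto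
  qed
  then obtain g g' where g: "\<And>x. x \<in> ?S \<Longrightarrow> (\<lambda>n. of_nat n powr (-x)) sums g x"
    "\<And>x. x \<in> ?S \<Longrightarrow> (\<lambda>n. - (of_real (ln (real n)) * of_nat n powr (-x))) sums g' x"
    "\<And>x. x \<in> ?S \<Longrightarrow> (g has_field_derivative g' x) (at x)" by blast
  have gz: "g x = zeta x" if "x \<in> ?S" for x
    using sums_unique2[OF g(1)[OF that]] dirichlet_sums[OF one_coeff_bound, of x] that by simp
  have "g' s = - dirichlet_series (\<lambda>n. ln (real n)) s"
    using sums_unique2[OF g(2)[of s]] sums_minus[OF dirichlet_sums[OF ln_coeff_bound, of s]] s by simp
  then have "(g has_field_derivative - dirichlet_series (\<lambda>n. ln (real n)) s) (at s)"
    using g(3)[of s] s by simp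
  then show ?thesis
    by (rule has_field_derivative_transform_within_open[OF _ op]) (use s gz in auto)
qed

text \<open>The Dirichlet product of \<open>\<Lambda>\<close> and 1 is the logarithm, since the sum of \<open>\<Lambda>\<close> over the
divisors of \<open>n\<close> is \<open>log n\<close>; together with \<open>zeta_deriv\<close> this says that the left factor is
\<open>-\<zeta>'/\<zeta>\<close>, without any appeal to the Euler product.\<close>
lemma mangoldt_series_mult_zeta:
  assumes s: "Re s > 1"
  shows "mangoldt_series s * zeta s = dirichlet_series (\<lambda>n. ln (real n)) s"
proof -
  let ?f = "\<lambda>d. of_real (mangoldt d) * of_nat d powr (-s) :: complex"
  let ?h = "\<lambda>m. of_real 1 * of_nat m powr (-s) :: complex"
  let ?P = "{0::nat<..}"
  have toinf: "((\<lambda>n. of_real (a n) * of_nat n powr (-s)) has_sum dirichlet_series a s) ?P \<and>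
        (\<lambda>n. norm (of_real (a n) * of_nat n powr (-s) :: complex)) summable_on ?P"
    if a: "\<And>n. n > 0 \<Longrightarrow> \<bar>a n\<bar> \<le> 1 + ln (real n)" for a
  proof
    have "(\<lambda>n. norm (of_real (a n) * of_nat n powr (-s) :: complex)) summable_on UNIV"
      using norm_summable_imp_summable_on[of "\<lambda>n. norm (of_real (a n) * of_nat n powr (-s) :: complex)"]
        dirichlet_summable[OF a s] by simp
    then show "(\<lambda>n. norm (of_real (a n) * of_nat n powr (-s) :: complex)) summable_on ?P"
      by (rule summable_on_subset_banach) auto
    have "((\<lambda>n. of_real (a n) * of_nat n powr (-s)) has_sum dirichlet_series a s) UNIV"
      by (rule norm_summable_imp_has_sum[OF dirichlet_summable[OF a s] dirichlet_sums[OF a s]])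
    also have "?this \<longleftrightarrow> ((\<lambda>n. of_real (a n) * of_nat n powr (-s)) has_sum dirichlet_series a s) ?P"
      by (rule has_sum_cong_neutral) auto
    finally show "((\<lambda>n. of_real (a n) * of_nat n powr (-s)) has_sum dirichlet_series a s) ?P" .
  qed
  note vm = toinf[OF mangoldt_coeff_bound] and ze = toinf[OF one_coeff_bound] and lo = toinf[OF ln_coeff_bound]
  let ?g = "\<lambda>(d, m). ?f d * ?h m"
  let ?Q = "Sigma ?P (\<lambda>n. {d. d dvd n})"
  \<comment> \<open>Pairs \<open>(d, m)\<close> are regrouped by their product.\<close>
  have bij: "bij_betw (\<lambda>(n, d). (d, n div d)) ?Q (?P \<times> ?P)"
    by (rule bij_betwI[where g = "\<lambda>(d, m). (d * m, d)"])
       (auto simp: dvd_div_eq_0_iff intro!: Nat.gr0I)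
  have "(\<lambda>x. norm (?g x)) summable_on ?P \<times> ?P"
  proof (rule summable_on_SigmaI)
    show "((\<lambda>m. norm (?g (d, m))) has_sum norm (?f d) * infsum (\<lambda>m. norm (?h m)) ?P) ?P" for d
      using has_sum_cmult_right[OF has_sum_infsum[OF conjunct2[OF ze]], of "norm (?f d)"]
      by (simp add: norm_mult)
    show "(\<lambda>d. norm (?f d) * infsum (\<lambda>m. norm (?h m)) ?P) summable_on ?P"
      by (intro summable_on_cmult_left conjunct2[OF vm])
  qed auto
  then have sg: "?g summable_on ?P \<times> ?P"
    by (rule abs_summable_summable)
  have sq: "(\<lambda>x. ?g (case x of (n, d) \<Rightarrow> (d, n div d))) summable_on ?Q"
    using summable_on_reindex_bij_betw[OF bij, of ?g] sg by simp
  have "mangoldt_series s * zeta s = infsum (\<lambda>d. ?f d * zeta s) ?P"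
    using infsumI[OF has_sum_cmult_left[OF conjunct1[OF vm], of "zeta s"]] by simp
  also have "\<dots> = infsum (\<lambda>d. infsum (\<lambda>m. ?f d * ?h m) ?P) ?P"
    using infsumI[OF has_sum_cmult_right[OF conjunct1[OF ze]]] by simp
  also have "\<dots> = infsum ?g (?P \<times> ?P)"
    using infsum_Sigma'_banach[of "\<lambda>d m. ?f d * ?h m" ?P "\<lambda>_. ?P"] sg by simp
  also have "\<dots> = infsum (\<lambda>x. ?g (case x of (n, d) \<Rightarrow> (d, n div d))) ?Q"
    by (rule infsum_reindex_bij_betw[OF bij, symmetric])
  also have "\<dots> = infsum (\<lambda>n. infsum (\<lambda>d. ?g (d, n div d)) {d. d dvd n}) ?P"
    using infsum_Sigma'_banach[of "\<lambda>n d. ?g (d, n div d)" ?P "\<lambda>n. {d. d dvd n}"] sq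
    by (simp add: case_prod_unfold)
  also have "\<dots> = infsum (\<lambda>n. of_real (ln (real n)) * of_nat n powr (-s)) ?P"
  proof (rule infsum_cong)
    fix n assume n: "n \<in> ?P"
    have fin: "finite {d. d dvd n}" using n by simp
    have "infsum (\<lambda>d. ?g (d, n div d)) {d. d dvd n} = (\<Sum>d | d dvd n. ?g (d, n div d))"
      using fin by (rule infsum_finite)
    also have "\<dots> = (\<Sum>d | d dvd n. mangoldt d * of_nat n powr (-s))"
    proof (rule sum.cong[OF refl])
      fix d assume "d \<in> {d. d dvd n}"
      then obtain m where m: "n = d * m" by auto
      have "d > 0" using n m by auto
      then have "(of_nat n :: complex) powr (-s) = of_nat d powr (-s) * of_nat (n div d) powr (-s)"
        unfolding m by (simp add: powr_times_real)
      then show "?g (d, n div d) = mangoldt d * of_nat n powr (-s)" by simp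
    qed
    also have "\<dots> = of_real (ln (real n)) * of_nat n powr (-s)"
      using mangoldt_sum[of n, where ?'a = complex] n by (simp add: sum_distrib_right[symmetric])
    finally show "infsum (\<lambda>d. ?g (d, n div d)) {d. d dvd n} = of_real (ln (real n)) * of_nat n powr (-s)" .
  qed
  also have "\<dots> = dirichlet_series (\<lambda>n. ln (real n)) s" using infsumI[OF conjunct1[OF lo]] by simp
  finally show ?thesis .
qed

section \<open>Continuation of zeta to the half-plane Re s > 0\<close>

definition zeta_reg_term :: "nat \<Rightarrow> complex \<Rightarrow> complex" where
  "zeta_reg_term n s = (s - 1) * of_nat (Suc n) powr (-s) - of_nat (Suc n) powr (1 - s)
     + of_nat (Suc (Suc n)) powr (1 - s)"

text \<open>This is \<open>(s - 1) \<zeta>(s)\<close>, with the pole of zeta removed: the sum compares \<open>(s - 1) n\<^bsup>-s\<^esup>\<close>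
with the telescoping increments of \<open>n\<^bsup>1-s\<^esup>\<close>. Unlike the series for zeta it converges for
\<open>Re s > 0\<close>, and every term is entire.\<close>
definition zeta_reg :: "complex \<Rightarrow> complex" where
  "zeta_reg s = 1 + (\<Sum>n. zeta_reg_term n s)"

text \<open>The term is the error in approximating the increment of \<open>x\<^bsup>1-s\<^esup>\<close> over \<open>[n, n + 1]\<close> by the
derivative at the left end. Applying the mean value inequality twice bounds it by the second
derivative.\<close>
lemma norm_zeta_reg_term:
  assumes s: "Re s > 0"
  shows "norm (zeta_reg_term n s) \<le> norm s * norm (s - 1) * real (Suc n) powr (- Re s - 1)"
proof -
  define N where "N = real (Suc n)"
  have N: "N > 0" by (simp add: N_def)
  define S where "S = closed_segment (complex_of_real N) (complex_of_real (N + 1))"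
  have S: "\<exists>x. w = complex_of_real x \<and> N \<le> x \<and> x \<le> N + 1" if "w \<in> S" for w
  proof -
    have "S = complex_of_real ` closed_segment N (N + 1)"
      unfolding S_def by (rule closed_segment_of_real)
    then show ?thesis using that by (auto simp: closed_segment_eq_real_ivl)
  qed
  have cS: "convex S" by (simp add: S_def)
  have inS: "complex_of_real N \<in> S" "complex_of_real (N + 1) \<in> S" by (auto simp: S_def)
  have nn: "w \<notin> \<real>\<^sub>\<le>\<^sub>0" if "w \<in> S" for w
    using S[OF that] N by auto
  define B where "B = norm s * N powr (- Re s - 1)"
  have B0: "B \<ge> 0" by (simp add: B_def)
  have dist1: "norm (w - complex_of_real N) \<le> 1" if "w \<in> S" for w
  proof -
    obtain x where x: "w = complex_of_real x" "N \<le> x" "x \<le> N + 1" using S[OF \<open>w \<in> S\<close>] by blast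
    have "w - complex_of_real N = complex_of_real (x - N)" using x by simp
    then show ?thesis using x by (simp only: norm_of_real)
  qed
  have h: "norm (w powr (-s) - of_real N powr (-s)) \<le> B" if w: "w \<in> S" for w
  proof -
    have "norm (w powr (-s) - of_real N powr (-s)) \<le> B * norm (w - of_real N)"
    proof (rule field_differentiable_bound[OF cS _ _ w inS(1)])
      fix z assume z: "z \<in> S"
      show "((\<lambda>z. z powr (-s)) has_field_derivative (-s) * z powr (-s - 1)) (at z within S)"
        using has_field_derivative_powr[OF nn[OF z], of "-s"] by (rule has_field_derivative_at_within)
      obtain x where x: "z = complex_of_real x" "N \<le> x" "x \<le> N + 1" using S[OF z] by blast
      have "norm (z powr (-s - 1)) = x powr (- Re s - 1)"
        using x N by (subst norm_powr_real_powr) auto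
      also have "\<dots> \<le> N powr (- Re s - 1)"
        using x N s by (intro powr_mono2') auto
      finally show "norm ((-s) * z powr (-s - 1)) \<le> B"
        unfolding B_def norm_mult by (simp add: mult_left_mono)
    qed
    also have "\<dots> \<le> B * 1" using B0 dist1[OF w] by (intro mult_left_mono)
    finally show ?thesis by simp
  qed
  let ?phi = "\<lambda>w. w powr (1 - s) - (1 - s) * of_real N powr (-s) * w"
  have "norm (?phi (of_real (N + 1)) - ?phi (of_real N)) \<le> norm (1 - s) * B * norm (of_real (N + 1) - complex_of_real N)"
  proof (rule field_differentiable_bound[OF cS _ _ inS(2) inS(1)])
    fix z assume z: "z \<in> S"
    have "((\<lambda>z. z powr (1 - s)) has_field_derivative (1 - s) * z powr (1 - s - 1)) (at z within S)"
      using has_field_derivative_powr[OF nn[OF z], of "1-s"] by (rule has_field_derivative_at_within)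
    from DERIV_diff[OF this DERIV_cmult[OF DERIV_ident, of "(1 - s) * of_real N powr (-s)"]]
    show "(?phi has_field_derivative (1 - s) * (z powr (-s) - of_real N powr (-s))) (at z within S)"
      by (simp add: right_diff_distrib)
    show "norm ((1 - s) * (z powr (-s) - of_real N powr (-s))) \<le> norm (1 - s) * B"
      unfolding norm_mult using h[OF z] by (intro mult_left_mono) auto
  qed
  also have "norm (of_real (N + 1) - complex_of_real N) = 1" by simp
  also have "?phi (of_real (N + 1)) - ?phi (of_real N) = zeta_reg_term n s"
    by (simp add: zeta_reg_term_def N_def algebra_simps)
  finally show ?thesis by (simp add: B_def N_def norm_minus_commute mult_ac)
qed

lemma summable_zeta_reg_bound: "e > 0 \<Longrightarrow> summable (\<lambda>n. real (Suc n) powr (- e - 1))"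
  by (subst summable_Suc_iff) (simp add: summable_real_powr_iff)

lemma holomorphic_zeta_reg: "zeta_reg holomorphic_on {s. Re s > 0}"
proof -
  let ?S = "{s. Re s > 0}"
  have op: "open ?S" by (simp add: open_halfspace_Re_gt)
  have diff: "zeta_reg_term n field_differentiable at x" for n x
  proof -
    have "(\<lambda>s. c powr (a - s)) field_differentiable at x" if "c \<noteq> 0" for a c :: complex
      unfolding field_differentiable_def
      by (rule exI, rule DERIV_chain2[OF has_field_derivative_powr_right[OF that]])
         (rule derivative_eq_intros refl)+
    from this[of _ 0] this[of _ 1] show ?thesis
      unfolding zeta_reg_term_def
      by (intro field_differentiable_add field_differentiable_diff field_differentiable_mult
            field_differentiable_ident field_differentiable_const) (auto simp del: of_nat_Suc)
  qed
  have "\<exists>d h. 0 < d \<and> summable h \<and> range h \<subseteq> \<real>\<^sub>\<ge>\<^sub>0 \<and>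
          (\<forall>\<^sub>F n in sequentially. \<forall>y\<in>ball x d \<inter> ?S. cmod (zeta_reg_term n y) \<le> cmod (h n))"
    if x: "x \<in> ?S" for x
  proof -
    define d where "d = Re x / 2"
    define C where "C = (norm x + d) * (norm x + d + 1)"
    have d: "d > 0" "Re x = 2 * d" using x by (auto simp: d_def)
    have C: "C \<ge> 0" using d by (simp add: C_def)
    have bd: "cmod (zeta_reg_term n y) \<le> C * real (Suc n) powr (- d - 1)" if y: "y \<in> ball x d" "Re y > 0" for n y
    proof -
      have yx: "norm (y - x) < d" using y by (simp add: dist_norm norm_minus_commute)
      have 1: "norm y \<le> norm x + d" using yx norm_triangle_ineq[of x "y - x"] by simp
      have 2: "norm (y - 1) \<le> norm x + d + 1" using 1 norm_triangle_ineq4[of y 1] by simp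
      have 3: "Re y > d" using abs_Re_le_cmod[of "y - x"] yx d by (simp add: abs_if split: if_splits)
      have "cmod (zeta_reg_term n y) \<le> norm y * norm (y - 1) * real (Suc n) powr (- Re y - 1)"
        by (rule norm_zeta_reg_term[OF y(2)])
      also have "\<dots> \<le> C * real (Suc n) powr (- d - 1)"
        unfolding C_def using 1 2 3 d by (intro mult_mono powr_mono) auto
      finally show ?thesis .
    qed
    have "summable (\<lambda>n. complex_of_real (C * real (Suc n) powr (- d - 1)))"
      by (subst summable_complex_of_real) (rule summable_mult[OF summable_zeta_reg_bound[OF d(1)]])
    then show ?thesis using d C bd
      by (intro exI[of _ d] exI[of _ "\<lambda>n. of_real (C * real (Suc n) powr (- d - 1))"]) (auto simp: norm_mult)
  qed
  then obtain g where g: "\<forall>x \<in> ?S. ((\<lambda>n. zeta_reg_term n x) sums g x) \<and> g field_differentiable (at x)"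
    using series_differentiable_comparison_complex[OF op, of zeta_reg_term] diff by blast
  have "(\<lambda>x. 1 + g x) holomorphic_on ?S"
    using g op by (intro holomorphic_intros) (auto simp: holomorphic_on_def field_differentiable_at_within)
  moreover have "1 + g x = zeta_reg x" if "x \<in> ?S" for x
    using g that sums_unique by (auto simp: zeta_reg_def)
  ultimately show ?thesis by (rule holomorphic_transform) auto
qed

lemma zeta_reg_1: "zeta_reg 1 = 1"
  by (simp add: zeta_reg_def zeta_reg_term_def del: of_nat_Suc)

lemma zeta_reg_eq_zeta:
  assumes s: "Re s > 1"
  shows "zeta_reg s = (s - 1) * zeta s"
proof -
  have "(\<lambda>n. of_nat n powr (-s)) sums zeta s"
    using dirichlet_sums[OF one_coeff_bound s] by simp
  then have "(\<lambda>n. of_nat (Suc n) powr (-s)) sums zeta s"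
    by (subst sums_Suc_iff) simp
  then have 1: "(\<lambda>n. (s - 1) * of_nat (Suc n) powr (-s)) sums ((s - 1) * zeta s)"
    by (rule sums_mult)
  have "(\<lambda>n. of_nat n powr (1 - s)) \<longlonglongrightarrow> (0::complex)"
    using s by (intro tendsto_neg_powr_complex_of_nat filterlim_ident) auto
  then have "(\<lambda>n. of_nat (Suc n) powr (1 - s)) \<longlonglongrightarrow> (0::complex)"
    by (rule LIMSEQ_Suc)
  from telescope_sums[OF this]
  have 2: "(\<lambda>n. of_nat (Suc (Suc n)) powr (1 - s) - of_nat (Suc n) powr (1 - s)) sums (0 - 1 :: complex)"
    by simp
  have "(\<lambda>n. zeta_reg_term n s) sums ((s - 1) * zeta s + (0 - 1))"
    using sums_add[OF 1 2] by (simp add: zeta_reg_term_def algebra_simps)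
  from sums_unique[OF this] show ?thesis unfolding zeta_reg_def by (simp add: algebra_simps)
qed

text \<open>Multiplying through by \<open>zeta_reg\<close> avoids the question of zeros; where it does not vanish,
this says \<open>-\<zeta>'/\<zeta> = 1/(s - 1) - F'/F\<close> with \<open>F = (s - 1) \<zeta>\<close>.\<close>
lemma zeta_reg_mult_mangoldt_series:
  assumes s: "Re s > 1"
  shows "zeta_reg s * (mangoldt_series s - 1 / (s - 1)) = - deriv zeta_reg s"
proof -
  have op: "open {s. Re s > 1}" by (simp add: open_halfspace_Re_gt)
  have "((\<lambda>s. (s - 1) * zeta s) has_field_derivative
           (zeta s + (s - 1) * - dirichlet_series (\<lambda>n. ln (real n)) s)) (at s)"
    by (auto intro!: derivative_eq_intros zeta_deriv[OF s])
  then have "(zeta_reg has_field_derivative (zeta s + (s - 1) * - dirichlet_series (\<lambda>n. ln (real n)) s)) (at s)"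
    by (rule has_field_derivative_transform_within_open[OF _ op]) (use s zeta_reg_eq_zeta in auto)
  then have "deriv zeta_reg s = zeta s - (s - 1) * (mangoldt_series s * zeta s)"
    by (simp add: DERIV_imp_deriv mangoldt_series_mult_zeta[OF s])
  moreover have "s - 1 \<noteq> 0" using s by auto
  then have "(s - 1) * zeta s * (mangoldt_series s - 1 / (s - 1)) = (s - 1) * (mangoldt_series s * zeta s) - zeta s"
    by (simp add: right_diff_distrib)
  ultimately show ?thesis by (simp add: zeta_reg_eq_zeta[OF s])
qed

section \<open>Zeta has no zeros in the closed half-plane Re s >= 1\<close>

text \<open>Near \<open>z\<close> the function is \<open>(w - z)\<^sup>k g(w)\<close> with \<open>g\<close> free of zeros, so its logarithmic
derivative is \<open>k / (w - z) + g'/g\<close>, and multiplying by \<open>w - z = \<sigma>\<close> leaves the order \<open>k\<close> in the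
limit.\<close>
lemma log_deriv_order_of_zero:
  assumes f: "f holomorphic_on S" and S: "open S" "connected S" and z: "z \<in> S"
    and nc: "\<exists>w\<in>S. f w \<noteq> 0"
  shows "\<exists>k::nat. (k = 0 \<longleftrightarrow> f z \<noteq> 0) \<and>
           (\<forall>\<^sub>F \<sigma> in at_right 0. f (z + of_real \<sigma>) \<noteq> 0) \<and>
           ((\<lambda>\<sigma>. of_real \<sigma> * (deriv f (z + of_real \<sigma>) / f (z + of_real \<sigma>))) \<longlongrightarrow> of_nat k) (at_right (0::real))"
proof -
  have "\<exists>g r n. 0 < r \<and> g holomorphic_on ball z r \<and> (n = 0 \<longleftrightarrow> f z \<noteq> 0) \<and>
           (\<forall>w\<in>ball z r. f w = (w - z) ^ n * g w \<and> g w \<noteq> 0)"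
  proof (cases "f z = 0")
    case True
    have "\<not> f constant_on S"
    proof
      assume "f constant_on S"
      then obtain y where y: "\<And>x. x \<in> S \<Longrightarrow> f x = y" by (auto simp: constant_on_def)
      then show False using y[OF z] True nc by auto
    qed
    then obtain g r n where "0 < n" "0 < r" "ball z r \<subseteq> S" "g holomorphic_on ball z r"
      "\<And>w. w \<in> ball z r \<Longrightarrow> f w = (w - z) ^ n * g w" "\<And>w. w \<in> ball z r \<Longrightarrow> g w \<noteq> 0"
      by (rule holomorphic_factor_zero_nonconstant[OF f S z True]) (rule that)
    then show ?thesis using True by (intro exI[of _ g] exI[of _ r] exI[of _ n]) auto
  next
    case False
    have "continuous_on S f" using f by (rule holomorphic_on_imp_continuous_on)
    then have "open (S \<inter> f -` (- {0}))"
      using S by (intro continuous_open_preimage) auto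
    moreover have "z \<in> S \<inter> f -` (- {0})" using z False by simp
    ultimately obtain r where r: "r > 0" "ball z r \<subseteq> S \<inter> f -` (- {0})"
      by (rule openE)
    then have "f holomorphic_on ball z r" by (intro holomorphic_on_subset[OF f]) auto
    then show ?thesis using r False by (intro exI[of _ f] exI[of _ r] exI[of _ 0]) auto
  qed
  then obtain g r k where grk: "0 < r \<and> g holomorphic_on ball z r \<and> (k = 0 \<longleftrightarrow> f z \<noteq> 0) \<and>
           (\<forall>w\<in>ball z r. f w = (w - z) ^ k * g w \<and> g w \<noteq> 0)" by (elim exE)
  note r = grk[THEN conjunct1] and g = grk[THEN conjunct2, THEN conjunct1]
    and k = grk[THEN conjunct2, THEN conjunct2, THEN conjunct1]
  have fg: "f w = (w - z) ^ k * g w" "g w \<noteq> 0" if "w \<in> ball z r" for w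
    using grk[THEN conjunct2, THEN conjunct2, THEN conjunct2, rule_format, OF that] by (rule conjunct1, rule conjunct2)
  have ev: "\<forall>\<^sub>F \<sigma> in at_right 0. 0 < \<sigma> \<and> \<sigma> < r"
    using r eventually_at_right_less[of 0] eventually_at_right_real[of 0 r] by (auto elim: eventually_elim2)
  have inb: "z + complex_of_real \<sigma> \<in> ball z r" if "0 < \<sigma> \<and> \<sigma> < r" for \<sigma>
    using that by (simp add: dist_norm)
  have eq: "\<forall>\<^sub>F \<sigma> in at_right 0. of_nat k + of_real \<sigma> * (deriv g (z + of_real \<sigma>) / g (z + of_real \<sigma>))
              = of_real \<sigma> * (deriv f (z + of_real \<sigma>) / f (z + of_real \<sigma>))"
    using ev
  proof eventually_elim
    case (elim \<sigma>)
    let ?w = "z + complex_of_real \<sigma>"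
    note b = inb[OF elim]
    have w: "?w - z = of_real \<sigma>" by simp
    have dg: "(g has_field_derivative deriv g ?w) (at ?w)"
      by (rule holomorphic_derivI[OF g _ b]) simp
    have "((\<lambda>w. (w - z) ^ k * g w) has_field_derivative
             (of_nat k * (?w - z) ^ (k - 1) * g ?w + (?w - z) ^ k * deriv g ?w)) (at ?w)"
      by (auto intro!: derivative_eq_intros dg simp: algebra_simps)
    then have "(f has_field_derivative
             (of_nat k * (?w - z) ^ (k - 1) * g ?w + (?w - z) ^ k * deriv g ?w)) (at ?w)"
      by (rule has_field_derivative_transform_within_open[OF _ open_ball b]) (rule fg(1)[symmetric])
    then have "deriv f ?w = of_nat k * of_real \<sigma> ^ (k - 1) * g ?w + of_real \<sigma> ^ k * deriv g ?w"
      using DERIV_imp_deriv w by simp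
    moreover have "of_real \<sigma> * (of_nat k * of_real \<sigma> ^ (k - 1)) = of_nat k * complex_of_real \<sigma> ^ k"
      by (cases k) auto
    ultimately have "of_real \<sigma> * deriv f ?w = of_nat k * of_real \<sigma> ^ k * g ?w + of_real \<sigma> * of_real \<sigma> ^ k * deriv g ?w"
      by (simp add: distrib_left mult.assoc[symmetric])
    then show ?case unfolding fg(1)[OF b] w using fg(2)[OF b] elim by (simp add: field_simps)
  qed
  have cont: "isCont (\<lambda>w. deriv g w / g w) z"
  proof (intro continuous_intros)
    have "deriv g holomorphic_on ball z r" by (rule holomorphic_deriv[OF g]) simp
    then show "isCont (deriv g) z"
      using r by (intro field_differentiable_imp_continuous_at holomorphic_on_imp_differentiable_at[OF _ open_ball]) auto
    show "isCont g z" using r g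
      by (intro field_differentiable_imp_continuous_at holomorphic_on_imp_differentiable_at[OF _ open_ball]) auto
    show "g z \<noteq> 0" using fg(2)[of z] r by simp
  qed
  have tz: "((\<lambda>\<sigma>. z + complex_of_real \<sigma>) \<longlongrightarrow> z) (at_right 0)"
    by (rule tendsto_eq_intros tendsto_of_real tendsto_ident_at refl)+ simp
  have "((\<lambda>\<sigma>. deriv g (z + of_real \<sigma>) / g (z + of_real \<sigma>)) \<longlongrightarrow> deriv g z / g z) (at_right 0)"
    by (rule isCont_tendsto_compose[OF cont tz])
  from tendsto_add[OF tendsto_const[of "of_nat k"] tendsto_mult[OF tendsto_of_real[OF tendsto_ident_at] this]]
  have "((\<lambda>\<sigma>. of_nat k + of_real \<sigma> * (deriv g (z + of_real \<sigma>) / g (z + of_real \<sigma>)))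
       \<longlongrightarrow> of_nat k) (at_right 0)" by simp
  from Lim_transform_eventually[OF this eq]
  have lim: "((\<lambda>\<sigma>. of_real \<sigma> * (deriv f (z + of_real \<sigma>) / f (z + of_real \<sigma>))) \<longlongrightarrow> of_nat k) (at_right 0)" .
  have nz: "\<forall>\<^sub>F \<sigma> in at_right 0. f (z + of_real \<sigma>) \<noteq> 0"
    using ev by eventually_elim (subst fg(1)[OF inb], use fg(2)[OF inb] in auto)
  show ?thesis by (intro exI[of _ k] conjI k nz lim)
qed

text \<open>The series continues to \<open>1/(s - 1) - F'/F\<close> with \<open>F = (s - 1) \<zeta>\<close>, so the limit is its
residue at \<open>z\<close>: one for the pole of zeta, minus the order of a zero.\<close>
lemma mangoldt_series_boundary:
  assumes z: "Re z \<ge> 1"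
  shows "\<exists>k::nat. (k = 0 \<longleftrightarrow> zeta_reg z \<noteq> 0) \<and>
     ((\<lambda>\<sigma>. of_real \<sigma> * mangoldt_series (z + of_real \<sigma>)) \<longlongrightarrow> (if z = 1 then 1 else 0) - of_nat k) (at_right (0::real))"
proof -
  let ?S = "{s. Re s > 0}"
  have S: "open ?S" "connected ?S" "z \<in> ?S" using z
    by (auto simp: open_halfspace_Re_gt intro!: convex_connected convex_halfspace_Re_gt)
  have "\<exists>w\<in>?S. zeta_reg w \<noteq> 0" by (rule bexI[of _ 1]) (auto simp: zeta_reg_1)
  from log_deriv_order_of_zero[OF holomorphic_zeta_reg S this] obtain k :: nat where
    k: "(k = 0 \<longleftrightarrow> zeta_reg z \<noteq> 0) \<and> (\<forall>\<^sub>F \<sigma> in at_right 0. zeta_reg (z + of_real \<sigma>) \<noteq> 0) \<and>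
           ((\<lambda>\<sigma>. of_real \<sigma> * (deriv zeta_reg (z + of_real \<sigma>) / zeta_reg (z + of_real \<sigma>))) \<longlongrightarrow> of_nat k) (at_right (0::real))"
    by (elim exE)
  note k1 = k[THEN conjunct1] and k2 = k[THEN conjunct2, THEN conjunct1] and k3 = k[THEN conjunct2, THEN conjunct2]
  have pos: "\<forall>\<^sub>F \<sigma> in at_right (0::real). \<sigma> > 0" by (rule eventually_at_right_less)
  have eq: "\<forall>\<^sub>F \<sigma> in at_right (0::real). of_real \<sigma> / (z + of_real \<sigma> - 1)
         - of_real \<sigma> * (deriv zeta_reg (z + of_real \<sigma>) / zeta_reg (z + of_real \<sigma>)) = of_real \<sigma> * mangoldt_series (z + of_real \<sigma>)"
    using k2 pos
  proof eventually_elim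
    case (elim \<sigma>)
    have "Re (z + of_real \<sigma>) > 1" using z elim by simp
    from zeta_reg_mult_mangoldt_series[OF this] elim(1)
    have "mangoldt_series (z + of_real \<sigma>) = 1 / (z + of_real \<sigma> - 1) - deriv zeta_reg (z + of_real \<sigma>) / zeta_reg (z + of_real \<sigma>)"
      by (simp add: eq_divide_eq eq_diff_eq field_simps)
    then show ?case by (simp add: right_diff_distrib)
  qed
  have l: "((\<lambda>\<sigma>. of_real \<sigma> / (z + of_real \<sigma> - 1)) \<longlongrightarrow> (if z = 1 then 1 else 0)) (at_right (0::real))"
  proof (cases "z = 1")
    case True
    have "\<forall>\<^sub>F \<sigma> in at_right (0::real). 1 = complex_of_real \<sigma> / (z + of_real \<sigma> - 1)"
      using pos by eventually_elim (simp add: True)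
    from Lim_transform_eventually[OF tendsto_const this] True show ?thesis by simp
  next
    case False
    have i: "((\<lambda>\<sigma>. complex_of_real \<sigma>) \<longlongrightarrow> of_real 0) (at_right (0::real))"
      by (rule tendsto_of_real[OF tendsto_ident_at])
    have "((\<lambda>\<sigma>. z + complex_of_real \<sigma> - 1) \<longlongrightarrow> z + of_real 0 - 1) (at_right (0::real))"
      by (intro tendsto_diff tendsto_add tendsto_const i)
    from tendsto_divide[OF i this] False show ?thesis by simp
  qed
  from Lim_transform_eventually[OF tendsto_diff[OF l k3] eq] k1
  show ?thesis by (intro exI[of _ k] conjI)
qed

lemma Re_nat_powr: 
  assumes "n > 0"
  shows "Re (of_nat n powr (- (of_real c + \<i> * of_real t))) = real n powr (-c) * cos (t * ln (real n))"
proof -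
  have "of_nat n powr (- (of_real c + \<i> * of_real t)) =
      exp (of_real (- c * ln (real n)) - \<i> * of_real (t * ln (real n)))"
    using assms by (simp add: powr_def Ln_of_nat algebra_simps)
  also have "Re \<dots> = exp (- c * ln (real n)) * cos (t * ln (real n))"
    by (simp add: Re_exp)
  finally show ?thesis using assms by (simp add: powr_def)
qed

text \<open>The classical inequality \<open>3 + 4 cos x + cos 2x = 2 (1 + cos x)\<^sup>2 \<ge> 0\<close>, applied to
\<open>x = t log n\<close> term by term.\<close>
lemma mertens_341:
  assumes c: "c > 1"
  shows "0 \<le> 3 * Re (mangoldt_series (of_real c)) + 4 * Re (mangoldt_series (of_real c + \<i> * of_real t))
            + Re (mangoldt_series (of_real c + \<i> * of_real (2 * t)))"
proof -
  let ?T = "\<lambda>u n. of_real (mangoldt n) * of_nat n powr (- (of_real c + \<i> * of_real u)) :: complex"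
  have s: "(\<lambda>n. Re (?T u n)) sums Re (mangoldt_series (of_real c + \<i> * of_real u))" for u
    by (rule sums_Re, rule dirichlet_sums[OF mangoldt_coeff_bound]) (use c in auto)
  have re: "Re (?T u n) = mangoldt n * (real n powr (-c) * cos (u * ln (real n)))" for u n
    using Re_nat_powr[of n c u] by (cases "n = 0") (simp_all del: of_real_mangoldt)
  have A: "(\<lambda>n. 3 * Re (?T 0 n) + 4 * Re (?T t n) + Re (?T (2 * t) n)) sums
      (3 * Re (mangoldt_series (of_real c + \<i> * of_real 0)) + 4 * Re (mangoldt_series (of_real c + \<i> * of_real t))
            + Re (mangoldt_series (of_real c + \<i> * of_real (2 * t))))"
    by (intro sums_add sums_mult s)
  have "0 \<le> 3 * Re (?T 0 n) + 4 * Re (?T t n) + Re (?T (2 * t) n)" for n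
  proof -
    define y where "y = cos (t * ln (real n))"
    have c2: "cos (2 * t * ln (real n)) = 2 * y\<^sup>2 - 1"
      unfolding y_def using cos_double_cos[of "t * ln (real n)"] by (simp add: mult.assoc)
    have "3 * Re (?T 0 n) + 4 * Re (?T t n) + Re (?T (2 * t) n)
        = mangoldt n * real n powr (-c) * (2 * (1 + y)\<^sup>2)"
      unfolding re c2 y_def[symmetric] by (simp add: power2_eq_square algebra_simps)
    also have "\<dots> \<ge> 0" by (intro mult_nonneg_nonneg mangoldt_nonneg) auto
    finally show ?thesis .
  qed
  from sums_le[OF this sums_zero A] show ?thesis by simp
qed

text \<open>To the right of the line, a zero would make the absolutely convergent series for \<open>-\<zeta>'/\<zeta>\<close>
unbounded. On the line, zeros of order \<open>k\<close> at \<open>1 + it\<close> and \<open>l\<close> at \<open>1 + 2it\<close> would turn the 3-4-1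
inequality into \<open>3 - 4k - l \<ge> 0\<close>, which forces \<open>k = 0\<close>.\<close>
lemma zeta_reg_nonzero:
  assumes z: "Re z \<ge> 1"
  shows "zeta_reg z \<noteq> 0"
proof (cases "Re z > 1")
  case True
  obtain k :: nat where k: "(k = 0 \<longleftrightarrow> zeta_reg z \<noteq> 0) \<and>
     ((\<lambda>\<sigma>. of_real \<sigma> * mangoldt_series (z + of_real \<sigma>)) \<longlongrightarrow> (if z = 1 then 1 else 0) - of_nat k) (at_right (0::real))"
    using mangoldt_series_boundary[OF z] by (elim exE)
  define C where "C = (\<Sum>n. \<bar>mangoldt n :: real\<bar> * real n powr (- Re z))"
  have "((\<lambda>\<sigma>. of_real \<sigma> * mangoldt_series (z + of_real \<sigma>)) \<longlongrightarrow> 0) (at_right (0::real))"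
  proof (rule Lim_null_comparison)
    show "((\<lambda>\<sigma>. \<sigma> * C) \<longlongrightarrow> 0) (at_right (0::real))"
      using tendsto_mult_left_zero[OF tendsto_ident_at[of 0 "{0<..}"], of C] by simp
    show "\<forall>\<^sub>F \<sigma> in at_right 0. cmod (of_real \<sigma> * mangoldt_series (z + of_real \<sigma>)) \<le> \<sigma> * C"
      using eventually_at_right_less[of 0]
    proof eventually_elim
      case (elim \<sigma>)
      have "cmod (mangoldt_series (z + of_real \<sigma>)) \<le> C"
        unfolding C_def by (rule norm_dirichlet_series_le[OF mangoldt_coeff_bound]) (use elim True in auto)
      then show ?case using elim by (simp add: norm_mult)
    qed
  qed
  from tendsto_unique[OF _ this k[THEN conjunct2]] True have "k = 0" by (auto split: if_splits)
  then show ?thesis using k[THEN conjunct1] by simp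
next
  case False
  define t where "t = Im z"
  have zt: "z = 1 + \<i> * of_real t" using False z by (simp add: t_def complex_eq_iff)
  show ?thesis
  proof (cases "t = 0")
    case True
    then show ?thesis using zeta_reg_1 zt by simp
  next
    case False
    have *: "\<exists>k::nat. (k = 0 \<longleftrightarrow> zeta_reg (1 + \<i> * of_real u) \<noteq> 0) \<and>
     ((\<lambda>\<sigma>. \<sigma> * Re (mangoldt_series (of_real (1 + \<sigma>) + \<i> * of_real u))) \<longlongrightarrow> (if u = 0 then 1 else 0) - of_nat k) (at_right (0::real))" for u
    proof -
      have re: "Re (1 + \<i> * complex_of_real u) \<ge> 1" by simp
      obtain k :: nat where k: "(k = 0 \<longleftrightarrow> zeta_reg (1 + \<i> * of_real u) \<noteq> 0) \<and>
     ((\<lambda>\<sigma>. of_real \<sigma> * mangoldt_series (1 + \<i> * of_real u + of_real \<sigma>)) \<longlongrightarrow>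
        (if 1 + \<i> * complex_of_real u = 1 then 1 else 0) - of_nat k) (at_right (0::real))"
        using mangoldt_series_boundary[OF re] by (elim exE)
      have e: "Re (of_real \<sigma> * mangoldt_series (1 + \<i> * of_real u + of_real \<sigma>)) = \<sigma> * Re (mangoldt_series (of_real (1 + \<sigma>) + \<i> * of_real u))" for \<sigma>
        by (simp add: add_ac)
      from tendsto_Re[OF k[THEN conjunct2]] show ?thesis
        unfolding e using k[THEN conjunct1] by (intro exI[of _ k] conjI) (auto split: if_splits)
    qed
    obtain j :: nat where j: "(j = 0 \<longleftrightarrow> zeta_reg (1 + \<i> * of_real 0) \<noteq> 0) \<and>
     ((\<lambda>\<sigma>. \<sigma> * Re (mangoldt_series (of_real (1 + \<sigma>) + \<i> * of_real 0))) \<longlongrightarrow> (if (0::real) = 0 then 1 else 0) - of_nat j) (at_right (0::real))"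
      using *[of 0] by (elim exE)
    obtain k :: nat where k: "(k = 0 \<longleftrightarrow> zeta_reg (1 + \<i> * of_real t) \<noteq> 0) \<and>
     ((\<lambda>\<sigma>. \<sigma> * Re (mangoldt_series (of_real (1 + \<sigma>) + \<i> * of_real t))) \<longlongrightarrow> (if t = 0 then 1 else 0) - of_nat k) (at_right (0::real))"
      using *[of t] by (elim exE)
    obtain l :: nat where l: "(l = 0 \<longleftrightarrow> zeta_reg (1 + \<i> * of_real (2 * t)) \<noteq> 0) \<and>
     ((\<lambda>\<sigma>. \<sigma> * Re (mangoldt_series (of_real (1 + \<sigma>) + \<i> * of_real (2 * t)))) \<longlongrightarrow> (if 2 * t = 0 then 1 else 0) - of_nat l) (at_right (0::real))"
      using *[of "2 * t"] by (elim exE)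
    have "((\<lambda>\<sigma>. 3 * (\<sigma> * Re (mangoldt_series (of_real (1 + \<sigma>) + \<i> * of_real 0))) + 4 * (\<sigma> * Re (mangoldt_series (of_real (1 + \<sigma>) + \<i> * of_real t)))
       + \<sigma> * Re (mangoldt_series (of_real (1 + \<sigma>) + \<i> * of_real (2 * t)))) \<longlongrightarrow> 3 * ((if (0::real) = 0 then 1 else 0) - of_nat j) + 4 * ((if t = 0 then 1 else 0) - of_nat k)
         + ((if 2 * t = 0 then 1 else 0) - of_nat l)) (at_right (0::real))"
      by (intro tendsto_add tendsto_mult tendsto_const j[THEN conjunct2] k[THEN conjunct2] l[THEN conjunct2])
    moreover have "\<forall>\<^sub>F \<sigma> in at_right (0::real). 0 \<le> 3 * (\<sigma> * Re (mangoldt_series (of_real (1 + \<sigma>) + \<i> * of_real 0))) + 4 * (\<sigma> * Re (mangoldt_series (of_real (1 + \<sigma>) + \<i> * of_real t)))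
       + \<sigma> * Re (mangoldt_series (of_real (1 + \<sigma>) + \<i> * of_real (2 * t)))"
      using eventually_at_right_less[of 0]
    proof eventually_elim
      case (elim \<sigma>)
      have "0 \<le> \<sigma> * (3 * Re (mangoldt_series (of_real (1 + \<sigma>))) + 4 * Re (mangoldt_series (of_real (1 + \<sigma>) + \<i> * of_real t))
            + Re (mangoldt_series (of_real (1 + \<sigma>) + \<i> * of_real (2 * t))))"
        using elim by (intro mult_nonneg_nonneg mertens_341) auto
      then show ?case by (simp add: algebra_simps)
    qed
    ultimately have "0 \<le> 3 * ((if (0::real) = 0 then 1 else 0) - of_nat j) + 4 * ((if t = 0 then 1 else 0) - of_nat k)
         + ((if 2 * t = 0 then 1 else 0) - real l)"
      by (rule tendsto_lowerbound) simp
    then have "0 \<le> 3 * (1 - real j) - 4 * real k - real l" using False by simp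
    then have "k = 0" by (cases k) auto
    then show ?thesis using k[THEN conjunct1] zt by simp
  qed
qed

text \<open>The continuation of \<open>-\<zeta>'/\<zeta> - \<zeta>\<close>. Both terms have a pole with residue 1 at \<open>s = 1\<close>; with
\<open>F = (s - 1) \<zeta>\<close> and \<open>F(1) = 1\<close> the poles cancel and leave \<open>-F'/F - (F(s) - F(1))/(s - 1)\<close>.\<close>
definition mangoldt_excess :: "complex \<Rightarrow> complex" where
  "mangoldt_excess s = - deriv zeta_reg s / zeta_reg s - (if s = 1 then deriv zeta_reg 1 else (zeta_reg s - 1) / (s - 1))"

lemma mangoldt_excess_eq:
  assumes s: "Re s > 1"
  shows "mangoldt_excess s = mangoldt_series s - zeta s"
proof -
  have s1: "s \<noteq> 1" using s by auto
  have nz: "zeta_reg s \<noteq> 0" using zeta_reg_nonzero[of s] s by simp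
  have "mangoldt_series s - 1 / (s - 1) = - deriv zeta_reg s / zeta_reg s"
    using zeta_reg_mult_mangoldt_series[OF s] nz by (simp add: field_simps)
  then have "mangoldt_series s = 1 / (s - 1) - deriv zeta_reg s / zeta_reg s"
    by (simp add: algebra_simps)
  moreover have "zeta s = zeta_reg s / (s - 1)" using zeta_reg_eq_zeta[OF s] s1 by simp
  ultimately show ?thesis using s1 by (simp add: mangoldt_excess_def diff_divide_distrib)
qed

lemma mangoldt_excess_holomorphic: "\<exists>U. open U \<and> {s. Re s \<ge> 1} \<subseteq> U \<and> mangoldt_excess holomorphic_on U"
proof -
  let ?S = "{s. Re s > 0}"
  have op: "open ?S" by (simp add: open_halfspace_Re_gt)
  let ?U = "?S \<inter> zeta_reg -` (-{0})"
  have opU: "open ?U"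
    by (intro continuous_open_preimage op holomorphic_on_imp_continuous_on holomorphic_zeta_reg) auto
  have "(\<lambda>s. if s = 1 then deriv zeta_reg 1 else (zeta_reg s - zeta_reg 1) / (s - 1)) holomorphic_on ?S"
    by (rule pole_lemma_open[OF holomorphic_zeta_reg op])
  then have "(\<lambda>s. if s = 1 then deriv zeta_reg 1 else (zeta_reg s - 1) / (s - 1)) holomorphic_on ?U"
    unfolding zeta_reg_1 by (rule holomorphic_on_subset) auto
  moreover have "zeta_reg holomorphic_on ?U" "deriv zeta_reg holomorphic_on ?U"
    using holomorphic_zeta_reg holomorphic_deriv[OF holomorphic_zeta_reg op] by (auto intro: holomorphic_on_subset)
  ultimately have "mangoldt_excess holomorphic_on ?U"
    unfolding mangoldt_excess_def using opU by (intro holomorphic_intros) auto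
  moreover have "{s. Re s \<ge> 1} \<subseteq> ?U" using zeta_reg_nonzero by auto
  ultimately show ?thesis using opU by (intro exI[of _ ?U] conjI)
qed

section \<open>Fejer-weighted sums\<close>

text \<open>The Fourier transform of the triangle \<open>1 - |t|/l\<close> on \<open>[-l, l]\<close>, with the removable
singularity at \<open>u = 0\<close> filled in.\<close>
definition fejer :: "real \<Rightarrow> real \<Rightarrow> real" where
  "fejer l u = (if u = 0 then l else 2 * (1 - cos (l * u)) / (l * u\<^sup>2))"

lemma fejer_has_integral:
  assumes l: "l > 0"
  shows "((\<lambda>t. (1 - t / l) * cos (t * u)) has_integral fejer l u / 2) {0..l}"
proof (cases "u = 0")
  case True
  have "((\<lambda>t. (1 - t / l)) has_integral (l - l\<^sup>2 / (2 * l)) - (0 - 0\<^sup>2 / (2 * l))) {0..l}"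
    using l
    by (intro fundamental_theorem_of_calculus)
       (auto intro!: derivative_eq_intros simp: has_real_derivative_iff_has_vector_derivative[symmetric])
  then show ?thesis using l True by (simp add: fejer_def power2_eq_square)
next
  case False
  let ?P = "\<lambda>t. (1 - t / l) * sin (t * u) / u - cos (t * u) / (l * u\<^sup>2)"
  have "((\<lambda>t. (1 - t / l) * cos (t * u)) has_integral ?P l - ?P 0) {0..l}"
  proof (rule fundamental_theorem_of_calculus)
    fix x assume "x \<in> {0..l}"
    show "(?P has_vector_derivative (1 - x / l) * cos (x * u)) (at x within {0..l})"
      unfolding has_real_derivative_iff_has_vector_derivative[symmetric] using l False
      by (auto intro!: derivative_eq_intros simp: field_simps power2_eq_square)
  qed (use l in simp)
  then show ?thesis using l False by (simp add: fejer_def diff_divide_distrib)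
qed

text \<open>Integration by parts; the boundary term at \<open>l\<close> disappears because \<open>G\<close> vanishes there.\<close>
lemma oscillatory_bound:
  fixes G G' :: "real \<Rightarrow> complex"
  assumes l: "l > 0" and L: "L > 0"
    and G: "\<And>t. t \<in> {0..l} \<Longrightarrow> (G has_vector_derivative G' t) (at t within {0..l})"
    and cG': "continuous_on {0..l} G'" and Gl: "G l = 0"
    and A: "norm (G 0) \<le> A" and B: "\<And>t. t \<in> {0..l} \<Longrightarrow> norm (G' t) \<le> B"
  shows "norm (integral {0..l} (\<lambda>t. G t * cis (L * t))) \<le> (A + B * l) / L"
proof -
  have cG: "continuous_on {0..l} G"
    using G by (rule continuous_on_vector_derivative)
  let ?c = "\<lambda>t. cis (L * t)"
  have ccis: "continuous_on {0..l} ?c"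
    by (intro continuous_intros)
  have i1: "(\<lambda>t. G t * ?c t) integrable_on {0..l}"
    by (intro integrable_continuous_real continuous_intros cG ccis)
  have i2: "(\<lambda>t. G' t * ?c t) integrable_on {0..l}"
    by (intro integrable_continuous_real continuous_intros cG' ccis)
  let ?P = "\<lambda>t. G t * ?c t"
  have dc: "(?c has_vector_derivative (\<i> * of_real L * ?c t)) (at t within {0..l})" for t
  proof -
    have "((\<lambda>w. exp (\<i> * (of_real L * w))) has_field_derivative
        (\<i> * of_real L * exp (\<i> * (of_real L * of_real t)))) (at (of_real t))"
      by (auto intro!: derivative_eq_intros)
    from has_vector_derivative_real_field[OF this] show ?thesis
      unfolding cis_conv_exp of_real_mult by (rule has_vector_derivative_at_within)
  qed
  have "((\<lambda>t. G t * (\<i> * of_real L * ?c t) + G' t * ?c t) has_integral ?P l - ?P 0) {0..l}"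
    using l by (intro fundamental_theorem_of_calculus has_vector_derivative_mult G dc) auto
  then have "integral {0..l} (\<lambda>t. G t * (\<i> * of_real L * ?c t) + G' t * ?c t) = - G 0"
    using Gl by (simp add: integral_unique)
  also have "(\<lambda>t. G t * (\<i> * of_real L * ?c t) + G' t * ?c t) = (\<lambda>t. (\<i> * of_real L) * (G t * ?c t) + G' t * ?c t)"
    by (simp add: mult_ac)
  also have "integral {0..l} \<dots> = (\<i> * of_real L) * integral {0..l} (\<lambda>t. G t * ?c t) + integral {0..l} (\<lambda>t. G' t * ?c t)"
    using i1 i2 by (subst integral_add) (auto intro!: integrable_on_mult_right)
  finally have eq: "(\<i> * of_real L) * integral {0..l} (\<lambda>t. G t * ?c t) = - G 0 - integral {0..l} (\<lambda>t. G' t * ?c t)"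
    by (simp add: algebra_simps)
  have "norm (integral {0..l} (\<lambda>t. G' t * ?c t)) \<le> B * (l - 0)"
    by (rule integral_bound) (use l B in \<open>auto intro!: continuous_intros cG' simp: norm_mult\<close>)
  then have "norm ((\<i> * of_real L) * integral {0..l} (\<lambda>t. G t * ?c t)) \<le> A + B * l"
    unfolding eq using A norm_triangle_ineq4[of "- G 0" "integral {0..l} (\<lambda>t. G' t * ?c t)"] by simp
  then have "L * norm (integral {0..l} (\<lambda>t. G t * ?c t)) \<le> A + B * l"
    using L by (simp add: norm_mult)
  then show ?thesis using L by (simp add: field_simps)
qed

lemma mangoldt_excess_bounds:
  assumes l: "l > 0"
  shows "\<exists>A>0. \<forall>s. 1 \<le> Re s \<and> Re s \<le> 2 \<and> \<bar>Im s\<bar> \<le> l \<longrightarrow> norm (mangoldt_excess s) \<le> A \<and> norm (deriv mangoldt_excess s) \<le> A"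
proof -
  obtain U where U: "open U \<and> {s. Re s \<ge> 1} \<subseteq> U \<and> mangoldt_excess holomorphic_on U"
    using mangoldt_excess_holomorphic by (elim exE)
  let ?K = "cbox (Complex 1 (-l)) (Complex 2 l)"
  have K: "?K \<subseteq> U" using U by (auto simp: in_cbox_complex_iff)
  have c: "compact ?K" by (rule compact_cbox)
  have "continuous_on ?K mangoldt_excess" "continuous_on ?K (deriv mangoldt_excess)"
    using U K by (meson holomorphic_deriv holomorphic_on_imp_continuous_on continuous_on_subset)+
  then have "bounded (mangoldt_excess ` ?K)" "bounded (deriv mangoldt_excess ` ?K)"
    using c by (auto intro!: compact_imp_bounded compact_continuous_image)
  then obtain a b where ab: "\<forall>x\<in>?K. norm (mangoldt_excess x) \<le> a" "\<forall>x\<in>?K. norm (deriv mangoldt_excess x) \<le> b"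
    unfolding bounded_iff by auto
  show ?thesis
  proof (intro exI[of _ "max 1 (max a b)"] conjI allI impI)
    fix s assume "1 \<le> Re s \<and> Re s \<le> 2 \<and> \<bar>Im s\<bar> \<le> l"
    then have "s \<in> ?K" by (auto simp: in_cbox_complex_iff)
    then show "norm (mangoldt_excess s) \<le> max 1 (max a b)" "norm (deriv mangoldt_excess s) \<le> max 1 (max a b)"
      using ab by (auto simp: le_max_iff_disj)
  qed auto
qed

text \<open>Inserting the series into the integral turns each \<open>n\<^bsup>-it\<^esup>\<close> into a value of the kernel. The
interchange is a uniform limit on a compact interval. Twice the real part over \<open>[0, l]\<close> stands
for the integral over \<open>[-l, l]\<close>, as the coefficients are real.\<close>
lemma fejer_excess_sums:
  assumes l: "l > 0" and sg: "\<sigma> > 0"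
  shows "(\<lambda>n. (mangoldt n - 1) * real n powr (- (1 + \<sigma>)) * fejer l (ln (real n) - L)) sums
     (2 * Re (integral {0..l} (\<lambda>t. (of_real (1 - t / l) * mangoldt_excess (of_real (1 + \<sigma>) + \<i> * of_real t)) * cis (L * t))))"
proof -
  let ?c = "1 + \<sigma>"
  let ?a = "\<lambda>n::nat. mangoldt n - 1 :: real"
  have ab: "\<bar>?a n\<bar> \<le> 1 + ln (real n)" if "n > 0" for n
    using mangoldt_le[OF that] mangoldt_nonneg[of n] ln_nat_nonneg[of n] by (auto simp: abs_if)
  let ?H = "\<lambda>t. mangoldt_excess (of_real ?c + \<i> * of_real t)"
  let ?g = "\<lambda>t. of_real (1 - t / l) * ?H t * cis (L * t)"
  let ?f = "\<lambda>n t. ?a n * real n powr (- ?c) * ((1 - t / l) * cos (t * (ln (real n) - L)))"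
  have H: "?H t = dirichlet_series ?a (of_real ?c + \<i> * of_real t)" for t
  proof -
    have re: "Re (of_real ?c + \<i> * of_real t) > 1" using sg by simp
    have "(\<lambda>n. of_real (mangoldt n) * of_nat n powr - (of_real ?c + \<i> * of_real t)
              - of_real 1 * of_nat n powr - (of_real ?c + \<i> * of_real t)) sums
            (mangoldt_series (of_real ?c + \<i> * of_real t) - zeta (of_real ?c + \<i> * of_real t))"
      by (rule sums_diff[OF dirichlet_sums[OF mangoldt_coeff_bound re] dirichlet_sums[OF one_coeff_bound re]])
    then have "(\<lambda>n. of_real (?a n) * of_nat n powr - (of_real ?c + \<i> * of_real t)) sums ?H t"
      unfolding mangoldt_excess_eq[OF re] by (simp add: left_diff_distrib)
    with dirichlet_sums[OF ab re] show ?thesis by (rule sums_unique2[symmetric])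
  qed
  have termf: "Re (of_real (1 - t / l) * cis (L * t) * (of_real (?a n) * of_nat n powr - (of_real ?c + \<i> * of_real t))) = ?f n t" for n t
  proof (cases "n = 0")
    case False
    have "of_nat n powr (- (of_real ?c + \<i> * of_real t)) =
      exp (of_real (- ?c * ln (real n)) - \<i> * of_real (t * ln (real n)))"
      using False by (simp add: powr_def Ln_of_nat algebra_simps)
    also have "\<dots> = of_real (real n powr (-?c)) * cis (- (t * ln (real n)))"
    proof -
      have p: "real n powr (-?c) = exp (- ?c * ln (real n))" using False by (simp add: powr_def)
      show ?thesis unfolding p cis_conv_exp exp_of_real[symmetric] exp_add[symmetric] by simp
    qed
    finally have e: "of_nat n powr (- (of_real ?c + \<i> * of_real t)) = of_real (real n powr (-?c)) * cis (- (t * ln (real n)))" .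
    have "of_real (1 - t / l) * cis (L * t) * (of_real (?a n) * of_nat n powr - (of_real ?c + \<i> * of_real t))
       = of_real (?a n * real n powr (-?c) * (1 - t / l)) * (cis (L * t) * cis (- (t * ln (real n))))"
      unfolding e by (simp only: of_real_mult mult_ac)
    also have "cis (L * t) * cis (- (t * ln (real n))) = cis (- (t * (ln (real n) - L)))"
      by (simp add: cis_mult algebra_simps)
    finally show ?thesis by (simp only:) (simp del: of_real_mult of_real_diff of_real_divide)
  qed simp
  have sf: "(\<lambda>n. ?f n t) sums Re (?g t)" for t
  proof -
    have re: "Re (of_real ?c + \<i> * of_real t) > 1" using sg by simp
    have "(\<lambda>n. of_real (1 - t / l) * cis (L * t) * (of_real (?a n) * of_nat n powr - (of_real ?c + \<i> * of_real t)))
        sums (of_real (1 - t / l) * cis (L * t) * ?H t)"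
      unfolding H by (rule sums_mult[OF dirichlet_sums[OF ab re]])
    from sums_Re[OF this] show ?thesis unfolding termf by (simp add: mult_ac)
  qed
  define M where "M = (\<lambda>n. \<bar>?a n\<bar> * real n powr (- ?c))"
  have sM: "summable M" unfolding M_def by (rule dirichlet_summable_abs[OF ab]) (use sg in auto)
  have fM: "norm (?f n t) \<le> M n" if "t \<in> {0..l}" for n t
  proof -
    have "\<bar>1 - t / l\<bar> \<le> 1" using that l by (auto simp: abs_le_iff field_simps)
    then have "\<bar>1 - t / l\<bar> * \<bar>cos (t * (ln (real n) - L))\<bar> \<le> 1 * 1"
      by (intro mult_mono) auto
    then have "M n * (\<bar>1 - t / l\<bar> * \<bar>cos (t * (ln (real n) - L))\<bar>) \<le> M n * 1"
      by (intro mult_left_mono) (auto simp: M_def)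
    then show ?thesis by (simp add: M_def abs_mult mult.assoc)
  qed
  have "uniform_limit {0..l} (\<lambda>N t. \<Sum>n<N. ?f n t) (\<lambda>t. \<Sum>n. ?f n t) sequentially"
    by (rule Weierstrass_m_test[OF fM sM])
  also have "(\<lambda>t. \<Sum>n. ?f n t) = (\<lambda>t. Re (?g t))"
    using sf sums_unique by (metis (lifting))
  finally have ul: "uniform_limit {0..l} (\<lambda>N t. \<Sum>n<N. ?f n t) (\<lambda>t. Re (?g t)) sequentially" .
  have "continuous_on {0..l} (\<lambda>t. \<Sum>n<N. ?f n t)" for N
    by (intro continuous_intros) (use l in auto)
  from uniform_limit_integral[OF ul this] obtain I J where IJ:
    "\<And>N. ((\<lambda>t. \<Sum>n<N. ?f n t) has_integral I N) {0..l}"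
    "((\<lambda>t. Re (?g t)) has_integral J) {0..l}" "I \<longlonglongrightarrow> J" by auto
  let ?k = "\<lambda>n. ?a n * real n powr (- ?c) * fejer l (ln (real n) - L)"
  have "((\<lambda>t. \<Sum>n<N. ?f n t) has_integral (\<Sum>n<N. ?a n * real n powr (- ?c) * (fejer l (ln (real n) - L) / 2))) {0..l}" for N
    by (intro has_integral_sum has_integral_mult_right fejer_has_integral l) auto
  with IJ(1) have "I N = (\<Sum>n<N. ?a n * real n powr (- ?c) * (fejer l (ln (real n) - L) / 2))" for N
    by (rule has_integral_unique)
  then have I: "2 * I N = (\<Sum>n<N. ?k n)" for N by (simp add: sum_distrib_left)
  have "(\<lambda>N. 2 * I N) \<longlonglongrightarrow> 2 * J" by (intro tendsto_intros IJ(3))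
  then have s: "?k sums (2 * J)" unfolding sums_def I .
  obtain U where U: "open U \<and> {s. Re s \<ge> 1} \<subseteq> U \<and> mangoldt_excess holomorphic_on U"
    using mangoldt_excess_holomorphic by (elim exE)
  have "continuous_on {0..l} ?H"
  proof (rule continuous_on_compose2[of U mangoldt_excess])
    show "continuous_on U mangoldt_excess" using U holomorphic_on_imp_continuous_on by auto
    show "(\<lambda>t. of_real ?c + \<i> * of_real t) ` {0..l} \<subseteq> U" using U sg by auto
  qed (intro continuous_intros)
  then have "continuous_on {0..l} ?g"
    using l by (intro continuous_intros) auto
  then have "(?g has_integral integral {0..l} ?g) {0..l}"
    by (intro integrable_integral integrable_continuous_real)
  then have "((\<lambda>t. Re (?g t)) has_integral Re (integral {0..l} ?g)) {0..l}"
    by (rule has_integral_Re)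
  from has_integral_unique[OF IJ(2) this] s show ?thesis by simp
qed

text \<open>The point is the uniformity in \<open>\<sigma>\<close>: the integrand is smooth up to the line \<open>Re s = 1\<close>, so
one bound on a compact rectangle serves all \<open>\<sigma>\<close>. This later allows \<open>\<sigma>\<close> to depend on \<open>L\<close>.\<close>
lemma fejer_excess_bound:
  assumes l: "l > 0"
  shows "\<exists>C>0. \<forall>\<sigma> L S. 0 < \<sigma> \<and> \<sigma> \<le> 1 \<and>
     (\<lambda>n. (mangoldt n - 1) * real n powr (- (1 + \<sigma>)) * fejer l (ln (real n) - L)) sums S \<longrightarrow>
     \<bar>S\<bar> \<le> C \<and> (L > 0 \<longrightarrow> \<bar>S\<bar> \<le> C / L)"
proof -
  obtain A where A: "A > 0 \<and> (\<forall>s. 1 \<le> Re s \<and> Re s \<le> 2 \<and> \<bar>Im s\<bar> \<le> l \<longrightarrow> norm (mangoldt_excess s) \<le> A \<and> norm (deriv mangoldt_excess s) \<le> A)"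
    using mangoldt_excess_bounds[OF l] by (elim exE)
  obtain U where U: "open U \<and> {s. Re s \<ge> 1} \<subseteq> U \<and> mangoldt_excess holomorphic_on U"
    using mangoldt_excess_holomorphic by (elim exE)
  have U1: "open U" "mangoldt_excess holomorphic_on U" using U by auto
  \<comment> \<open>A bound for the derivative of the triangle times the function on the segment.\<close>
  define B where "B = A / l + A"
  have B: "B > 0" using A l by (auto simp: B_def intro: add_pos_pos)
  define C where "C = 2 * (A * l) + 2 * (A + B * l)"
  have C: "C > 0" "2 * (A * l) \<le> C" "2 * (A + B * l) \<le> C" using A B l by (auto simp: C_def intro!: add_pos_pos)
  have main: "\<bar>S\<bar> \<le> C \<and> (L > 0 \<longrightarrow> \<bar>S\<bar> \<le> C / L)"
    if sg: "0 < \<sigma>" "\<sigma> \<le> 1" and S: "(\<lambda>n. (mangoldt n - 1) * real n powr (- (1 + \<sigma>)) * fejer l (ln (real n) - L)) sums S" for \<sigma> L S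
  proof -
    let ?z = "\<lambda>t. of_real (1 + \<sigma>) + \<i> * complex_of_real t"
    let ?G = "\<lambda>t. of_real (1 - t / l) * mangoldt_excess (?z t)"
    let ?G' = "\<lambda>t. of_real (1 - t / l) * (\<i> * deriv mangoldt_excess (?z t)) + of_real (- (1 / l)) * mangoldt_excess (?z t)"
    have zU: "?z t \<in> U" for t using U sg by auto
    have S2: "S = 2 * Re (integral {0..l} (\<lambda>t. ?G t * cis (L * t)))"
      using sums_unique2[OF S fejer_excess_sums[OF l sg(1)]] .
    have S3: "\<bar>S\<bar> \<le> 2 * norm (integral {0..l} (\<lambda>t. ?G t * cis (L * t)))"
      unfolding S2 using abs_Re_le_cmod by (simp add: abs_mult)
    have hb: "norm (mangoldt_excess (?z t)) \<le> A" "norm (deriv mangoldt_excess (?z t)) \<le> A" if "t \<in> {0..l}" for t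
      using A sg that by auto
    have ch: "continuous_on {0..l} (\<lambda>t. mangoldt_excess (?z t))"
      by (rule continuous_on_compose2[OF holomorphic_on_imp_continuous_on[OF U1(2)]])
         (use zU in \<open>auto intro!: continuous_intros\<close>)
    have cdh: "continuous_on {0..l} (\<lambda>t. deriv mangoldt_excess (?z t))"
      by (rule continuous_on_compose2[OF holomorphic_on_imp_continuous_on[OF holomorphic_deriv[OF U1(2,1)]]])
         (use zU in \<open>auto intro!: continuous_intros\<close>)
    have w: "\<bar>1 - t / l\<bar> \<le> 1" if "t \<in> {0..l}" for t using that l by (auto simp: abs_le_iff field_simps)
    have nG: "norm (?G t) \<le> A" if "t \<in> {0..l}" for t
      unfolding norm_mult norm_of_real using mult_mono[OF w[OF that] hb(1)[OF that]] by simp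
    have "norm (integral {0..l} (\<lambda>t. ?G t * cis (L * t))) \<le> A * (l - 0)"
    proof (rule integral_bound)
      show "continuous_on {0..l} (\<lambda>t. ?G t * cis (L * t))"
        using l by (intro continuous_intros ch) auto
      show "norm (?G t * cis (L * t)) \<le> A" if "t \<in> {0..l}" for t
        unfolding norm_mult[of _ "cis (L * t)"] norm_cis using nG[OF that] by simp
    qed (use l in simp)
    with S3 C have 1: "\<bar>S\<bar> \<le> C" by simp
    have 2: "\<bar>S\<bar> \<le> C / L" if L: "L > 0"
    proof -
      have dG: "(?G has_vector_derivative ?G' t) (at t within {0..l})" for t
      proof (rule has_vector_derivative_mult)
        show "((\<lambda>t. complex_of_real (1 - t / l)) has_vector_derivative of_real (- (1 / l))) (at t within {0..l})"
          by (rule has_vector_derivative_of_real) (use l in \<open>auto intro!: derivative_eq_intros\<close>)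
        have hd: "(mangoldt_excess has_field_derivative deriv mangoldt_excess (?z t)) (at (?z t))"
          by (rule holomorphic_derivI[OF U1(2,1) zU])
        have "((\<lambda>w. mangoldt_excess (of_real (1 + \<sigma>) + \<i> * w)) has_field_derivative (\<i> * deriv mangoldt_excess (?z t))) (at (of_real t))"
          by (rule DERIV_cong[OF DERIV_chain2[where g = "\<lambda>w. of_real (1 + \<sigma>) + \<i> * w", OF hd]])
             (auto intro!: derivative_eq_intros)
        from has_vector_derivative_real_field[OF this]
        show "((\<lambda>t. mangoldt_excess (?z t)) has_vector_derivative (\<i> * deriv mangoldt_excess (?z t))) (at t within {0..l})"
          by (rule has_vector_derivative_at_within)
      qed
      have "norm (integral {0..l} (\<lambda>t. ?G t * cis (L * t))) \<le> (A + B * l) / L"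
      proof (rule oscillatory_bound[OF l L dG])
        show "continuous_on {0..l} ?G'"
          using l by (intro continuous_intros ch cdh) auto
        show "?G l = 0" using l by simp
        show "norm (?G 0) \<le> A" using nG[of 0] l by simp
        fix t assume t: "t \<in> {0..l}"
        have "norm (?G' t) \<le> \<bar>1 - t / l\<bar> * norm (deriv mangoldt_excess (?z t)) + 1 / l * norm (mangoldt_excess (?z t))"
          by (rule order_trans[OF norm_triangle_ineq]) (use l in \<open>simp add: norm_mult del: of_real_diff of_real_divide of_real_minus\<close>)
        also have "\<dots> \<le> 1 * A + 1 / l * A"
          using w[OF t] hb[OF t] l A by (intro add_mono mult_mono) auto
        finally show "norm (?G' t) \<le> B" by (simp add: B_def)
      qed
      then have "\<bar>S\<bar> \<le> 2 * ((A + B * l) / L)" using S3 by linarith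
      also have "\<dots> \<le> C / L" using C L by (simp add: divide_right_mono)
      finally show ?thesis .
    qed
    show ?thesis using 1 2 by simp
  qed
  show ?thesis
    by (rule exI[of _ C], rule conjI[OF C(1)], intro allI impI, elim conjE, rule main, assumption+)
qed

lemma fejer_nonneg: "l > 0 \<Longrightarrow> 0 \<le> fejer l u"
  by (simp add: fejer_def)

lemma triangle_has_integral:
  assumes l: "(l::real) > 0"
  shows "((\<lambda>t. (1 - t / l) * c) has_integral (l / 2) * c) {0..l}"
  using has_integral_mult_left[OF fejer_has_integral[OF l, of 0], of c] by (simp add: fejer_def)

lemma fejer_le:
  assumes l: "l > 0"
  shows "fejer l u \<le> l"
proof -
  have "fejer l u / 2 \<le> (l / 2) * 1"
  proof (rule has_integral_le[OF fejer_has_integral[OF l] triangle_has_integral[OF l, of 1]])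
    fix t assume "t \<in> {0..l}"
    then show "(1 - t / l) * cos (t * u) \<le> (1 - t / l) * 1"
      using l by (intro mult_left_mono) auto
  qed
  then show ?thesis by simp
qed

text \<open>On this range the cosine in \<open>fejer_has_integral\<close> stays above 1/2, since \<open>1 \<le> \<pi>/3\<close>.\<close>
lemma fejer_ge:
  assumes l: "l > 0" and u: "\<bar>u\<bar> \<le> 1 / l"
  shows "fejer l u \<ge> l / 2"
proof -
  have "(l / 2) * (1 / 2) \<le> fejer l u / 2"
  proof (rule has_integral_le[OF triangle_has_integral[OF l, of "1/2"] fejer_has_integral[OF l]])
    fix t assume t: "t \<in> {0..l}"
    have "\<bar>t * u\<bar> \<le> l * (1 / l)" unfolding abs_mult using t u l by (intro mult_mono) auto
    then have 1: "\<bar>t * u\<bar> \<le> pi / 3" using l pi_gt3 by simp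
    have "cos (pi / 3) \<le> cos \<bar>t * u\<bar>" using 1 by (intro cos_monotone_0_pi_le) auto
    then have "1 / 2 \<le> cos (t * u)" by (simp add: cos_60)
    then show "(1 - t / l) * (1 / 2) \<le> (1 - t / l) * cos (t * u)"
      using t l by (intro mult_left_mono) auto
  qed
  then show ?thesis by simp
qed

text \<open>The decay that makes the far part of a weighted sum small once \<open>l\<close> is large.\<close>
lemma fejer_mult_le:
  assumes l: "l > 0"
  shows "fejer l u * u\<^sup>2 \<le> 4 / l"
proof (cases "u = 0")
  case False
  have "1 - cos (l * u) \<le> 2" using cos_ge_minus_one[of "l * u"] by linarith
  then have "2 * (1 - cos (l * u)) \<le> 4" using mult_left_mono[of _ 2 "2::real"] by fastforce
  then have "2 * (1 - cos (l * u)) / l \<le> 4 / l" using l by (intro divide_right_mono) auto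
  then show ?thesis using False by (simp add: fejer_def)
qed (use l in simp)

lemma fejer_1_le: "fejer 1 u \<le> 5 / (1 + u\<^sup>2)"
proof -
  have "fejer 1 u * (1 + u\<^sup>2) \<le> 5" using fejer_le[of 1 u] fejer_mult_le[of 1 u] by (simp add: distrib_left)
  then show ?thesis by (simp add: pos_le_divide_eq add_pos_nonneg)
qed

text \<open>The kernel has zeros, but the numerators \<open>1 - cos u\<close> and \<open>1 - cos (u + \<pi>) = 1 + cos u\<close> add
up to 2, so two translates together dominate \<open>1 / (1 + u\<^sup>2)\<close>. A bound for kernel sums thereby
becomes a bound for window sums.\<close>
lemma fejer_1_shift: "1 / (1 + u\<^sup>2) \<le> 16 * (fejer 1 u + fejer 1 (u + pi))"
proof (cases "u = 0 \<or> u = - pi")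
  case True
  then have "1 \<le> fejer 1 u + fejer 1 (u + pi)"
    using fejer_nonneg[of 1] by (auto simp: fejer_def)
  then have "16 * 1 \<le> 16 * (fejer 1 u + fejer 1 (u + pi))" by (intro mult_left_mono) auto
  moreover have "1 / (1 + u\<^sup>2) \<le> 16 * 1" by (simp add: divide_le_eq add_pos_nonneg)
  ultimately show ?thesis by (rule order_trans[rotated])
next
  case False
  \<comment> \<open>A common upper bound for the two denominators: \<open>(u + \<pi>)\<^sup>2 \<le> 2 u\<^sup>2 + 2 \<pi>\<^sup>2\<close> and \<open>\<pi> < 4\<close>.\<close>
  define D where "D = 32 * (1 + u\<^sup>2)"
  have pi: "pi \<ge> 0" "pi < 4" using pi_less_4 by auto
  have p2: "pi\<^sup>2 \<le> 4\<^sup>2" using pi by (intro power_mono) auto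
  have "0 \<le> (u - pi)\<^sup>2" by simp
  then have "(u + pi)\<^sup>2 \<le> 2 * u\<^sup>2 + 2 * pi\<^sup>2" by (simp add: power2_eq_square algebra_simps)
  moreover have "u\<^sup>2 \<ge> 0" by simp
  ultimately have D: "u\<^sup>2 \<le> D" "(u + pi)\<^sup>2 \<le> D" using p2 unfolding D_def distrib_left power2_eq_square[of 4] by linarith+
  have pos: "u\<^sup>2 > 0" "(u + pi)\<^sup>2 > 0" using False by auto
  have D0: "D > 0" using D pos by linarith
  have a: "fejer 1 u \<ge> 2 * (1 - cos u) / D"
    using False D(1) pos by (simp add: fejer_def frac_le)
  have b: "fejer 1 (u + pi) \<ge> 2 * (1 + cos u) / D"
  proof -
    have "0 \<le> 1 + cos u" using cos_ge_minus_one[of u] by linarith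
    then have "2 * (1 + cos u) / D \<le> 2 * (1 + cos u) / (u + pi)\<^sup>2"
      by (intro frac_le D(2) pos(2) order_refl mult_nonneg_nonneg) auto
    then show ?thesis using False by (simp add: fejer_def add_eq_0_iff2)
  qed
  have "2 * (1 - cos u) / D + 2 * (1 + cos u) / D = 4 / D"
    by (simp add: add_divide_distrib[symmetric])
  with a b have "4 / D \<le> fejer 1 u + fejer 1 (u + pi)" by linarith
  then have "16 * (4 / D) \<le> 16 * (fejer 1 u + fejer 1 (u + pi))" by (intro mult_left_mono) auto
  moreover have "1 / (1 + u\<^sup>2) \<le> 16 * (4 / D)"
  proof -
    have "16 * (4 / D) = 2 * (1 / (1 + u\<^sup>2))" using mult_divide_mult_cancel_left[of 32 2 "1 + u\<^sup>2"] by (simp add: D_def distrib_left)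
    moreover have "0 \<le> 1 / (1 + u\<^sup>2)" by simp
    ultimately show ?thesis by linarith
  qed
  ultimately show ?thesis by (rule order_trans[rotated])
qed

text \<open>The derivative of \<open>arctan (log x - L)\<close> is \<open>1 / (x (1 + (log x - L)\<^sup>2))\<close>, and between \<open>n\<close>
and \<open>n + 1\<close> it does not fall below a sixth of its value at \<open>n\<close>; the window sum is thus dominated
by a telescoping one.\<close>
lemma arctan_step:
  assumes n: "n > 0"
  shows "1 / real n / (1 + (ln (real n) - L)\<^sup>2) \<le> 6 * (arctan (ln (real (Suc n)) - L) - arctan (ln (real n) - L))"
proof -
  define u where "u = ln (real n) - L"
  have "\<exists>z. real n < z \<and> z < real (Suc n) \<and>
      arctan (ln (real (Suc n)) - L) - arctan (ln (real n) - L) =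
      (real (Suc n) - real n) * (1 / z * inverse (1 + (ln z - L)\<^sup>2))"
    by (rule MVT2) (use n in \<open>auto intro!: derivative_eq_intros\<close>)
  then obtain z where z: "real n < z" "z < real n + 1"
    "arctan (ln (real (Suc n)) - L) - arctan (ln (real n) - L) = 1 / z * inverse (1 + (ln z - L)\<^sup>2)"
    by auto
  have zn: "z > 0" "z \<le> 2 * real n" using z n by auto
  define d where "d = ln z - ln (real n)"
  have d0: "d \<ge> 0" using z n by (simp add: d_def)
  have "d = ln (z / real n)" using z n by (simp add: d_def ln_div)
  also have "\<dots> \<le> z / real n - 1" using z n by (intro ln_le_minus_one) auto
  also have "\<dots> \<le> 1" using zn n by (simp add: field_simps)
  finally have d1: "d\<^sup>2 \<le> 1" using d0 by (simp add: power_le_one)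
  have "ln z - L = u + d" by (simp add: u_def d_def)
  moreover have "(u + d)\<^sup>2 \<le> 2 * u\<^sup>2 + 2 * d\<^sup>2"
    using zero_le_power2[of "u - d"] by (simp add: power2_eq_square algebra_simps)
  moreover have "u\<^sup>2 \<ge> 0" by simp
  ultimately have "1 + (ln z - L)\<^sup>2 \<le> 3 + 3 * u\<^sup>2" using d1 by (simp only:)
  then have "1 + (ln z - L)\<^sup>2 \<le> 3 * (1 + u\<^sup>2)" by simp
  then have "z * (1 + (ln z - L)\<^sup>2) \<le> (2 * real n) * (3 * (1 + u\<^sup>2))"
    using zn n by (intro mult_mono) (auto simp: add_nonneg_nonneg)
  moreover have "0 < z * (1 + (ln z - L)\<^sup>2)" using zn by (intro mult_pos_pos) (auto simp: add_pos_nonneg)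
  ultimately have "1 / ((2 * real n) * (3 * (1 + u\<^sup>2))) \<le> 1 / (z * (1 + (ln z - L)\<^sup>2))"
    by (intro frac_le) auto
  then have "6 * (1 / ((2 * real n) * (3 * (1 + u\<^sup>2)))) \<le> 6 * (1 / z * inverse (1 + (ln z - L)\<^sup>2))"
    by (simp add: field_simps)
  moreover have "6 * (1 / ((2 * real n) * (3 * q))) = 1 / real n / q" if "q > 0" for q :: real
    using that n by (simp add: field_simps)
  then have "6 * (1 / ((2 * real n) * (3 * (1 + u\<^sup>2)))) = 1 / real n / (1 + u\<^sup>2)"
    by (simp only: add_pos_nonneg zero_less_one zero_le_power2)
  ultimately show ?thesis unfolding z(3) by (simp add: u_def)
qed

text \<open>The total increase of the arctangent is at most \<open>\<pi> < 4\<close>. The term \<open>n = 0\<close> is zero on the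
left, so its telescoping partner is started at \<open>log 1\<close>.\<close>
lemma harmonic_window_sum: "(\<Sum>n<N. real n powr (-1) / (1 + (ln (real n) - L)\<^sup>2)) \<le> 24"
proof -
  have "(\<Sum>n<N. real n powr (-1) / (1 + (ln (real n) - L)\<^sup>2)) \<le>
      (\<Sum>n<N. 6 * (arctan (ln (real (Suc n)) - L) - (if n = 0 then arctan (ln 1 - L) else arctan (ln (real n) - L))))"
  proof (rule sum_mono)
    fix n assume "n \<in> {..<N}"
    show "real n powr (-1) / (1 + (ln (real n) - L)\<^sup>2) \<le>
       6 * (arctan (ln (real (Suc n)) - L) - (if n = 0 then arctan (ln 1 - L) else arctan (ln (real n) - L)))"
      using arctan_step[of n L] by (cases "n = 0") (auto simp: powr_minus_divide)
  qed
  also have "\<dots> = 6 * (\<Sum>n<N. (if Suc n = 0 then arctan (ln 1 - L) else arctan (ln (real (Suc n)) - L)) - (if n = 0 then arctan (ln 1 - L) else arctan (ln (real n) - L)))"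
    by (simp add: sum_distrib_left)
  also have "\<dots> = 6 * ((if N = 0 then arctan (ln 1 - L) else arctan (ln (real N) - L)) - arctan (ln 1 - L))"
    by (subst sum_lessThan_telescope) simp
  also have "\<dots> \<le> 24"
    using arctan_bounded[of "ln (real N) - L"] arctan_bounded[of "ln 1 - L"] pi_less_4 by auto
  finally show ?thesis .
qed

lemma plain_window_sum:
  assumes sg: "\<sigma> > 0"
  shows "summable (\<lambda>n. real n powr (- (1 + \<sigma>)) / (1 + (ln (real n) - L)\<^sup>2)) \<and>
    (\<Sum>n. real n powr (- (1 + \<sigma>)) / (1 + (ln (real n) - L)\<^sup>2)) \<le> 24"
proof -
  let ?f = "\<lambda>n. real n powr (- (1 + \<sigma>)) / (1 + (ln (real n) - L)\<^sup>2)"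
  have pos: "?f n \<ge> 0" for n by (simp add: add_nonneg_nonneg)
  have bd: "(\<Sum>n<N. ?f n) \<le> 24" for N
  proof -
    have "(\<Sum>n<N. ?f n) \<le> (\<Sum>n<N. real n powr (-1) / (1 + (ln (real n) - L)\<^sup>2))"
    proof (intro sum_mono divide_right_mono)
      fix n show "real n powr (- (1 + \<sigma>)) \<le> real n powr (-1)"
        by (cases "n = 0") (simp, intro powr_mono, use sg in auto)
    qed (simp add: add_nonneg_nonneg)
    with harmonic_window_sum[of L N] show ?thesis by linarith
  qed
  have "summable ?f" by (rule summableI_nonneg_bounded[OF pos bd])
  then show ?thesis using suminf_le_const[OF _ bd] by blast
qed

lemma weighted_summable:
  assumes sg: "\<sigma> > 0" and b: "\<And>n. 0 \<le> b n \<and> b n \<le> (B::real)"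
  shows "summable (\<lambda>n. mangoldt n * real n powr (- (1 + \<sigma>)) * b n)"
    and "summable (\<lambda>n. real n powr (- (1 + \<sigma>)) * b n)"
proof -
  have s1: "summable (\<lambda>n. \<bar>mangoldt n\<bar> * real n powr (- (1 + \<sigma>)) * B)"
    by (intro summable_mult2 dirichlet_summable_abs mangoldt_coeff_bound) (use sg in auto)
  have s2: "summable (\<lambda>n. \<bar>1\<bar> * real n powr (- (1 + \<sigma>)) * B)"
    by (intro summable_mult2 dirichlet_summable_abs one_coeff_bound) (use sg in auto)
  show "summable (\<lambda>n. mangoldt n * real n powr (- (1 + \<sigma>)) * b n)"
    by (rule summable_comparison_test'[OF s1])
       (use b mangoldt_nonneg in \<open>auto simp: abs_mult intro!: mult_left_mono\<close>)
  show "summable (\<lambda>n. real n powr (- (1 + \<sigma>)) * b n)"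
    by (rule summable_comparison_test'[OF s2])
       (use b in \<open>auto simp: abs_mult intro!: mult_left_mono\<close>)
qed

text \<open>This is the form in which the analytic input is used: smoothed at any fixed scale \<open>l\<close>, \<open>\<Lambda>\<close>
behaves like 1 up to an error that tends to 0 as \<open>L\<close> grows.\<close>
lemma mangoldt_fejer_compare:
  assumes l: "l > 0"
  shows "\<exists>C>0. \<forall>\<sigma> L. 0 < \<sigma> \<and> \<sigma> \<le> 1 \<longrightarrow>
     \<bar>(\<Sum>n. mangoldt n * real n powr (- (1 + \<sigma>)) * fejer l (ln (real n) - L))
       - (\<Sum>n. real n powr (- (1 + \<sigma>)) * fejer l (ln (real n) - L))\<bar> \<le> (if L > 0 then min C (C / L) else C)"
proof -
  obtain C where C: "C > 0 \<and> (\<forall>\<sigma> L S. 0 < \<sigma> \<and> \<sigma> \<le> 1 \<and>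
     (\<lambda>n. (mangoldt n - 1) * real n powr (- (1 + \<sigma>)) * fejer l (ln (real n) - L)) sums S \<longrightarrow>
     \<bar>S\<bar> \<le> C \<and> (L > 0 \<longrightarrow> \<bar>S\<bar> \<le> C / L))"
    using fejer_excess_bound[OF l] by (elim exE)
  show ?thesis
  proof (rule exI[of _ C], rule conjI[OF C[THEN conjunct1]], intro allI impI, elim conjE)
    fix \<sigma> L :: real assume sg: "0 < \<sigma>" "\<sigma> \<le> 1"
    let ?b = "\<lambda>n. fejer l (ln (real n) - L)"
    have b: "0 \<le> ?b n \<and> ?b n \<le> l" for n using fejer_nonneg[OF l] fejer_le[OF l] by auto
    let ?S = "(\<Sum>n. mangoldt n * real n powr (- (1 + \<sigma>)) * ?b n) - (\<Sum>n. real n powr (- (1 + \<sigma>)) * ?b n)"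
    have "(\<lambda>n. mangoldt n * real n powr (- (1 + \<sigma>)) * ?b n - real n powr (- (1 + \<sigma>)) * ?b n) sums ?S"
      by (intro sums_diff summable_sums weighted_summable[OF sg(1) b])
    moreover have "mangoldt n * real n powr (- (1 + \<sigma>)) * ?b n - real n powr (- (1 + \<sigma>)) * ?b n
       = (mangoldt n - 1) * real n powr (- (1 + \<sigma>)) * ?b n" for n
      by (simp add: left_diff_distrib)
    ultimately have "(\<lambda>n. (mangoldt n - 1) * real n powr (- (1 + \<sigma>)) * ?b n) sums ?S" by simp
    with C[THEN conjunct2, rule_format, of \<sigma> L ?S] sg have "\<bar>?S\<bar> \<le> C \<and> (L > 0 \<longrightarrow> \<bar>?S\<bar> \<le> C / L)" by blast
    then show "\<bar>?S\<bar> \<le> (if L > 0 then min C (C / L) else C)" by simp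
  qed
qed

text \<open>A Chebyshev-type upper bound. At scale 1 the kernel sum of \<open>\<Lambda>\<close> exceeds that of 1 by a
bounded amount, the latter is bounded by \<open>plain_window_sum\<close>, and \<open>fejer_1_shift\<close> passes from
kernels at \<open>L\<close> and \<open>L - \<pi>\<close> to the window.\<close>
lemma mangoldt_window_sum:
  "\<exists>C>0. \<forall>\<sigma> L. 0 < \<sigma> \<and> \<sigma> \<le> 1 \<longrightarrow>
     (\<Sum>n. mangoldt n * real n powr (- (1 + \<sigma>)) * (1 / (1 + (ln (real n) - L)\<^sup>2))) \<le> C"
proof -
  obtain C where C: "C > 0 \<and> (\<forall>\<sigma> L. 0 < \<sigma> \<and> \<sigma> \<le> 1 \<longrightarrow>
     \<bar>(\<Sum>n. mangoldt n * real n powr (- (1 + \<sigma>)) * fejer 1 (ln (real n) - L))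
       - (\<Sum>n. real n powr (- (1 + \<sigma>)) * fejer 1 (ln (real n) - L))\<bar> \<le> (if L > 0 then min C (C / L) else C))"
    using mangoldt_fejer_compare[of 1] by auto
  have fb: "0 \<le> fejer 1 x \<and> fejer 1 x \<le> 1" for x using fejer_nonneg[of 1] fejer_le[of 1] by auto
  have A: "(\<Sum>n. mangoldt n * real n powr (- (1 + \<sigma>)) * fejer 1 (ln (real n) - L)) \<le> 120 + C"
    if sg: "0 < \<sigma>" "\<sigma> \<le> 1" for \<sigma> L
  proof -
    have "(\<Sum>n. real n powr (- (1 + \<sigma>)) * fejer 1 (ln (real n) - L)) \<le>
       (\<Sum>n. 5 * (real n powr (- (1 + \<sigma>)) / (1 + (ln (real n) - L)\<^sup>2)))"
    proof (rule suminf_le)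
      fix n
      show "real n powr (- (1 + \<sigma>)) * fejer 1 (ln (real n) - L) \<le> 5 * (real n powr (- (1 + \<sigma>)) / (1 + (ln (real n) - L)\<^sup>2))"
        using mult_left_mono[OF fejer_1_le[of "ln (real n) - L"], of "real n powr (- (1 + \<sigma>))"] by (simp add: mult_ac)
    next
      show "summable (\<lambda>n. real n powr (- (1 + \<sigma>)) * fejer 1 (ln (real n) - L))"
        by (rule weighted_summable(2)[OF sg(1) fb])
      show "summable (\<lambda>n. 5 * (real n powr (- (1 + \<sigma>)) / (1 + (ln (real n) - L)\<^sup>2)))"
        using plain_window_sum[OF sg(1), of L] by (intro summable_mult) auto
    qed
    also have "\<dots> \<le> 5 * 24"
      using plain_window_sum[OF sg(1), of L] by (subst suminf_mult) auto
    finally have "(\<Sum>n. real n powr (- (1 + \<sigma>)) * fejer 1 (ln (real n) - L)) \<le> 120" by simp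
    moreover have "\<bar>(\<Sum>n. mangoldt n * real n powr (- (1 + \<sigma>)) * fejer 1 (ln (real n) - L))
       - (\<Sum>n. real n powr (- (1 + \<sigma>)) * fejer 1 (ln (real n) - L))\<bar> \<le> C"
      using C[THEN conjunct2, rule_format, of \<sigma> L] sg by (auto split: if_splits)
    ultimately show ?thesis by linarith
  qed
  show ?thesis
  proof (rule exI[of _ "32 * (120 + C)"], rule conjI, use C in simp, intro allI impI, elim conjE)
    fix \<sigma> L :: real assume sg: "0 < \<sigma>" "\<sigma> \<le> 1"
    let ?m = "\<lambda>n. mangoldt n * real n powr (- (1 + \<sigma>))"
    let ?a = "\<lambda>n. ?m n * fejer 1 (ln (real n) - L)" and ?b = "\<lambda>n. ?m n * fejer 1 (ln (real n) - (L - pi))"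
    have w: "0 \<le> 1 / (1 + (ln (real n) - L)\<^sup>2) \<and> 1 / (1 + (ln (real n) - L)\<^sup>2) \<le> 1" for n
      by (simp add: add_nonneg_nonneg divide_le_eq add_pos_nonneg)
    have sa: "summable ?a" and sb: "summable ?b" by (rule weighted_summable(1)[OF sg(1) fb])+
    have "(\<Sum>n. ?m n * (1 / (1 + (ln (real n) - L)\<^sup>2))) \<le> (\<Sum>n. 16 * (?a n + ?b n))"
    proof (rule suminf_le)
      fix n
      have "?m n * (1 / (1 + (ln (real n) - L)\<^sup>2)) \<le> ?m n * (16 * (fejer 1 (ln (real n) - L) + fejer 1 (ln (real n) - L + pi)))"
        by (intro mult_left_mono fejer_1_shift mult_nonneg_nonneg mangoldt_nonneg) auto
      also have "\<dots> = 16 * (?a n + ?b n)" by (simp add: algebra_simps)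
      finally show "?m n * (1 / (1 + (ln (real n) - L)\<^sup>2)) \<le> 16 * (?a n + ?b n)" .
    next
      show "summable (\<lambda>n. ?m n * (1 / (1 + (ln (real n) - L)\<^sup>2)))"
        by (rule weighted_summable(1)[OF sg(1) w])
      show "summable (\<lambda>n. 16 * (?a n + ?b n))" by (intro summable_mult summable_add sa sb)
    qed
    also have "\<dots> = 16 * ((\<Sum>n. ?a n) + (\<Sum>n. ?b n))"
      by (simp only: suminf_mult[OF summable_add[OF sa sb]] suminf_add[OF sa sb])
    also have "\<dots> \<le> 16 * ((120 + C) + (120 + C))"
      by (intro mult_left_mono add_mono A sg) auto
    finally show "(\<Sum>n. ?m n * (1 / (1 + (ln (real n) - L)\<^sup>2))) \<le> 32 * (120 + C)" by simp
  qed
qed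

section \<open>Primes in short intervals\<close>

lemma card_nats_ge:
  assumes "0 \<le> a"
  shows "real (card {n::nat. a \<le> real n \<and> real n \<le> b}) \<ge> b - a - 1" and "finite {n::nat. a \<le> real n \<and> real n \<le> b}"
proof -
  have "{n::nat. a \<le> real n \<and> real n \<le> b} \<subseteq> {..nat \<lfloor>b\<rfloor>}"
    by (auto simp: le_nat_floor)
  then show fin: "finite {n::nat. a \<le> real n \<and> real n \<le> b}" by (rule finite_subset) simp
  show "real (card {n::nat. a \<le> real n \<and> real n \<le> b}) \<ge> b - a - 1"
  proof (cases "b \<ge> 0")
    case True
    have "{nat \<lceil>a\<rceil>..nat \<lfloor>b\<rfloor>} \<subseteq> {n::nat. a \<le> real n \<and> real n \<le> b}"
    proof
      fix n assume "n \<in> {nat \<lceil>a\<rceil>..nat \<lfloor>b\<rfloor>}"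
      then have "a \<le> real n" "int n \<le> \<lfloor>b\<rfloor>" using True by (auto simp: nat_le_iff ceiling_le_iff le_nat_iff)
      then show "n \<in> {n::nat. a \<le> real n \<and> real n \<le> b}" by (auto simp: le_floor_iff)
    qed
    then have "card {nat \<lceil>a\<rceil>..nat \<lfloor>b\<rfloor>} \<le> card {n::nat. a \<le> real n \<and> real n \<le> b}"
      by (rule card_mono[OF fin])
    then have "real (card {n::nat. a \<le> real n \<and> real n \<le> b}) \<ge> real_of_int (\<lfloor>b\<rfloor> + 1 - \<lceil>a\<rceil>)"
      using True assms by simp linarith
    then show ?thesis by linarith
  qed (use assms in linarith)
qed

text \<open>Only \<open>n\<close> between \<open>e\<^sup>L\<close> and \<open>e\<^bsup>L + 1/l\<^esup>\<close> are kept: about \<open>e\<^sup>L / l\<close> of them, each with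
weight of order \<open>l e\<^bsup>-L\<^esup>\<close>. So \<open>l\<close> cancels, which matters because \<open>l\<close> is chosen in terms of the
bound. The choice \<open>\<sigma> = 1 / (L + 1)\<close> keeps \<open>n\<^bsup>-\<sigma>\<^esup> \<ge> 1/e\<close> on this range.\<close>
lemma fejer_sum_lower:
  assumes l: "l \<ge> 1" and L: "L \<ge> 1" "exp L \<ge> 2 * l"
  shows "(\<Sum>n. real n powr (- (1 + 1 / (L + 1))) * fejer l (ln (real n) - L)) \<ge> exp (- 2) / 4"
proof -
  define \<sigma> where "\<sigma> = 1 / (L + 1)"
  have sg: "\<sigma> > 0" using L by (simp add: \<sigma>_def)
  define N where "N = {n::nat. exp L \<le> real n \<and> real n \<le> exp (L + 1 / l)}"
  have finN: "finite N" unfolding N_def by (rule card_nats_ge) simp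
  have b: "0 \<le> fejer l x \<and> fejer l x \<le> l" for x
    using l fejer_nonneg[of l] fejer_le[of l] by auto
  have "exp L * (1 + 1 / l) \<le> exp L * exp (1 / l)"
    by (intro mult_left_mono exp_ge_add_one_self) auto
  then have "exp (L + 1 / l) - exp L \<ge> exp L / l" by (simp add: exp_add distrib_left)
  moreover have "real (card N) \<ge> exp (L + 1 / l) - exp L - 1"
    unfolding N_def by (rule card_nats_ge) simp
  moreover have "exp L / (2 * l) \<ge> 1" using L(2) l by simp
  moreover have "exp L / l = 2 * (exp L / (2 * l))" by simp
  ultimately have card: "real (card N) \<ge> exp L / (2 * l)" by linarith
  have low: "real n powr (- (1 + \<sigma>)) * fejer l (ln (real n) - L) \<ge> exp (- (L + 2)) * (l / 2)" if "n \<in> N" for n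
  proof -
    have n: "exp L \<le> real n" "real n \<le> exp (L + 1 / l)" using that by (auto simp: N_def)
    have n0: "real n > 0" using n(1) exp_gt_zero[of L] by linarith
    have ln1: "L \<le> ln (real n)" "ln (real n) \<le> L + 1 / l"
      using n n0 ln_le_cancel_iff[OF n0, of "exp (L + 1 / l)"] by (simp_all add: ln_ge_iff)
    have l1: "1 / l \<le> 1" using l by simp
    have p: "real n powr (- (1 + \<sigma>)) = exp (- ((1 + \<sigma>) * ln (real n)))"
      using n0 by (simp add: powr_def algebra_simps)
    have "(1 + \<sigma>) * ln (real n) \<le> (1 + \<sigma>) * (L + 1)"
      using ln1 l1 sg by (intro mult_left_mono) auto
    also have "\<dots> = L + 2" using L by (simp add: \<sigma>_def field_simps)
    finally have "exp (- (L + 2)) \<le> real n powr (- (1 + \<sigma>))"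
      unfolding p by simp
    moreover have "l / 2 \<le> fejer l (ln (real n) - L)"
      using ln1 l by (intro fejer_ge) auto
    ultimately show ?thesis using l by (intro mult_mono) auto
  qed
  have "exp (- 2) / 4 = (exp L / (2 * l)) * (exp (- (L + 2)) * (l / 2))"
  proof -
    have "exp L * exp (- (L + 2)) = exp (- 2)" by (simp add: exp_add[symmetric])
    then have "exp (- 2) / 4 = exp L * exp (- (L + 2)) / 4" by simp
    also have "\<dots> = (exp L / (2 * l)) * (exp (- (L + 2)) * (l / 2))" using l by (simp add: field_simps)
    finally show ?thesis .
  qed
  also have "\<dots> \<le> real (card N) * (exp (- (L + 2)) * (l / 2))"
    using card l by (intro mult_right_mono) auto
  also have "\<dots> \<le> (\<Sum>n\<in>N. real n powr (- (1 + \<sigma>)) * fejer l (ln (real n) - L))"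
    by (rule sum_bounded_below[OF low])
  also have "\<dots> \<le> (\<Sum>n. real n powr (- (1 + \<sigma>)) * fejer l (ln (real n) - L))"
    by (rule sum_le_suminf[OF weighted_summable(2)[OF sg b] finN]) (use b in auto)
  finally show ?thesis unfolding \<sigma>_def .
qed

text \<open>The kernel sum of \<open>\<Lambda>\<close> is at least \<open>c\<^sub>0 - C / L\<close>. By the decay of the kernel the part with
\<open>|log n - L| > \<epsilon>\<close> is at most a constant over \<open>l\<close>, and near \<open>L\<close> the kernel is at most \<open>l\<close>.\<close>
lemma mangoldt_short_interval:
  assumes e: "\<epsilon> > 0"
  shows "\<exists>c>0. \<exists>L0. \<forall>L\<ge>L0. (\<Sum>n | n > 0 \<and> \<bar>ln (real n) - L\<bar> \<le> \<epsilon>. mangoldt n / real n) \<ge> (c::real)"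
proof -
  obtain C0 where C0: "C0 > 0 \<and> (\<forall>\<sigma> L. 0 < \<sigma> \<and> \<sigma> \<le> 1 \<longrightarrow>
     (\<Sum>n. mangoldt n * real n powr (- (1 + \<sigma>)) * (1 / (1 + (ln (real n) - L)\<^sup>2))) \<le> C0)"
    using mangoldt_window_sum by (elim exE)
  define c0 where "c0 = exp (- 2) / (4::real)"
  have c0: "c0 > 0" by (simp add: c0_def)
  \<comment> \<open>For \<open>|u| > \<epsilon>\<close> the kernel is at most \<open>4 / (l u\<^sup>2) \<le> (K / l) / (1 + u\<^sup>2)\<close>.\<close>
  define K where "K = 4 * (1 + 1 / \<epsilon>\<^sup>2)"
  have K: "K > 0" using e by (simp add: K_def add_pos_pos)
  \<comment> \<open>This makes the far part at most \<open>c\<^sub>0 / 3\<close>; \<open>L\<^sub>0\<close> below does the same for the error \<open>C / L\<close>.\<close>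
  define l where "l = max 1 (3 * K * C0 / c0)"
  have l: "l \<ge> 1" "l > 0" by (auto simp: l_def)
  have "3 * K * C0 / c0 \<le> l" by (simp add: l_def)
  then have lc: "K / l * C0 \<le> c0 / 3" using c0 l by (simp add: field_simps)
  obtain C where C: "C > 0 \<and> (\<forall>\<sigma> L. 0 < \<sigma> \<and> \<sigma> \<le> 1 \<longrightarrow>
     \<bar>(\<Sum>n. mangoldt n * real n powr (- (1 + \<sigma>)) * fejer l (ln (real n) - L))
       - (\<Sum>n. real n powr (- (1 + \<sigma>)) * fejer l (ln (real n) - L))\<bar> \<le> (if L > 0 then min C (C / L) else C))"
    using mangoldt_fejer_compare[OF l(2)] by (elim exE)
  define L0 where "L0 = max 1 (max (ln (2 * l)) (3 * C / c0))"
  have main: "(\<Sum>n | n > 0 \<and> \<bar>ln (real n) - L\<bar> \<le> \<epsilon>. mangoldt n / real n) \<ge> c0 / (3 * l)" if "L \<ge> L0" for L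
  proof -
    have L: "L \<ge> 1" "ln (2 * l) \<le> L" "3 * C / c0 \<le> L" using that by (auto simp: L0_def)
    have expL: "exp L \<ge> 2 * l" using L(2) l exp_le_cancel_iff[of "ln (2 * l)" L] by simp
    have CL: "C / L \<le> c0 / 3" using L(1,3) c0 by (simp add: field_simps)
    define \<sigma> where "\<sigma> = 1 / (L + 1)"
    have sg: "0 < \<sigma>" "\<sigma> \<le> 1" using L by (auto simp: \<sigma>_def)
    let ?N = "{n. n > 0 \<and> \<bar>ln (real n) - L\<bar> \<le> \<epsilon>}"
    have "?N \<subseteq> {n::nat. exp (L - \<epsilon>) \<le> real n \<and> real n \<le> exp (L + \<epsilon>)}"
    proof
      fix n assume "n \<in> ?N"
      then have n: "real n > 0" "L - \<epsilon> \<le> ln (real n)" "ln (real n) \<le> L + \<epsilon>" by (auto simp: abs_le_iff)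
      then have "exp (L - \<epsilon>) \<le> real n" by (simp add: ln_ge_iff)
      moreover have "exp (ln (real n)) \<le> exp (L + \<epsilon>)" using n(3) by (simp only: exp_le_cancel_iff)
      ultimately show "n \<in> {n::nat. exp (L - \<epsilon>) \<le> real n \<and> real n \<le> exp (L + \<epsilon>)}"
        using n(1) by simp
    qed
    then have finN: "finite ?N" by (rule finite_subset) (rule card_nats_ge, simp)
    let ?m = "\<lambda>n. mangoldt n * real n powr (- (1 + \<sigma>))"
    let ?w = "\<lambda>n. 1 / (1 + (ln (real n) - L)\<^sup>2)"
    have b: "0 \<le> fejer l x \<and> fejer l x \<le> l" for x
      using l fejer_nonneg[of l] fejer_le[of l] by auto
    have w: "0 \<le> ?w n \<and> ?w n \<le> 1" for n
      by (simp add: add_nonneg_nonneg divide_le_eq add_pos_nonneg)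
    have m0: "?m n \<ge> 0" for n by (intro mult_nonneg_nonneg mangoldt_nonneg) auto
    have s2: "summable (\<lambda>n. ?m n * ?w n)" by (rule weighted_summable(1)[OF sg(1) w])
    have pt: "?m n * fejer l (ln (real n) - L) \<le> (if n \<in> ?N then l * (mangoldt n / real n) else 0) + K / l * (?m n * ?w n)" for n
    proof (cases "n \<in> ?N")
      case True
      then have n: "n > 0" by simp
      have "real n powr (- (1 + \<sigma>)) \<le> real n powr (-1)" using n sg by (intro powr_mono) auto
      then have "?m n \<le> mangoldt n / real n"
        using mult_left_mono[OF _ mangoldt_nonneg[of n]] n by (fastforce simp: powr_minus_divide)
      then have "?m n * fejer l (ln (real n) - L) \<le> (mangoldt n / real n) * l"
        using b m0 mangoldt_nonneg[of n] by (intro mult_mono) auto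
      moreover have "0 \<le> K / l * (?m n * ?w n)"
        by (rule mult_nonneg_nonneg[OF _ mult_nonneg_nonneg[OF m0 conjunct1[OF w]]]) (use K l in simp)
      ultimately show ?thesis using True by (simp add: mult.commute)
    next
      case False
      show ?thesis
      proof (cases "n = 0")
        case n: False
        define u where "u = ln (real n) - L"
        have u: "\<bar>u\<bar> > \<epsilon>" using False n by (auto simp: u_def)
        then have u2: "u\<^sup>2 \<ge> \<epsilon>\<^sup>2" using e by (metis abs_le_square_iff abs_of_pos less_imp_le)
        have e2: "\<epsilon>\<^sup>2 > 0" using e by simp
        have "1 \<le> u\<^sup>2 / \<epsilon>\<^sup>2" using u2 e2 by simp
        then have "4 * (1 + u\<^sup>2) \<le> 4 * (u\<^sup>2 / \<epsilon>\<^sup>2 + u\<^sup>2)" by (intro mult_left_mono) auto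
        also have "\<dots> = K * u\<^sup>2" by (simp add: K_def algebra_simps)
        finally have "4 / l * (1 + u\<^sup>2) \<le> K / l * u\<^sup>2" using l by (simp add: divide_right_mono)
        moreover have "fejer l u * u\<^sup>2 * (1 + u\<^sup>2) \<le> 4 / l * (1 + u\<^sup>2)"
          by (intro mult_right_mono fejer_mult_le l) auto
        ultimately have "(fejer l u * (1 + u\<^sup>2)) * u\<^sup>2 \<le> (K / l) * u\<^sup>2" by (simp add: mult_ac)
        moreover have "u\<^sup>2 > 0" using u2 e2 by linarith
        ultimately have "fejer l u * (1 + u\<^sup>2) \<le> K / l" by (rule mult_right_le_imp_le)
        then have "fejer l u \<le> K / l * (1 / (1 + u\<^sup>2))"
          using pos_le_divide_eq[of "1 + u\<^sup>2" "fejer l u" "K / l"] by (simp add: add_pos_nonneg)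
        from mult_left_mono[OF this m0[of n]]
        have "?m n * fejer l (ln (real n) - L) \<le> K / l * (?m n * ?w n)"
          unfolding u_def[symmetric] by (simp add: mult_ac)
        then show ?thesis using False by (simp only: if_False add_0)
      qed simp
    qed
    have sN: "(\<lambda>n. if n \<in> ?N then l * (mangoldt n / real n) else 0) sums (\<Sum>n\<in>?N. l * (mangoldt n / real n))"
      by (rule sums_If_finite_set[OF finN])
    have "c0 \<le> (\<Sum>n. real n powr (- (1 + \<sigma>)) * fejer l (ln (real n) - L))"
      unfolding c0_def \<sigma>_def by (rule fejer_sum_lower[OF l(1) L(1) expL])
    moreover have "\<bar>(\<Sum>n. ?m n * fejer l (ln (real n) - L))
       - (\<Sum>n. real n powr (- (1 + \<sigma>)) * fejer l (ln (real n) - L))\<bar> \<le> C / L"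
      using C[THEN conjunct2, rule_format, of \<sigma> L] sg L(1) by (simp split: if_splits)
    moreover have "(\<Sum>n. ?m n * fejer l (ln (real n) - L)) \<le>
        (\<Sum>n\<in>?N. l * (mangoldt n / real n)) + K / l * (\<Sum>n. ?m n * ?w n)"
      by (rule sums_le[OF pt summable_sums[OF weighted_summable(1)[OF sg(1) b]]
             sums_add[OF sN sums_mult[OF summable_sums[OF s2]]]])
    moreover have "K / l * (\<Sum>n. ?m n * ?w n) \<le> K / l * C0"
      using C0[THEN conjunct2, rule_format, of \<sigma> L] sg K l by (intro mult_left_mono) auto
    ultimately have "c0 / 3 \<le> (\<Sum>n\<in>?N. l * (mangoldt n / real n))"
      using lc CL by linarith
    then have "c0 / 3 \<le> (\<Sum>n\<in>?N. mangoldt n / real n) * l" by (simp add: sum_distrib_left mult.commute)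
    then have "c0 / 3 / l \<le> (\<Sum>n\<in>?N. mangoldt n / real n)" using l by (simp add: pos_divide_le_eq)
    then show ?thesis by simp
  qed
  show ?thesis
    using c0 l main by (intro exI[of _ "c0 / (3 * l)"] conjI exI[of _ L0]) auto
qed

text \<open>A proper prime power \<open>p\<^sup>k \<le> y\<close> has \<open>p \<le> sqrt y\<close> and \<open>k \<le> log\<^sub>2 y\<close>.\<close>
lemma card_proper_prime_powers:
  assumes y: "y \<ge> (1::real)"
  shows "finite {n::nat. primepow n \<and> \<not> prime n \<and> real n \<le> y}"
    and "real (card {n::nat. primepow n \<and> \<not> prime n \<and> real n \<le> y}) \<le> (sqrt y + 1) * (log 2 y + 1)"
proof -
  let ?A = "{n::nat. primepow n \<and> \<not> prime n \<and> real n \<le> y}"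
  let ?B = "{..nat \<lfloor>sqrt y\<rfloor>} \<times> {..nat \<lfloor>log 2 y\<rfloor>}"
  have sub: "?A \<subseteq> (\<lambda>(p, k). p ^ k) ` ?B"
  proof
    fix n assume n: "n \<in> ?A"
    then obtain p k where pk: "prime p" "k > 0" "n = p ^ k" by (auto simp: primepow_def)
    have "k \<noteq> 1" using n pk by auto
    then have k: "k \<ge> 2" using pk(2) by simp
    have p: "p \<ge> 2" using pk(1) prime_ge_2_nat by blast
    have "p ^ 2 \<le> n" unfolding pk(3) using k p by (intro power_increasing) auto
    then have "(real p)\<^sup>2 \<le> y" using n by (auto simp flip: of_nat_power)
    then have 1: "real p \<le> sqrt y" by (rule real_le_rsqrt)
    have "2 ^ k \<le> n" unfolding pk(3) using p by (intro power_mono) auto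
    then have "real (2 ^ k) \<le> real n" by (simp only: of_nat_le_iff)
    moreover have "2 powr real k = real (2 ^ k)" by (simp add: powr_realpow)
    moreover have "real n \<le> y" using n by simp
    ultimately have "2 powr real k \<le> y" by linarith
    then have 2: "real k \<le> log 2 y" using y by (simp add: le_log_iff)
    show "n \<in> (\<lambda>(p, k). p ^ k) ` ?B"
      by (rule image_eqI[of _ _ "(p, k)"]) (use pk(3) 1 2 in \<open>auto simp: le_nat_floor\<close>)
  qed
  then show "finite ?A" by (rule finite_subset) simp
  have "card ?A \<le> card ((\<lambda>(p, k). p ^ k) ` ?B)" by (rule card_mono[OF _ sub]) simp
  also have "\<dots> \<le> card ?B" by (rule card_image_le) simp
  also have "\<dots> = Suc (nat \<lfloor>sqrt y\<rfloor>) * Suc (nat \<lfloor>log 2 y\<rfloor>)" by (simp add: card_cartesian_product)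
  finally have "real (card ?A) \<le> real (Suc (nat \<lfloor>sqrt y\<rfloor>)) * real (Suc (nat \<lfloor>log 2 y\<rfloor>))"
    by (simp only: of_nat_le_iff of_nat_mult[symmetric])
  also have "\<dots> \<le> (sqrt y + 1) * (log 2 y + 1)"
  proof (intro mult_mono)
    have "log 2 y \<ge> 0" "sqrt y \<ge> 0" using y by auto
    then show "real (Suc (nat \<lfloor>sqrt y\<rfloor>)) \<le> sqrt y + 1" "real (Suc (nat \<lfloor>log 2 y\<rfloor>)) \<le> log 2 y + 1"
      "0 \<le> sqrt y + 1" by (auto simp: of_nat_nat)
  qed auto
  finally show "real (card ?A) \<le> (sqrt y + 1) * (log 2 y + 1)" .
qed

text \<open>Without a prime in the interval, the sum of \<open>\<Lambda>(n)/n\<close> over it would consist of proper prime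
powers only, hence be of order \<open>x\<^bsup>-1/2\<^esup> log\<^sup>2 x\<close> and tend to 0, against
\<open>mangoldt_short_interval\<close>.\<close>
theorem prime_short_interval:
  assumes e: "\<epsilon> > (0::real)"
  shows "\<exists>X. \<forall>x\<ge>X. \<exists>p. prime (p::nat) \<and> x \<le> real p \<and> real p \<le> x * exp \<epsilon>"
proof -
  obtain c where c: "c > 0 \<and> (\<exists>L0. \<forall>L\<ge>L0. (\<Sum>n | n > 0 \<and> \<bar>ln (real n) - L\<bar> \<le> \<epsilon> / 2. mangoldt n / real n) \<ge> (c::real))"
    using mangoldt_short_interval[of "\<epsilon> / 2"] e by auto
  then obtain L0 where L0: "\<And>L. L \<ge> L0 \<Longrightarrow> (\<Sum>n | n > 0 \<and> \<bar>ln (real n) - L\<bar> \<le> \<epsilon> / 2. mangoldt n / real n) \<ge> c" by blast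
  define f where "f = (\<lambda>x. (sqrt (x * exp \<epsilon>) + 1) * (log 2 (x * exp \<epsilon>) + 1) * (ln (x * exp \<epsilon>) / x))"
  have "(f \<longlongrightarrow> 0) at_top" unfolding f_def using e by real_asymp
  from order_tendstoD(2)[OF this c[THEN conjunct1]]
  obtain X1 where X1: "\<And>x. x \<ge> X1 \<Longrightarrow> f x < c" unfolding eventually_at_top_linorder by blast
  have main: "\<exists>p. prime (p::nat) \<and> x \<le> real p \<and> real p \<le> x * exp \<epsilon>" if "x \<ge> max 1 (max X1 (exp L0))" for x
  proof (rule ccontr)
    assume neg: "\<not> ?thesis"
    have x: "x \<ge> 1" "x \<ge> X1" "x \<ge> exp L0" using that by auto
    define y where "y = x * exp \<epsilon>"
    have y: "y \<ge> 1" unfolding y_def using mult_mono[of 1 x 1 "exp \<epsilon>"] x e by simp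
    define L where "L = ln x + \<epsilon> / 2"
    have "L0 \<le> ln x" using x by (simp add: ln_ge_iff)
    then have L: "L \<ge> L0" using e by (simp add: L_def)
    let ?N = "{n. n > 0 \<and> \<bar>ln (real n) - L\<bar> \<le> \<epsilon> / 2}"
    let ?A = "{n::nat. primepow n \<and> \<not> prime n \<and> real n \<le> y}"
    have N: "x \<le> real n \<and> real n \<le> y" if "n \<in> ?N" for n
    proof -
      have n: "n > 0" using that by simp
      have "\<bar>ln (real n) - L\<bar> \<le> \<epsilon> / 2" using that by simp
      then have "ln x \<le> ln (real n)" "ln (real n) \<le> ln x + \<epsilon>" unfolding L_def by linarith+
      moreover have "ln x + \<epsilon> = ln y" using x by (simp add: y_def ln_mult)
      ultimately show ?thesis using n x y by (simp add: ln_le_cancel_iff)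
    qed
    have finN: "finite ?N"
      by (rule finite_subset[OF _ card_nats_ge(2)[of x y]]) (use N x in auto)
    have "c \<le> (\<Sum>n\<in>?N. mangoldt n / real n)" by (rule L0[OF L])
    also have "\<dots> = (\<Sum>n\<in>?N \<inter> ?A. mangoldt n / real n)"
    proof (rule sum.mono_neutral_right[OF finN])
      show "\<forall>i\<in>?N - ?N \<inter> ?A. mangoldt i / real i = 0"
      proof
        fix n assume n: "n \<in> ?N - ?N \<inter> ?A"
        then have "x \<le> real n \<and> real n \<le> y" using N by blast
        then have "\<not> primepow n" using n neg unfolding y_def by blast
        then show "mangoldt n / real n = 0" by (simp add: mangoldt_def)
      qed
    qed auto
    also have "\<dots> \<le> (\<Sum>n\<in>?N \<inter> ?A. ln y / x)"
    proof (rule sum_mono)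
      fix n assume "n \<in> ?N \<inter> ?A"
      then have n: "n > 0" "x \<le> real n" "real n \<le> y" using N by auto
      have "mangoldt n \<le> ln (real n)" using mangoldt_le[OF n(1)] .
      also have "\<dots> \<le> ln y" using n y by simp
      finally show "mangoldt n / real n \<le> ln y / x"
        using n x y by (intro frac_le) auto
    qed
    also have "\<dots> = real (card (?N \<inter> ?A)) * (ln y / x)" by simp
    also have "\<dots> \<le> real (card ?A) * (ln y / x)"
      using card_mono[OF card_proper_prime_powers(1)[OF y], of "?N \<inter> ?A"] x y by (intro mult_right_mono) auto
    also have "\<dots> \<le> (sqrt y + 1) * (log 2 y + 1) * (ln y / x)"
      using card_proper_prime_powers(2)[OF y] x y by (intro mult_right_mono) auto
    also have "\<dots> = f x" by (simp add: f_def y_def)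
    finally show False using X1[OF x(2)] by simp
  qed
  then show ?thesis by blast
qed

section \<open>Modular Sidon sets and interleaving\<close>

lemma R_set_finite: "finite {card S | S. S \<subseteq> {1..int n} \<and> B_star g S}"
  by (rule finite_subset[of _ "card ` Pow {1..int n}"]) auto

lemma R_ge:
  assumes "S \<subseteq> {1..int n}" "B_star g S"
  shows "card S \<le> R g n"
  unfolding R_def by (rule Max_ge[OF R_set_finite]) (use assms in blast)

lemma R_attained: "\<exists>S. S \<subseteq> {1..int n} \<and> B_star g S \<and> card S = R g n"
proof -
  have "B_star g {}" by (simp add: B_star_def)
  then have "{card S | S. S \<subseteq> {1..int n} \<and> B_star g S} \<noteq> {}" by blast
  from Max_in[OF R_set_finite this] have "R g n \<in> {card S | S. S \<subseteq> {1..int n} \<and> B_star g S}"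
    unfolding R_def .
  then obtain S where "R g n = card S" "S \<subseteq> {1..int n}" "B_star g S" by blast
  then show ?thesis by auto
qed

lemma R_mono:
  assumes "g \<le> h"
  shows "R g n \<le> R h n"
proof -
  obtain S where S: "S \<subseteq> {1..int n}" "B_star g S" "card S = R g n" using R_attained by blast
  have "B_star h S" using S(2) assms unfolding B_star_def by (meson le_trans)
  then show ?thesis using R_ge S by metis
qed

lemma B_starI:
  assumes fin: "finite S" and le: "\<And>m. card {s \<in> S. m - s \<in> S} \<le> g"
  shows "B_star g S"
  unfolding B_star_def
proof (intro allI conjI)
  fix m
  have eq: "{(s1, s2) \<in> S \<times> S. s1 + s2 = m} = (\<lambda>s. (s, m - s)) ` {s \<in> S. m - s \<in> S}"
    by (auto simp: image_iff algebra_simps)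
  show "finite {(s1, s2) \<in> S \<times> S. s1 + s2 = m}" unfolding eq using fin by simp
  show "card {(s1, s2) \<in> S \<times> S. s1 + s2 = m} \<le> g"
    unfolding eq by (subst card_image) (auto simp: inj_on_def le)
qed

definition sidon_mod :: "int \<Rightarrow> int set \<Rightarrow> bool" where
  "sidon_mod N S \<longleftrightarrow> (\<forall>a\<in>S. \<forall>b\<in>S. \<forall>c\<in>S. \<forall>d\<in>S.
      [a + b = c + d] (mod N) \<longrightarrow> (a = c \<and> b = d) \<or> (a = d \<and> b = c))"

text \<open>Exponents are read modulo \<open>p - 1\<close> and powers of the primitive root \<open>\<theta>\<close> modulo \<open>p\<close>. A sum
of two elements therefore determines \<open>i + j\<close> modulo \<open>p - 1\<close>, hence the product \<open>\<theta>\<^sup>i \<theta>\<^sup>j\<close>, and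
also \<open>\<theta>\<^sup>i + \<theta>\<^sup>j\<close> modulo \<open>p\<close>; sum and product determine the pair.\<close>
lemma ruzsa_sidon_set:
  fixes p :: nat
  assumes p: "prime p"
  shows "\<exists>S. S \<subseteq> {0..<int (p * (p - 1))} \<and> card S = p - 1 \<and> sidon_mod (int (p * (p - 1))) S"
proof -
  have p2: "p \<ge> 2" using p prime_ge_2_nat by blast
  obtain \<theta> where th: "residue_primroot p \<theta>" using prime_primitive_root_exists[of p] p p2 by auto
  have cop: "coprime p \<theta>" and ordth: "ord p \<theta> = p - 1"
    using th p by (auto simp: residue_primroot_def totient_prime)
  define P where "P = int p"
  have P: "P \<ge> 2" "prime P" using p p2 by (auto simp: P_def)
  have Pm: "P - 1 = int (p - 1)" using p2 by (simp add: P_def of_nat_diff)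
  define N where "N = P * (P - 1)"
  have N: "int (p * (p - 1)) = N" using p2 by (simp add: N_def P_def of_nat_diff)
  have N0: "N > 0" using P by (simp add: N_def)
  \<comment> \<open>The Chinese remainder solution of \<open>s i \<equiv> i (mod p - 1)\<close> and \<open>s i \<equiv> \<theta>\<^sup>i (mod p)\<close>.\<close>
  define s where "s i = (P * int i - (P - 1) * int \<theta> ^ i) mod N" for i :: nat
  have sp: "[s i = int \<theta> ^ i] (mod P)" for i
  proof -
    have "[s i = P * int i - (P - 1) * int \<theta> ^ i] (mod P)"
      unfolding s_def N_def cong_def by (rule mod_mod_cancel) simp
    also have "P * int i - (P - 1) * int \<theta> ^ i = int \<theta> ^ i + P * (int i - int \<theta> ^ i)" by (simp add: algebra_simps)
    also have "[int \<theta> ^ i + P * (int i - int \<theta> ^ i) = int \<theta> ^ i] (mod P)" by (simp add: cong_def)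
    finally show ?thesis .
  qed
  have sq: "[s i = int i] (mod (P - 1))" for i
  proof -
    have "[s i = P * int i - (P - 1) * int \<theta> ^ i] (mod (P - 1))"
      unfolding s_def N_def cong_def by (rule mod_mod_cancel) simp
    also have "P * int i - (P - 1) * int \<theta> ^ i = int i + (P - 1) * (int i - int \<theta> ^ i)" by (simp add: algebra_simps)
    also have "[int i + (P - 1) * (int i - int \<theta> ^ i) = int i] (mod (P - 1))" by (simp add: cong_def)
    finally show ?thesis .
  qed
  have small: "i = j" if "[int i = int j] (mod (P - 1))" "i < p - 1" "j < p - 1" for i j
  proof -
    have "[i = j] (mod (p - 1))" using that(1) unfolding Pm cong_int_iff .
    then show ?thesis using that by (simp add: cong_def)
  qed
  have powexp: "[int \<theta> ^ i = int \<theta> ^ j] (mod P)" if "[int i = int j] (mod (P - 1))" for i j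
  proof -
    have "[i = j] (mod (p - 1))" using that(1) unfolding Pm cong_int_iff .
    then have "[\<theta> ^ i = \<theta> ^ j] (mod p)" using order_divides_expdiff[OF cop, of i j] ordth by simp
    then show ?thesis unfolding P_def by (simp add: cong_int_iff flip: of_nat_power)
  qed
  have powinj: "i = j" if "[int \<theta> ^ i = int \<theta> ^ j] (mod P)" "i < p - 1" "j < p - 1" for i j
  proof -
    have "[\<theta> ^ i = \<theta> ^ j] (mod p)" using that(1) unfolding P_def by (simp add: cong_int_iff flip: of_nat_power)
    then have "[i = j] (mod (p - 1))" using order_divides_expdiff[OF cop, of i j] ordth by simp
    then show ?thesis using that by (simp add: cong_def)
  qed
  have key: "(i = k \<and> j = l) \<or> (i = l \<and> j = k)"
    if c: "[s i + s j = s k + s l] (mod N)" and lt: "i < p - 1" "j < p - 1" "k < p - 1" "l < p - 1" for i j k l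
  proof -
    have cq: "[int i + int j = int k + int l] (mod (P - 1))"
    proof -
      have "[s i + s j = s k + s l] (mod (P - 1))" using c unfolding N_def by (rule cong_modulus_mult[of _ _ "P - 1" P, simplified mult.commute])
      then show ?thesis using cong_add[OF sq[of i] sq[of j]] cong_add[OF sq[of k] sq[of l]] by (meson cong_sym cong_trans)
    qed
    let ?a = "int \<theta> ^ i" and ?b = "int \<theta> ^ j" and ?c = "int \<theta> ^ k" and ?d = "int \<theta> ^ l"
    have sum: "[?a + ?b = ?c + ?d] (mod P)"
    proof -
      have "[s i + s j = s k + s l] (mod P)" using c unfolding N_def by (rule cong_modulus_mult)
      then show ?thesis using cong_add[OF sp[of i] sp[of j]] cong_add[OF sp[of k] sp[of l]] by (meson cong_sym cong_trans)
    qed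
    have prd: "[?a * ?b = ?c * ?d] (mod P)"
      using powexp[of "i + j" "k + l"] cq by (simp add: power_add)
    \<comment> \<open>\<open>\<theta>\<^sup>i\<close> is a root of the quadratic polynomial with roots \<open>\<theta>\<^sup>k\<close> and \<open>\<theta>\<^sup>l\<close>.\<close>
    have "(?a - ?c) * (?a - ?d) = ?a * ((?a + ?b) - (?c + ?d)) - (?a * ?b - ?c * ?d)" by (simp add: algebra_simps)
    moreover have "P dvd ?a * ((?a + ?b) - (?c + ?d)) - (?a * ?b - ?c * ?d)"
      using sum prd unfolding cong_iff_dvd_diff by (rule dvd_diff[OF dvd_mult])
    ultimately have "P dvd (?a - ?c) * (?a - ?d)" by simp
    then have "P dvd ?a - ?c \<or> P dvd ?a - ?d" using P(2) by (simp add: prime_dvd_mult_iff)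
    then have "i = k \<or> i = l" using powinj[of i k] powinj[of i l] lt by (auto simp: cong_iff_dvd_diff)
    then show ?thesis
    proof
      assume "i = k"
      then have "j = l" using cq small[of j l] lt by (simp add: cong_add_lcancel)
      then show ?thesis using \<open>i = k\<close> by simp
    next
      assume "i = l"
      then have "j = k" using cq small[of j k] lt by (simp add: cong_add_lcancel add.commute[of "int k"])
      then show ?thesis using \<open>i = l\<close> by simp
    qed
  qed
  have inj: "inj_on s {..<p - 1}"
    using key[of _ _ _ _] by (intro inj_onI) (metis cong_refl lessThan_iff)
  let ?S = "s ` {..<p - 1}"
  have "?S \<subseteq> {0..<N}" using N0 by (auto simp: s_def)
  moreover have "card ?S = p - 1" using inj by (simp add: card_image)
  moreover have "sidon_mod N ?S" unfolding sidon_mod_def using key by fastforce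
  ultimately show ?thesis unfolding N by (intro exI[of _ ?S]) simp
qed

text \<open>Given one representation of \<open>M\<close>, the Sidon property leaves two orders for the residues of
any other one, and each order fixes the sum of the two elements of \<open>A\<close>. So all representations
lie in the union of two images of the representations of one number by \<open>A\<close>.\<close>
lemma interleave_B_star:
  fixes A S :: "int set"
  assumes A: "A \<subseteq> {0..<m}" "B_star g A" and S: "S \<subseteq> {0..<N}" "sidon_mod N S"
  shows "\<exists>T. T \<subseteq> {1..m * N} \<and> card T = card A * card S \<and> B_star (2 * g) T"
proof -
  define f where "f = (\<lambda>(a, s). 1 + s + N * a)"
  define T where "T = f ` (A \<times> S)"
  have finA: "finite A" and finS: "finite S" using A(1) S(1) by (auto intro: finite_subset)
  have fs: "(f (a, s) - 1) mod N = s" "(f (a, s) - 1) div N = a" if "s \<in> S" for a s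
    using that S(1) by (auto simp: f_def div_pos_pos_trivial)
  have inj: "inj_on f (A \<times> S)"
    by (rule inj_onI) (metis fs mem_Sigma_iff surj_pair)
  have "T \<subseteq> {1..m * N}"
  proof
    fix t assume "t \<in> T"
    then obtain a s where as: "a \<in> A" "s \<in> S" "t = 1 + s + N * a" by (auto simp: T_def f_def)
    have b: "0 \<le> a" "a \<le> m - 1" "0 \<le> s" "s + 1 \<le> N" using as A(1) S(1) by force+
    have "N * a \<le> N * (m - 1)" using b by (intro mult_left_mono) auto
    moreover have "0 \<le> N * a" using b by auto
    ultimately show "t \<in> {1..m * N}" using b as(3) by (simp add: algebra_simps)
  qed
  moreover have "card T = card A * card S" unfolding T_def using inj by (simp add: card_image card_cartesian_product)
  moreover have "B_star (2 * g) T"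
    unfolding B_star_def
  proof
    fix M
    let ?X = "{(s1, s2) \<in> T \<times> T. s1 + s2 = M}"
    have finX: "finite ?X"
      by (rule finite_subset[of _ "T \<times> T"]) (auto simp: T_def finA finS)
    have "card ?X \<le> 2 * g"
    proof (cases "?X = {}")
      case True
      then have "card ?X = 0" by (simp only: card.empty)
      then show ?thesis by simp
    next
      case False
      then obtain a0 s0 a1 s1 where 0: "a0 \<in> A" "s0 \<in> S" "a1 \<in> A" "s1 \<in> S"
        "f (a0, s0) + f (a1, s1) = M" by (auto simp: T_def)
      define q where "q = a0 + a1"
      let ?P = "{(x, y) \<in> A \<times> A. x + y = q}"
      have finP: "finite ?P" and cardP: "card ?P \<le> g" using A(2) unfolding B_star_def by blast+
      let ?f1 = "\<lambda>(x, y). (f (x, s0), f (y, s1))" and ?f2 = "\<lambda>(x, y). (f (x, s1), f (y, s0))"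
      have N0: "N > 0" using 0(2) S(1) by auto
      have "?X \<subseteq> ?f1 ` ?P \<union> ?f2 ` ?P"
      proof
        fix z assume "z \<in> ?X"
        then obtain b0 t0 b1 t1 where b: "b0 \<in> A" "t0 \<in> S" "b1 \<in> A" "t1 \<in> S"
          "f (b0, t0) + f (b1, t1) = M" "z = (f (b0, t0), f (b1, t1))" by (auto simp: T_def)
        have eq: "t0 + t1 + N * (b0 + b1) = s0 + s1 + N * (a0 + a1)"
          using b(5) 0(5) by (simp add: f_def algebra_simps)
        then have "[t0 + t1 = s0 + s1] (mod N)" by (metis cong_def mod_mult_self2)
        then have d: "(t0 = s0 \<and> t1 = s1) \<or> (t0 = s1 \<and> t1 = s0)"
          using S(2) b 0 unfolding sidon_mod_def by blast
        then have "N * (b0 + b1) = N * (a0 + a1)" using eq by auto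
        then have "(b0, b1) \<in> ?P" using N0 b by (simp add: q_def)
        then show "z \<in> ?f1 ` ?P \<union> ?f2 ` ?P" using d b(6) by force
      qed
      then have "card ?X \<le> card (?f1 ` ?P \<union> ?f2 ` ?P)" by (rule card_mono[rotated]) (use finP in simp)
      also have "\<dots> \<le> card (?f1 ` ?P) + card (?f2 ` ?P)" by (rule card_Un_le)
      also have "\<dots> \<le> card ?P + card ?P" by (intro add_mono card_image_le finP)
      finally show ?thesis using cardP by simp
    qed
    then show "finite ?X \<and> card ?X \<le> 2 * g" using finX by simp
  qed
  ultimately show ?thesis by blast
qed

lemma R_ge_prime:
  assumes A: "A \<subseteq> {0..<int m}" "B_star g A" and p: "prime p" and n: "m * (p * (p - 1)) \<le> n"
  shows "card A * (p - 1) \<le> R (2 * g) n"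
proof -
  obtain S where S: "S \<subseteq> {0..<int (p * (p - 1))}" "card S = p - 1" "sidon_mod (int (p * (p - 1))) S"
    using ruzsa_sidon_set[OF p] by blast
  obtain T where T: "T \<subseteq> {1..int m * int (p * (p - 1))}" "card T = card A * card S" "B_star (2 * g) T"
    using interleave_B_star[OF A S(1,3)] by blast
  have "int m * int (p * (p - 1)) \<le> int n" using n by (simp only: of_nat_mult[symmetric] of_nat_le_iff)
  then have "T \<subseteq> {1..int n}" using T(1) by auto
  from R_ge[OF this T(3)] show ?thesis using T(2) S(2) by simp
qed

text \<open>The prime \<open>p\<close> is chosen just below \<open>y = sqrt (n / m)\<close>, so that \<open>m p\<^sup>2 \<le> n\<close>. The threshold
depends on \<open>\<epsilon>\<close> alone.\<close>
lemma R_lower: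
  assumes e: "0 < \<epsilon>" "\<epsilon> < (1::real)"
  shows "\<exists>X. \<forall>g m n A. A \<subseteq> {0..<int m} \<and> B_star g A \<and> 0 < m \<and> X \<le> real n / real m \<longrightarrow>
           (1 - \<epsilon>) * real (card A) * sqrt (real n / real m) \<le> real (R (2 * g) n)"
proof -
  obtain X0 where X0: "\<forall>x\<ge>X0. \<exists>p. prime (p::nat) \<and> x \<le> real p \<and> real p \<le> x * exp (\<epsilon> / 2)"
    using prime_short_interval[of "\<epsilon> / 2"] e by auto
  \<comment> \<open>Half of \<open>\<epsilon>\<close> is lost to the gap between \<open>p\<close> and \<open>y\<close>; for \<open>y \<ge> 2 / \<epsilon>\<close> the other half covers the loss from \<open>p\<close> to \<open>p - 1\<close>.\<close>
  define Y where "Y = max (2 / \<epsilon>) (max 1 X0 * exp (\<epsilon> / 2))"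
  have Y0: "Y > 0" using e unfolding Y_def less_max_iff_disj by simp
  have main: "(1 - \<epsilon>) * real (card A) * sqrt (real n / real m) \<le> real (R (2 * g) n)"
    if A: "A \<subseteq> {0..<int m}" "B_star g A" and m: "0 < m" and n: "Y\<^sup>2 \<le> real n / real m" for g m n A
  proof -
    define y where "y = sqrt (real n / real m)"
    have y: "Y \<le> y" unfolding y_def using n by (rule real_le_rsqrt)
    define x where "x = y * exp (- (\<epsilon> / 2))"
    have xy: "x * exp (\<epsilon> / 2) = y" by (simp add: x_def mult.assoc exp_add[symmetric])
    have "max 1 X0 * exp (\<epsilon> / 2) \<le> x * exp (\<epsilon> / 2)" unfolding xy using y by (simp add: Y_def)
    then have x0: "max 1 X0 \<le> x" by simp
    then obtain p where p: "prime p" "x \<le> real p" "real p \<le> y" using X0 xy by force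
    have y0: "y > 0" using y Y0 by linarith
    have "(real p)\<^sup>2 \<le> y\<^sup>2" using p(3) by (intro power_mono) auto
    also have "\<dots> = real n / real m" by (simp add: y_def)
    finally have "real m * (real p)\<^sup>2 \<le> real n" using m by (simp add: field_simps)
    then have "m * p\<^sup>2 \<le> n" by (simp flip: of_nat_power of_nat_mult)
    moreover have "m * (p * (p - 1)) \<le> m * p\<^sup>2"
      unfolding power2_eq_square by (intro mult_le_mono) auto
    ultimately have "m * (p * (p - 1)) \<le> n" by (rule le_trans[rotated])
    from R_ge_prime[OF A p(1) this] have R: "real (card A) * real (p - 1) \<le> real (R (2 * g) n)"
      by (simp flip: of_nat_mult)
    have "2 / \<epsilon> \<le> y" using y by (simp add: Y_def)
    then have "1 \<le> \<epsilon> / 2 * y" using e by (simp add: field_simps)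
    moreover have "(1 - \<epsilon> / 2) * y \<le> x"
      using exp_ge_add_one_self[of "- (\<epsilon> / 2)"] y0 unfolding x_def by (subst mult.commute) (intro mult_left_mono, auto)
    ultimately have "(1 - \<epsilon>) * y \<le> x - 1" by (simp add: algebra_simps)
    also have "\<dots> \<le> real (p - 1)" using p(2) prime_gt_0_nat[OF p(1)] by (simp add: of_nat_diff)
    finally have "real (card A) * ((1 - \<epsilon>) * y) \<le> real (card A) * real (p - 1)" by (rule mult_left_mono) simp
    with R show ?thesis unfolding y_def by (simp add: mult_ac)
  qed
  then show ?thesis by (intro exI[of _ "Y\<^sup>2"]) blast
qed

lemma rho_lower_ge:
  assumes A: "A \<subseteq> {0..<int m}" "B_star g A" and m: "0 < m" and g: "0 < g"
  shows "ereal (real (card A) / sqrt (2 * real g * real m)) \<le> rho_lower (2 * g)"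
proof -
  let ?c = "real (card A) / sqrt (2 * real g * real m)"
  have c0: "?c \<ge> 0" by simp
  have "ereal ((1 - \<epsilon>) * ?c) \<le> rho_lower (2 * g)" if e: "0 < \<epsilon>" "\<epsilon> < 1" for \<epsilon>
  proof -
    obtain X where X: "\<forall>g m n A. A \<subseteq> {0..<int m} \<and> B_star g A \<and> 0 < m \<and> X \<le> real n / real m \<longrightarrow>
           (1 - \<epsilon>) * real (card A) * sqrt (real n / real m) \<le> real (R (2 * g) n)"
      using R_lower[OF e] by blast
    have "eventually (\<lambda>n. real n \<ge> X * real m) sequentially"
      using filterlim_real_sequentially by (simp add: filterlim_at_top)
    then have "\<forall>\<^sub>F n in sequentially. ereal ((1 - \<epsilon>) * ?c) \<le> ereal (real (R (2 * g) n) / sqrt (real (2 * g) * real n))"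
      using eventually_gt_at_top[of 0]
    proof eventually_elim
      case (elim n)
      have "X \<le> real n / real m" using elim m by (simp add: field_simps)
      with X A m have "(1 - \<epsilon>) * real (card A) * sqrt (real n / real m) \<le> real (R (2 * g) n)" by blast
      then have "(1 - \<epsilon>) * real (card A) * sqrt (real n / real m) / sqrt (real (2 * g) * real n)
          \<le> real (R (2 * g) n) / sqrt (real (2 * g) * real n)" by (rule divide_right_mono) simp
      moreover have "(1 - \<epsilon>) * real (card A) * sqrt (real n / real m) / sqrt (real (2 * g) * real n) = (1 - \<epsilon>) * ?c"
        using elim m g by (simp add: real_sqrt_mult real_sqrt_divide field_simps)
      ultimately show ?case by simp
    qed
    then show ?thesis unfolding rho_lower_def by (rule Liminf_bounded)
  qed
  note le = this
  show ?thesis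
  proof (rule tendsto_upperbound)
    show "((\<lambda>\<epsilon>. ereal ((1 - \<epsilon>) * ?c)) \<longlongrightarrow> ereal ?c) (at_right 0)"
      by (rule tendsto_eq_intros tendsto_ident_at refl)+ simp
    show "\<forall>\<^sub>F \<epsilon> in at_right 0. ereal ((1 - \<epsilon>) * ?c) \<le> rho_lower (2 * g)"
      using eventually_at_right_real[OF zero_less_one] by eventually_elim (use le in auto)
  qed simp
qed

section \<open>A family of dense sets with few representations\<close>

text \<open>Integer-valued, so that the counting below is linear integer arithmetic.\<close>
definition reps :: "int set \<Rightarrow> int set \<Rightarrow> int \<Rightarrow> int" where
  "reps X Y m = int (card {s \<in> X. m - s \<in> Y})"

text \<open>A trapezoidal bound on a number \<open>x\<close> of representations of \<open>m\<close>: zero outside \<open>[lo, hi]\<close>,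
never above \<open>cap\<close>, and climbing from each end with slope \<open>1/d\<close>. This is the shape of the
representation function of an interval (\<open>d = 1\<close>) or of a progression of difference \<open>d\<close> paired
with an interval.\<close>
definition ramp :: "int \<Rightarrow> int \<Rightarrow> int \<Rightarrow> int \<Rightarrow> int \<Rightarrow> int \<Rightarrow> bool" where
  "ramp d lo hi cap m x \<longleftrightarrow> x \<le> cap \<and> (m < lo \<longrightarrow> x = 0) \<and> (hi < m \<longrightarrow> x = 0) \<and>
     (lo \<le> m \<longrightarrow> d * x \<le> m - lo + d) \<and> (m \<le> hi \<longrightarrow> d * x \<le> hi - m + d)"

definition prog :: "int \<Rightarrow> int \<Rightarrow> int \<Rightarrow> int set" where
  "prog d a w = (\<lambda>j. a + d * j) ` {0..<w}"

lemma finite_prog [simp]: "finite (prog d a w)"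
  by (simp add: prog_def)

text \<open>The index \<open>j\<close> of the summand from the progression is confined to \<open>[0, w)\<close>, from above by
\<open>m - a - d j \<ge> b\<close> and from below by \<open>m - a - d j \<le> e\<close>.\<close>
lemma ramp_reps:
  assumes d: "d > 0" and w: "w \<ge> 0" and Y: "Y \<subseteq> {b..e}" 
  shows "ramp d (a + b) (a + d * (w - 1) + e) w m (reps (prog d a w) Y m)"
proof -
  let ?S = "{s \<in> prog d a w. m - s \<in> Y}"
  let ?f = "\<lambda>j. a + d * j"
  have bound: "reps (prog d a w) Y m \<le> max 0 (v - u + 1)"
    if "\<And>j. \<lbrakk>0 \<le> j; j < w; m - ?f j \<in> Y\<rbrakk> \<Longrightarrow> u \<le> j \<and> j \<le> v" for u v
  proof -
    have "?S \<subseteq> ?f ` {u..v}"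
      using that by (auto simp: prog_def)
    then have "card ?S \<le> card (?f ` {u..v})" by (rule card_mono[rotated]) simp
    also have "\<dots> \<le> card {u..v}" by (rule card_image_le) simp
    finally show ?thesis by (simp add: reps_def)
  qed
  have 1: "reps (prog d a w) Y m \<le> w" using bound[of 0 "w - 1"] w by simp
  have nn: "0 \<le> reps (prog d a w) Y m" by (simp add: reps_def)
  have le: "d * j \<le> m - a - b \<and> a + d * j \<ge> m - e" if "m - ?f j \<in> Y" for j
    using subsetD[OF Y that] by auto
  have j0: "d * j \<ge> 0" if "0 \<le> j" for j using d that by simp
  have jw: "d * j \<le> d * (w - 1)" if "j < w" for j using d that by simp
  have 2: "reps (prog d a w) Y m = 0" if "m < a + b"
    using bound[of 0 "-1"] le j0 that nn by force
  have 3: "reps (prog d a w) Y m = 0" if "a + d * (w - 1) + e < m"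
    using bound[of 0 "-1"] le jw that nn by force
  have 4: "d * reps (prog d a w) Y m \<le> m - (a + b) + d" if "a + b \<le> m"
  proof -
    let ?v = "(m - a - b) div d"
    have v0: "?v \<ge> 0" using that d by (simp add: pos_imp_zdiv_nonneg_iff)
    have "j \<le> ?v" if "m - ?f j \<in> Y" for j
      using le[OF that] d by (metis mult.commute zdiv_mono1 nonzero_mult_div_cancel_right less_irrefl)
    then have "reps (prog d a w) Y m \<le> max 0 (?v - 0 + 1)" by (intro bound) auto
    then have "reps (prog d a w) Y m \<le> ?v + 1" using v0 by simp
    then have "d * reps (prog d a w) Y m \<le> d * (?v + 1)" using d by (intro mult_left_mono) auto
    also have "\<dots> = d * ?v + d" by (simp add: algebra_simps)
    also have "d * ?v \<le> m - a - b" using d by (simp add: minus_mod_eq_mult_div[symmetric])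
    finally show ?thesis by simp
  qed
  have 5: "d * reps (prog d a w) Y m \<le> a + d * (w - 1) + e - m + d" if "m \<le> a + d * (w - 1) + e"
  proof -
    let ?v = "(a + d * (w - 1) + e - m) div d"
    have v0: "?v \<ge> 0" using that d by (simp add: pos_imp_zdiv_nonneg_iff)
    have "w - 1 - ?v \<le> j" if "m - ?f j \<in> Y" for j
    proof -
      have "d * (w - 1 - j) \<le> a + d * (w - 1) + e - m" using le[OF that] by (simp add: algebra_simps)
      then have "w - 1 - j \<le> ?v"
        using d by (metis mult.commute zdiv_mono1 nonzero_mult_div_cancel_right less_irrefl)
      then show ?thesis by simp
    qed
    then have "reps (prog d a w) Y m \<le> max 0 ((w - 1) - (w - 1 - ?v) + 1)" by (intro bound) auto
    then have "reps (prog d a w) Y m \<le> ?v + 1" using v0 by simp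
    then have "d * reps (prog d a w) Y m \<le> d * (?v + 1)" using d by (intro mult_left_mono) auto
    also have "\<dots> = d * ?v + d" by (simp add: algebra_simps)
    also have "d * ?v \<le> a + d * (w - 1) + e - m" using d by (simp add: minus_mod_eq_mult_div[symmetric])
    finally show ?thesis by simp
  qed
  show ?thesis unfolding ramp_def using 1 2 3 4 5 by simp
qed

lemma ramp_cap: "ramp d lo hi cap m x \<Longrightarrow> x \<le> cap"
  and ramp_lo: "ramp d lo hi cap m x \<Longrightarrow> m < lo \<Longrightarrow> x = 0"
  and ramp_hi: "ramp d lo hi cap m x \<Longrightarrow> hi < m \<Longrightarrow> x = 0"
  and ramp_rise: "ramp d lo hi cap m x \<Longrightarrow> lo \<le> m \<Longrightarrow> d * x \<le> m - lo + d"
  and ramp_fall: "ramp d lo hi cap m x \<Longrightarrow> m \<le> hi \<Longrightarrow> d * x \<le> hi - m + d"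
  by (simp_all add: ramp_def)

text \<open>The indices stand for the four blocks \<open>[0, k)\<close> (1), the progression of difference two that
starts at \<open>g - k\<close> (p), \<open>[g, g + k)\<close> (2) and \<open>[2g - k + 1, 3g - k]\<close> (3). The trapezoids are
placed so that one falls while another rises: for instance, between \<open>2g\<close> and \<open>2g + 2l\<close>, 13 is at
its cap \<open>k\<close> and counted twice, while 22 climbs as fast as twice p2 descends. The total is then
at most \<open>2k + 2l \<le> 3k\<close>. From \<open>4g\<close> on only 33 remains, with cap \<open>g\<close>. The case distinction follows
the ends of the trapezoids.\<close>
lemma block_count_bound:
  fixes g k l m :: int
  assumes l: "0 \<le> l" "2 * l \<le> k" "3 * k \<le> g"
    and h11: "ramp 1 0 (2 * k - 2) k m x11"
    and hp1: "ramp 2 (g - k) (g + 2 * l - 3) l m xp1"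
    and h12: "ramp 1 g (g + 2 * k - 2) k m x12"
    and h13: "ramp 1 (2 * g - k + 1) (3 * g - 1) k m x13"
    and hpp: "ramp 2 (2 * g - 2 * k) (2 * g - 2 * k + 4 * l - 4) l m xpp"
    and hp2: "ramp 2 (2 * g - k) (2 * g + 2 * l - 3) l m xp2"
    and hp3: "ramp 2 (3 * g - 2 * k + 1) (4 * g - 2 * k + 2 * l - 2) l m xp3"
    and h22: "ramp 1 (2 * g) (2 * g + 2 * k - 2) k m x22"
    and h23: "ramp 1 (3 * g - k + 1) (4 * g - 1) k m x23"
    and h33: "ramp 1 (4 * g - 2 * k + 2) (6 * g - 2 * k) g m x33"
  shows "x11 + x22 + x33 + xpp + 2 * xp1 + 2 * x12 + 2 * x13 + 2 * xp2 + 2 * xp3 + 2 * x23 \<le> g"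
proof -
  note h = h11 hp1 h12 h13 hpp hp2 hp3 h22 h23 h33
  note h' = h[unfolded ramp_def]
  consider "m < g - k" | "g - k \<le> m" "m < 2 * g - 2 * k" | "2 * g - 2 * k \<le> m" "m < 2 * g - k" | "2 * g - k \<le> m" "m < 2 * g"
    | "2 * g \<le> m" "m \<le> 3 * g - 2 * k" | "3 * g - 2 * k < m" "m \<le> 3 * g - k"
    | "3 * g - k < m" "m < 3 * g" | "3 * g \<le> m" "m < 4 * g - 2 * k + 2" | "4 * g - 2 * k + 2 \<le> m" "m < 4 * g"
    | "4 * g \<le> m"
    by linarith
  then show ?thesis
  proof cases
    case 1
    then show ?thesis using h' l by simp
  next
    case 2
    then show ?thesis using h' l by simp
  next
    case 3
    then show ?thesis using h' l by simp
  next
    case 4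
    have z11: "x11 = 0" by (rule ramp_hi[OF h11]) (use 4 l in linarith)
    have zp1: "xp1 = 0" by (rule ramp_hi[OF hp1]) (use 4 l in linarith)
    have z12: "x12 = 0" by (rule ramp_hi[OF h12]) (use 4 l in linarith)
    have zp3: "xp3 = 0" by (rule ramp_lo[OF hp3]) (use 4 l in linarith)
    have z22: "x22 = 0" by (rule ramp_lo[OF h22]) (use 4 l in linarith)
    have z23: "x23 = 0" by (rule ramp_lo[OF h23]) (use 4 l in linarith)
    have z33: "x33 = 0" by (rule ramp_lo[OF h33]) (use 4 l in linarith)
    have b13: "x13 \<le> m - 2 * g + k"
      using ramp_lo[OF h13] ramp_rise[OF h13] 4 by (cases "m = 2 * g - k") auto
    have bp2: "2 * xp2 \<le> m - (2 * g - k) + 2" by (rule ramp_rise[OF hp2]) (use 4 in linarith)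
    show ?thesis
    proof (cases "m \<le> 2 * g - 2 * k + 4 * l - 4")
      case True
      from ramp_fall[OF hpp True] True show ?thesis
        using b13 bp2 4 l z11 zp1 z12 zp3 z22 z23 z33 by linarith
    next
      case False
      then have "xpp = 0" by (intro ramp_hi[OF hpp]) linarith
      then show ?thesis using b13 ramp_cap[OF hp2] 4 l z11 zp1 z12 zp3 z22 z23 z33 by linarith
    qed
  next
    case 5
    have z11: "x11 = 0" by (rule ramp_hi[OF h11]) (use 5 l in linarith)
    have zp1: "xp1 = 0" by (rule ramp_hi[OF hp1]) (use 5 l in linarith)
    have z12: "x12 = 0" by (rule ramp_hi[OF h12]) (use 5 l in linarith)
    have zpp: "xpp = 0" by (rule ramp_hi[OF hpp]) (use 5 l in linarith)
    have zp3: "xp3 = 0" by (rule ramp_lo[OF hp3]) (use 5 l in linarith)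
    have z23: "x23 = 0" by (rule ramp_lo[OF h23]) (use 5 l in linarith)
    have z33: "x33 = 0" by (rule ramp_lo[OF h33]) (use 5 l in linarith)
    have b22: "1 * x22 \<le> m - 2 * g + 1" by (rule ramp_rise[OF h22]) (use 5 in linarith)
    show ?thesis
    proof (cases "m \<le> 2 * g + 2 * l - 3")
      case True
      from ramp_fall[OF hp2 True] show ?thesis
        using b22 ramp_cap[OF h13] l z11 zp1 z12 zpp zp3 z23 z33 by linarith
    next
      case False
      then have "xp2 = 0" by (intro ramp_hi[OF hp2]) linarith
      then show ?thesis using ramp_cap[OF h13] ramp_cap[OF h22] l z11 zp1 z12 zpp zp3 z23 z33 by linarith
    qed
  next
    case 6
    have z11: "x11 = 0" by (rule ramp_hi[OF h11]) (use 6 l in linarith)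
    have zp1: "xp1 = 0" by (rule ramp_hi[OF hp1]) (use 6 l in linarith)
    have z12: "x12 = 0" by (rule ramp_hi[OF h12]) (use 6 l in linarith)
    have zpp: "xpp = 0" by (rule ramp_hi[OF hpp]) (use 6 l in linarith)
    have zp2: "xp2 = 0" by (rule ramp_hi[OF hp2]) (use 6 l in linarith)
    have z23: "x23 = 0" by (rule ramp_lo[OF h23]) (use 6 l in linarith)
    have z33: "x33 = 0" by (rule ramp_lo[OF h33]) (use 6 l in linarith)
    have bp3: "2 * xp3 \<le> m - (3 * g - 2 * k + 1) + 2" by (rule ramp_rise[OF hp3]) (use 6 in linarith)
    show ?thesis
    proof (cases "m \<le> 2 * g + 2 * k - 2")
      case True
      from ramp_fall[OF h22 True] show ?thesis
        using bp3 ramp_cap[OF h13] l z11 zp1 z12 zpp zp2 z23 z33 by linarith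
    next
      case False
      then have "x22 = 0" by (intro ramp_hi[OF h22]) linarith
      then show ?thesis using ramp_cap[OF h13] ramp_cap[OF hp3] l z11 zp1 z12 zpp zp2 z23 z33 by linarith
    qed
  next
    case 7
    have z11: "x11 = 0" by (rule ramp_hi[OF h11]) (use 7 l in linarith)
    have zp1: "xp1 = 0" by (rule ramp_hi[OF hp1]) (use 7 l in linarith)
    have z12: "x12 = 0" by (rule ramp_hi[OF h12]) (use 7 l in linarith)
    have zpp: "xpp = 0" by (rule ramp_hi[OF hpp]) (use 7 l in linarith)
    have zp2: "xp2 = 0" by (rule ramp_hi[OF hp2]) (use 7 l in linarith)
    have z22: "x22 = 0" by (rule ramp_hi[OF h22]) (use 7 l in linarith)
    have z33: "x33 = 0" by (rule ramp_lo[OF h33]) (use 7 l in linarith)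
    have "1 * x13 \<le> 3 * g - 1 - m + 1" by (rule ramp_fall[OF h13]) (use 7 in linarith)
    moreover have "1 * x23 \<le> m - (3 * g - k + 1) + 1" by (rule ramp_rise[OF h23]) (use 7 in linarith)
    ultimately show ?thesis using ramp_cap[OF hp3] l z11 zp1 z12 zpp zp2 z22 z33 by linarith
  next
    case 8
    have z11: "x11 = 0" by (rule ramp_hi[OF h11]) (use 8 l in linarith)
    have zp1: "xp1 = 0" by (rule ramp_hi[OF hp1]) (use 8 l in linarith)
    have z12: "x12 = 0" by (rule ramp_hi[OF h12]) (use 8 l in linarith)
    have z13: "x13 = 0" by (rule ramp_hi[OF h13]) (use 8 l in linarith)
    have zpp: "xpp = 0" by (rule ramp_hi[OF hpp]) (use 8 l in linarith)
    have zp2: "xp2 = 0" by (rule ramp_hi[OF hp2]) (use 8 l in linarith)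
    have z22: "x22 = 0" by (rule ramp_hi[OF h22]) (use 8 l in linarith)
    have z33: "x33 = 0" by (rule ramp_lo[OF h33]) (use 8 l in linarith)
    show ?thesis using ramp_cap[OF hp3] ramp_cap[OF h23] l z11 zp1 z12 z13 zpp zp2 z22 z33 by linarith
  next
    case 9
    have z11: "x11 = 0" by (rule ramp_hi[OF h11]) (use 9 l in linarith)
    have zp1: "xp1 = 0" by (rule ramp_hi[OF hp1]) (use 9 l in linarith)
    have z12: "x12 = 0" by (rule ramp_hi[OF h12]) (use 9 l in linarith)
    have z13: "x13 = 0" by (rule ramp_hi[OF h13]) (use 9 l in linarith)
    have zpp: "xpp = 0" by (rule ramp_hi[OF hpp]) (use 9 l in linarith)
    have zp2: "xp2 = 0" by (rule ramp_hi[OF hp2]) (use 9 l in linarith)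
    have z22: "x22 = 0" by (rule ramp_hi[OF h22]) (use 9 l in linarith)
    have b33: "1 * x33 \<le> m - (4 * g - 2 * k + 2) + 1" by (rule ramp_rise[OF h33]) (use 9 in linarith)
    show ?thesis
    proof (cases "m \<le> 4 * g - 2 * k + 2 * l - 2")
      case True
      from ramp_fall[OF hp3 True] show ?thesis
        using b33 ramp_cap[OF h23] l z11 zp1 z12 z13 zpp zp2 z22 by linarith
    next
      case False
      then have "xp3 = 0" by (intro ramp_hi[OF hp3]) linarith
      moreover have "1 * x23 \<le> 4 * g - 1 - m + 1" by (rule ramp_fall[OF h23]) (use 9 in linarith)
      ultimately show ?thesis using b33 ramp_cap[OF h23] l z11 zp1 z12 z13 zpp zp2 z22 by linarith
    qed
  next
    case 10
    have z11: "x11 = 0" by (rule ramp_hi[OF h11]) (use 10 l in linarith)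
    have zp1: "xp1 = 0" by (rule ramp_hi[OF hp1]) (use 10 l in linarith)
    have z12: "x12 = 0" by (rule ramp_hi[OF h12]) (use 10 l in linarith)
    have z13: "x13 = 0" by (rule ramp_hi[OF h13]) (use 10 l in linarith)
    have zpp: "xpp = 0" by (rule ramp_hi[OF hpp]) (use 10 l in linarith)
    have zp2: "xp2 = 0" by (rule ramp_hi[OF hp2]) (use 10 l in linarith)
    have zp3: "xp3 = 0" by (rule ramp_hi[OF hp3]) (use 10 l in linarith)
    have z22: "x22 = 0" by (rule ramp_hi[OF h22]) (use 10 l in linarith)
    have z23: "x23 = 0" by (rule ramp_hi[OF h23]) (use 10 l in linarith)
    show ?thesis using ramp_cap[OF h33] z11 zp1 z12 z13 zpp zp2 zp3 z22 z23 by linarith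
  qed
qed

lemma reps_commute: "reps X Y m = reps Y X m"
proof -
  have "bij_betw (\<lambda>s. m - s) {s \<in> X. m - s \<in> Y} {s \<in> Y. m - s \<in> X}"
    by (rule bij_betwI[where g = "\<lambda>s. m - s"]) auto
  then show ?thesis unfolding reps_def by (simp add: bij_betw_same_card)
qed

lemma reps_Un:
  assumes "finite X" "finite Y"
  shows "reps (X \<union> Y) Z m \<le> reps X Z m + reps Y Z m"
proof -
  have "{s \<in> X \<union> Y. m - s \<in> Z} = {s \<in> X. m - s \<in> Z} \<union> {s \<in> Y. m - s \<in> Z}" by auto
  then have "card {s \<in> X \<union> Y. m - s \<in> Z} \<le> card {s \<in> X. m - s \<in> Z} + card {s \<in> Y. m - s \<in> Z}"
    by (simp only: card_Un_le)
  then show ?thesis unfolding reps_def by (simp only: of_nat_add[symmetric] of_nat_le_iff)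
qed

text \<open>Mixed representations occur in both orders.\<close>
lemma reps_Un2:
  assumes "finite X" "finite Y"
  shows "reps (X \<union> Y) (X \<union> Y) m \<le> reps X X m + 2 * reps X Y m + reps Y Y m"
  using reps_Un[OF assms, of "X \<union> Y" m] reps_Un[OF assms, of X m] reps_Un[OF assms, of Y m]
    reps_commute[of X "X \<union> Y" m] reps_commute[of Y "X \<union> Y" m] reps_commute[of X Y m]
  by linarith

lemma prog_subset:
  assumes "d > 0"
  shows "prog d a w \<subseteq> {a..a + d * (w - 1)}"
proof
  fix x assume "x \<in> prog d a w"
  then obtain j where j: "0 \<le> j" "j \<le> w - 1" "x = a + d * j" by (auto simp: prog_def)
  have "d * j \<le> d * (w - 1)" "0 \<le> d * j" using j assms by (auto intro: mult_left_mono)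
  then show "x \<in> {a..a + d * (w - 1)}" using j by simp
qed

lemma card_prog: "d > 0 \<Longrightarrow> card (prog d a w) = nat w"
  unfolding prog_def by (subst card_image) (auto simp: inj_on_def)

lemma ramp_reps_eq:
  assumes "d > 0" "w \<ge> 0" "Y \<subseteq> {b..e}" "lo = a + b" "hi = a + d * (w - 1) + e"
  shows "ramp d lo hi w m (reps (prog d a w) Y m)"
  using ramp_reps[OF assms(1-3), of a m] assms(4,5) by simp

text \<open>The progression has density one half inside the gap between the first two intervals and
ends before \<open>g\<close>, because \<open>2 (g div 6) \<le> g div 3\<close>.\<close>
definition block_set :: "nat \<Rightarrow> int set" where
  "block_set g = (let G = int g; k = G div 3; l = G div 6 in
     prog 1 0 k \<union> prog 2 (G - k) l \<union> prog 1 G k \<union> prog 1 (2 * G - k + 1) G)"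

lemma block_set_B_star: "B_star g (block_set g)"
proof -
  define G k l where "G = int g" and "k = G div 3" and "l = G div 6"
  have l: "0 \<le> l" "2 * l \<le> k" "3 * k \<le> G" by (auto simp: G_def k_def l_def)
  define X1 P X2 X3 where "X1 = prog 1 0 k" and "P = prog 2 (G - k) l" and "X2 = prog 1 G k" and "X3 = prog 1 (2 * G - k + 1) G"
  note X = X1_def P_def X2_def X3_def
  have A: "block_set g = X1 \<union> P \<union> X2 \<union> X3"
    by (simp add: block_set_def Let_def G_def[symmetric] k_def[symmetric] l_def[symmetric] X)
  have sub: "X1 \<subseteq> {0..k - 1}" "P \<subseteq> {G - k..G - k + 2 * (l - 1)}" "X2 \<subseteq> {G..G + (k - 1)}" "X3 \<subseteq> {2 * G - k + 1..3 * G - k}"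
    using prog_subset[of 1 0 k] prog_subset[of 2 "G - k" l] prog_subset[of 1 G k] prog_subset[of 1 "2 * G - k + 1" G]
    by (auto simp: X)
  have fin: "finite X1" "finite P" "finite X2" "finite X3" by (auto simp: X)
  have le: "reps (block_set g) (block_set g) m \<le> G" for m
  proof -
    let ?r = "\<lambda>X Y. reps X Y m"
    have "?r X1 X1 + ?r X2 X2 + ?r X3 X3 + ?r P P + 2 * ?r P X1 + 2 * ?r X1 X2 + 2 * ?r X1 X3 + 2 * ?r P X2
        + 2 * ?r P X3 + 2 * ?r X2 X3 \<le> G"
    proof (rule block_count_bound[OF l])
      show "ramp 1 0 (2 * k - 2) k m (?r X1 X1)"
        by (subst (1) X1_def, rule ramp_reps_eq[OF _ _ sub(1)]) (use l in auto)
      show "ramp 2 (G - k) (G + 2 * l - 3) l m (?r P X1)"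
        by (subst (1) P_def, rule ramp_reps_eq[OF _ _ sub(1)]) (use l in auto)
      show "ramp 1 G (G + 2 * k - 2) k m (?r X1 X2)"
        by (subst (1) X1_def, rule ramp_reps_eq[OF _ _ sub(3)]) (use l in auto)
      show "ramp 1 (2 * G - k + 1) (3 * G - 1) k m (?r X1 X3)"
        by (subst (1) X1_def, rule ramp_reps_eq[OF _ _ sub(4)]) (use l in auto)
      show "ramp 2 (2 * G - 2 * k) (2 * G - 2 * k + 4 * l - 4) l m (?r P P)"
        by (subst (1) P_def, rule ramp_reps_eq[OF _ _ sub(2)]) (use l in auto)
      show "ramp 2 (2 * G - k) (2 * G + 2 * l - 3) l m (?r P X2)"
        by (subst (1) P_def, rule ramp_reps_eq[OF _ _ sub(3)]) (use l in auto)
      show "ramp 2 (3 * G - 2 * k + 1) (4 * G - 2 * k + 2 * l - 2) l m (?r P X3)"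
        by (subst (1) P_def, rule ramp_reps_eq[OF _ _ sub(4)]) (use l in auto)
      show "ramp 1 (2 * G) (2 * G + 2 * k - 2) k m (?r X2 X2)"
        by (subst (1) X2_def, rule ramp_reps_eq[OF _ _ sub(3)]) (use l in auto)
      show "ramp 1 (3 * G - k + 1) (4 * G - 1) k m (?r X2 X3)"
        by (subst (1) X2_def, rule ramp_reps_eq[OF _ _ sub(4)]) (use l in auto)
      show "ramp 1 (4 * G - 2 * k + 2) (6 * G - 2 * k) G m (?r X3 X3)"
        by (subst (1) X3_def, rule ramp_reps_eq[OF _ _ sub(4)]) (use l in auto)
    qed
    moreover have "?r (block_set g) (block_set g) \<le> ?r (X1 \<union> P \<union> X2) (X1 \<union> P \<union> X2) + 2 * ?r (X1 \<union> P \<union> X2) X3 + ?r X3 X3"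
      unfolding A by (rule reps_Un2) (use fin in auto)
    moreover have "?r (X1 \<union> P \<union> X2) (X1 \<union> P \<union> X2) \<le> ?r (X1 \<union> P) (X1 \<union> P) + 2 * ?r (X1 \<union> P) X2 + ?r X2 X2"
      by (rule reps_Un2) (use fin in auto)
    moreover have "?r (X1 \<union> P) (X1 \<union> P) \<le> ?r X1 X1 + 2 * ?r X1 P + ?r P P"
      by (rule reps_Un2) (use fin in auto)
    moreover have "?r (X1 \<union> P \<union> X2) X3 \<le> ?r (X1 \<union> P) X3 + ?r X2 X3"
      by (rule reps_Un) (use fin in auto)
    moreover have "?r (X1 \<union> P) X3 \<le> ?r X1 X3 + ?r P X3" "?r (X1 \<union> P) X2 \<le> ?r X1 X2 + ?r P X2"
      using fin by (auto intro: reps_Un)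
    moreover have "?r X1 P = ?r P X1" by (rule reps_commute)
    ultimately show ?thesis by linarith
  qed
  show ?thesis
  proof (rule B_starI)
    show "finite (block_set g)" using fin by (simp add: A)
    show "card {s \<in> block_set g. m - s \<in> block_set g} \<le> g" for m
      using le[of m] by (simp add: reps_def G_def)
  qed
qed

lemma block_set_size:
  "block_set g \<subseteq> {0..<int (3 * g - g div 3 + 1)}"
  "card (block_set g) = g + 2 * (g div 3) + g div 6"
proof -
  define G k l where "G = int g" and "k = G div 3" and "l = G div 6"
  have l: "0 \<le> l" "2 * l \<le> k" "3 * k \<le> G" by (auto simp: G_def k_def l_def)
  define X1 P X2 X3 where "X1 = prog 1 0 k" and "P = prog 2 (G - k) l" and "X2 = prog 1 G k" and "X3 = prog 1 (2 * G - k + 1) G"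
  note X = X1_def P_def X2_def X3_def
  have A: "block_set g = X1 \<union> P \<union> X2 \<union> X3"
    by (simp add: block_set_def Let_def G_def[symmetric] k_def[symmetric] l_def[symmetric] X)
  have sub: "X1 \<subseteq> {0..k - 1}" "P \<subseteq> {G - k..G - k + 2 * (l - 1)}" "X2 \<subseteq> {G..G + (k - 1)}" "X3 \<subseteq> {2 * G - k + 1..3 * G - k}"
    using prog_subset[of 1 0 k] prog_subset[of 2 "G - k" l] prog_subset[of 1 G k] prog_subset[of 1 "2 * G - k + 1" G]
    by (auto simp: X)
  have fin: "finite X1" "finite P" "finite X2" "finite X3" by (auto simp: X)
  have m: "int (3 * g - g div 3 + 1) = 3 * G - k + 1" by (simp add: G_def k_def of_nat_diff)
  have "X1 \<subseteq> {0..3 * G - k}" by (rule order_trans[OF sub(1)]) (use l in auto)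
  moreover have "P \<subseteq> {0..3 * G - k}" by (rule order_trans[OF sub(2)]) (use l in auto)
  moreover have "X2 \<subseteq> {0..3 * G - k}" by (rule order_trans[OF sub(3)]) (use l in auto)
  moreover have "X3 \<subseteq> {0..3 * G - k}" by (rule order_trans[OF sub(4)]) (use l in auto)
  moreover have "{0..3 * G - k} = {0..<3 * G - k + 1}" by auto
  ultimately show "block_set g \<subseteq> {0..<int (3 * g - g div 3 + 1)}"
    unfolding A m by (simp only: Un_least)
  have d1: "X1 \<inter> P = {}" using sub(1,2) l by fastforce
  have d2: "(X1 \<union> P) \<inter> X2 = {}" using sub(1,2,3) l by fastforce
  have d3: "(X1 \<union> P \<union> X2) \<inter> X3 = {}" using sub l by fastforce
  have "card (block_set g) = nat k + nat l + nat k + nat G"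
    unfolding A using d1 d2 d3 fin by (simp add: card_Un_disjoint X card_prog)
  then show "card (block_set g) = g + 2 * (g div 3) + g div 6"
    by (simp add: G_def k_def l_def nat_div_distrib)
qed

section \<open>Explicit small sets\<close>

text \<open>Sums of two elements of \<open>[0, M]\<close> lie in \<open>[0, 2M]\<close>, so the property is decided by finitely
many counts.\<close>
lemma B_star_list:
  assumes "list_all (\<lambda>x. 0 \<le> x \<and> x \<le> M) xs"
    and "list_all (\<lambda>m. length (filter (\<lambda>s. m - s \<in> set xs) xs) \<le> g) [0..2 * M]"
  shows "B_star g (set xs)"
proof (rule B_starI)
  fix m :: int
  show "card {s \<in> set xs. m - s \<in> set xs} \<le> g"
  proof (cases "m \<in> {0..2 * M}")
    case True
    have "card {s \<in> set xs. m - s \<in> set xs} = card (set (filter (\<lambda>s. m - s \<in> set xs) xs))"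
      by simp
    also have "\<dots> \<le> length (filter (\<lambda>s. m - s \<in> set xs) xs)" by (rule card_length)
    also have "\<dots> \<le> g" using assms(2) True by (simp add: list_all_iff)
    finally show ?thesis .
  next
    case False
    have range: "0 \<le> x \<and> x \<le> M" if "x \<in> set xs" for x
      using assms(1) that by (simp add: list_all_iff)
    have "m \<in> {0..2 * M}" if "s \<in> set xs" "m - s \<in> set xs" for s
      using range[OF that(1)] range[OF that(2)] by simp
    then have "{s \<in> set xs. m - s \<in> set xs} = {}" using False by blast
    then show ?thesis by (simp only: card.empty)
  qed
qed simp

text \<open>The constant enters through its square, so that the values below can be recognised by
rational arithmetic.\<close>
lemma rho_lower_list:
  assumes check: "list_all (\<lambda>x. 0 \<le> x \<and> x < int m) xs"
      "list_all (\<lambda>k. length (filter (\<lambda>s. k - s \<in> set xs) xs) \<le> g) [0..2 * int m]"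
      "distinct xs"
    and pos: "0 < g" "0 < m"
    and c: "0 \<le> c" "c\<^sup>2 = (real (length xs))\<^sup>2 / (2 * real g * real m)"
  shows "ereal c \<le> rho_lower (2 * g)"
proof -
  have "set xs \<subseteq> {0..<int m}" using check(1) by (auto simp: list_all_iff)
  moreover have "B_star g (set xs)"
    by (rule B_star_list[where M = "int m", OF _ check(2)]) (use check(1) in \<open>auto simp: list_all_iff\<close>)
  moreover have "c = real (card (set xs)) / sqrt (2 * real g * real m)"
  proof (rule power2_eq_imp_eq[OF _ c(1)])
    have "(sqrt (2 * real g * real m))\<^sup>2 = 2 * real g * real m" by (rule real_sqrt_pow2) simp
    then show "c\<^sup>2 = (real (card (set xs)) / sqrt (2 * real g * real m))\<^sup>2"
      unfolding c(2) by (simp only: distinct_card[OF check(3)] power_divide)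
  qed simp
  ultimately show ?thesis by (simp only: rho_lower_ge[OF _ _ pos(2,1)])
qed

text \<open>The sets in this and the following lemmas come from a computer search. They show no
structure to exploit, so the count is evaluated.\<close>
lemma rho_lower_4: "ereal (2 / sqrt 7) \<le> rho_lower 4"
proof -
  have "ereal (2 / sqrt 7) \<le> rho_lower (2 * 2)"
  proof (rule rho_lower_list[where m = 7 and xs = "[0, 1, 4, 6]"])
    show "list_all (\<lambda>x. 0 \<le> x \<and> x < int 7) [0, 1, 4, 6]" by code_simp
    show "list_all (\<lambda>k. length (filter (\<lambda>s. k - s \<in> set [0, 1, 4, 6]) [0, 1, 4, 6]) \<le> 2) [0..2 * int 7]"
      by code_simp
  qed (simp_all add: power_divide power_mult_distrib)
  then show ?thesis by simp
qed

lemma rho_lower_6: "ereal (2 * sqrt 2 / sqrt 15) \<le> rho_lower 6"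
proof -
  have "ereal (2 * sqrt 2 / sqrt 15) \<le> rho_lower (2 * 3)"
  proof (rule rho_lower_list[where m = 5 and xs = "[0, 1, 2, 4]"])
    show "list_all (\<lambda>x. 0 \<le> x \<and> x < int 5) [0, 1, 2, 4]" by code_simp
    show "list_all (\<lambda>k. length (filter (\<lambda>s. k - s \<in> set [0, 1, 2, 4]) [0, 1, 2, 4]) \<le> 3) [0..2 * int 5]"
      by code_simp
  qed (simp_all add: power_divide power_mult_distrib)
  then show ?thesis by simp
qed

lemma rho_lower_8: "ereal (2 / sqrt 7) \<le> rho_lower 8"
proof -
  have "ereal (2 / sqrt 7) \<le> rho_lower (2 * 4)"
  proof (rule rho_lower_list[where m = 14 and xs = "[0, 1, 2, 3, 8, 9, 12, 13]"])
    show "list_all (\<lambda>x. 0 \<le> x \<and> x < int 14) [0, 1, 2, 3, 8, 9, 12, 13]" by code_simp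
    show "list_all (\<lambda>k. length (filter (\<lambda>s. k - s \<in> set [0, 1, 2, 3, 8, 9, 12, 13]) [0, 1, 2, 3, 8, 9, 12, 13]) \<le> 4) [0..2 * int 14]"
      by code_simp
  qed (simp_all add: power_divide power_mult_distrib)
  then show ?thesis by simp
qed

lemma rho_lower_10: "ereal (7 / (3 * sqrt 10)) \<le> rho_lower 10"
proof -
  have "ereal (7 / (3 * sqrt 10)) \<le> rho_lower (2 * 5)"
  proof (rule rho_lower_list[where m = 9 and xs = "[0, 1, 2, 3, 4, 6, 8]"])
    show "list_all (\<lambda>x. 0 \<le> x \<and> x < int 9) [0, 1, 2, 3, 4, 6, 8]" by code_simp
    show "list_all (\<lambda>k. length (filter (\<lambda>s. k - s \<in> set [0, 1, 2, 3, 4, 6, 8]) [0, 1, 2, 3, 4, 6, 8]) \<le> 5) [0..2 * int 9]"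
      by code_simp
  qed (simp_all add: power_divide power_mult_distrib)
  then show ?thesis by simp
qed

lemma rho_lower_12: "ereal (sqrt 3 / sqrt 5) \<le> rho_lower 12"
proof -
  have "ereal (sqrt 3 / sqrt 5) \<le> rho_lower (2 * 6)"
  proof (rule rho_lower_list[where m = 20 and xs = "[0, 1, 2, 3, 4, 5, 8, 9, 12, 14, 18, 19]"])
    show "list_all (\<lambda>x. 0 \<le> x \<and> x < int 20) [0, 1, 2, 3, 4, 5, 8, 9, 12, 14, 18, 19]" by code_simp
    show "list_all (\<lambda>k. length (filter (\<lambda>s. k - s \<in> set [0, 1, 2, 3, 4, 5, 8, 9, 12, 14, 18, 19]) [0, 1, 2, 3, 4, 5, 8, 9, 12, 14, 18, 19]) \<le> 6) [0..2 * int 20]"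
      by code_simp
  qed (simp_all add: power_divide power_mult_distrib)
  then show ?thesis by simp
qed

lemma rho_lower_14: "ereal (11 / sqrt 210) \<le> rho_lower 14"
proof -
  have "ereal (11 / sqrt 210) \<le> rho_lower (2 * 7)"
  proof (rule rho_lower_list[where m = 15 and xs = "[0, 1, 2, 6, 7, 8, 9, 10, 11, 12, 14]"])
    show "list_all (\<lambda>x. 0 \<le> x \<and> x < int 15) [0, 1, 2, 6, 7, 8, 9, 10, 11, 12, 14]" by code_simp
    show "list_all (\<lambda>k. length (filter (\<lambda>s. k - s \<in> set [0, 1, 2, 6, 7, 8, 9, 10, 11, 12, 14]) [0, 1, 2, 6, 7, 8, 9, 10, 11, 12, 14]) \<le> 7) [0..2 * int 15]"
      by code_simp
  qed (simp_all add: power_divide power_mult_distrib)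
  then show ?thesis by simp
qed

lemma rho_lower_16: "ereal (17 / (4 * sqrt 30)) \<le> rho_lower 16"
proof -
  have "ereal (17 / (4 * sqrt 30)) \<le> rho_lower (2 * 8)"
  proof (rule rho_lower_list[where m = 30 and xs = "[0, 1, 2, 3, 4, 12, 14, 16, 17, 18, 19, 21, 22, 23, 25, 28, 29]"])
    show "list_all (\<lambda>x. 0 \<le> x \<and> x < int 30) [0, 1, 2, 3, 4, 12, 14, 16, 17, 18, 19, 21, 22, 23, 25, 28, 29]" by code_simp
    show "list_all (\<lambda>k. length (filter (\<lambda>s. k - s \<in> set [0, 1, 2, 3, 4, 12, 14, 16, 17, 18, 19, 21, 22, 23, 25, 28, 29]) [0, 1, 2, 3, 4, 12, 14, 16, 17, 18, 19, 21, 22, 23, 25, 28, 29]) \<le> 8) [0..2 * int 30]"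
      by code_simp
  qed (simp_all add: power_divide power_mult_distrib)
  then show ?thesis by simp
qed

lemma rho_lower_18: "ereal (4 / (3 * sqrt 3)) \<le> rho_lower 18"
proof -
  have "ereal (4 / (3 * sqrt 3)) \<le> rho_lower (2 * 9)"
  proof (rule rho_lower_list[where m = 24 and xs = "[0, 1, 2, 3, 4, 5, 6, 7, 8, 12, 13, 14, 16, 21, 22, 23]"])
    show "list_all (\<lambda>x. 0 \<le> x \<and> x < int 24) [0, 1, 2, 3, 4, 5, 6, 7, 8, 12, 13, 14, 16, 21, 22, 23]" by code_simp
    show "list_all (\<lambda>k. length (filter (\<lambda>s. k - s \<in> set [0, 1, 2, 3, 4, 5, 6, 7, 8, 12, 13, 14, 16, 21, 22, 23]) [0, 1, 2, 3, 4, 5, 6, 7, 8, 12, 13, 14, 16, 21, 22, 23]) \<le> 9) [0..2 * int 24]"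
      by code_simp
  qed (simp_all add: power_divide power_mult_distrib)
  then show ?thesis by simp
qed

lemma rho_lower_20: "ereal (2 * sqrt 5 / sqrt 33) \<le> rho_lower 20"
proof -
  have "ereal (2 * sqrt 5 / sqrt 33) \<le> rho_lower (2 * 10)"
  proof (rule rho_lower_list[where m = 33 and xs = "[0, 1, 2, 3, 10, 11, 12, 13, 18, 20, 22, 23, 24, 25, 26, 27, 28, 29, 31, 32]"])
    show "list_all (\<lambda>x. 0 \<le> x \<and> x < int 33) [0, 1, 2, 3, 10, 11, 12, 13, 18, 20, 22, 23, 24, 25, 26, 27, 28, 29, 31, 32]" by code_simp
    show "list_all (\<lambda>k. length (filter (\<lambda>s. k - s \<in> set [0, 1, 2, 3, 10, 11, 12, 13, 18, 20, 22, 23, 24, 25, 26, 27, 28, 29, 31, 32]) [0, 1, 2, 3, 10, 11, 12, 13, 18, 20, 22, 23, 24, 25, 26, 27, 28, 29, 31, 32]) \<le> 10) [0..2 * int 33]"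
      by code_simp
  qed (simp_all add: power_divide power_mult_distrib)
  then show ?thesis by simp
qed

lemma rho_lower_22: "ereal (18 / (5 * sqrt 22)) \<le> rho_lower 22"
proof -
  have "ereal (18 / (5 * sqrt 22)) \<le> rho_lower (2 * 11)"
  proof (rule rho_lower_list[where m = 25 and xs = "[0, 1, 2, 3, 4, 9, 12, 13, 14, 15, 16, 17, 18, 19, 20, 22, 23, 24]"])
    show "list_all (\<lambda>x. 0 \<le> x \<and> x < int 25) [0, 1, 2, 3, 4, 9, 12, 13, 14, 15, 16, 17, 18, 19, 20, 22, 23, 24]" by code_simp
    show "list_all (\<lambda>k. length (filter (\<lambda>s. k - s \<in> set [0, 1, 2, 3, 4, 9, 12, 13, 14, 15, 16, 17, 18, 19, 20, 22, 23, 24]) [0, 1, 2, 3, 4, 9, 12, 13, 14, 15, 16, 17, 18, 19, 20, 22, 23, 24]) \<le> 11) [0..2 * int 25]"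
      by code_simp
  qed (simp_all add: power_divide power_mult_distrib)
  then show ?thesis by simp
qed

section \<open>The general bound and its uniform version\<close>

lemma rho_lower_block:
  assumes g: "g > 0"
  shows "ereal ((real g + 2 * real_of_int \<lfloor>real g / 3\<rfloor> + real_of_int \<lfloor>real g / 6\<rfloor>) /
                     sqrt (6 * (real g)^2 - 2 * real g * real_of_int \<lfloor>real g / 3\<rfloor> + 2 * real g))
         \<le> rho_lower (2 * g)"
proof -
  have fl: "real_of_int \<lfloor>real g / 3\<rfloor> = real (g div 3)" "real_of_int \<lfloor>real g / 6\<rfloor> = real (g div 6)"
    using floor_divide_of_nat_eq[of g 3, where ?'a = real] floor_divide_of_nat_eq[of g 6, where ?'a = real] by simp_all
  have "real (3 * g - g div 3 + 1) = 3 * real g - real (g div 3) + 1" by (simp add: of_nat_diff)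
  then have m: "2 * real g * real (3 * g - g div 3 + 1) = 6 * (real g)\<^sup>2 - 2 * real g * real (g div 3) + 2 * real g"
    by (simp only:) (simp add: power2_eq_square algebra_simps)
  show ?thesis
    using rho_lower_ge[OF block_set_size(1) block_set_B_star _ g] unfolding fl m block_set_size(2) by simp
qed

text \<open>Here \<open>11 x / 6 - 13 / 6\<close> and \<open>8 x / 3 + 5 / 3\<close> bound the size of the block set for \<open>x = h\<close>
from below and the length of the interval that contains it from above, and \<open>2 x + 1\<close> bounds \<open>g\<close>
when \<open>h = g div 2\<close>.\<close>
lemma block_ratio_limit:
  "((\<lambda>x::real. (11 * x / 6 - 13 / 6) / sqrt ((8 * x / 3 + 5 / 3) * (2 * x + 1))) \<longlongrightarrow> 11 / (8 * sqrt 3)) at_top"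
proof -
  have "((\<lambda>x::real. (11 * x / 6 - 13 / 6) / sqrt ((8 * x / 3 + 5 / 3) * (2 * x + 1))) \<longlongrightarrow> 11 * inverse ((16 / 3) powr (1 / 2)) / 6) at_top"
    by real_asymp
  moreover have "11 * inverse ((16 / 3) powr (1 / 2)) / 6 = 11 / (8 * sqrt (3::real))"
    by (rule power2_eq_imp_eq) (simp_all add: powr_half_sqrt power_divide power_mult_distrib divide_inverse[symmetric])
  ultimately show ?thesis by simp
qed

text \<open>Apply \<open>R_lower\<close> to the block set for \<open>h = g div 2\<close>; monotonicity in the first argument
handles odd \<open>g\<close>. Half of \<open>\<delta>\<close> goes to the convergence of the ratio and half to the factor
\<open>1 - \<epsilon>\<close>, where the limit constant is at most 1.\<close>
lemma R_uniform_lower_bound: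
  fixes \<delta> :: real
  assumes d: "\<delta> > 0"
  shows "\<exists>G K :: real. \<forall>g n :: nat. g \<ge> 1 \<and> n \<ge> 1 \<and> real g \<ge> G \<and> real n / real g \<ge> K \<longrightarrow>
               real (R g n) > (11 / (8 * sqrt 3) - \<delta>) * sqrt (real g * real n)"
proof -
  define c where "c = 11 / (8 * sqrt (3::real))"
  have c: "0 < c" "c \<le> 1"
    unfolding c_def by (simp, rule power2_le_imp_le) (simp_all add: power_divide power_mult_distrib)
  define \<epsilon> where "\<epsilon> = min (1 / 2) (\<delta> / 2)"
  have e: "0 < \<epsilon>" "\<epsilon> < 1" "\<epsilon> \<le> \<delta> / 2" using d by (auto simp: \<epsilon>_def)
  obtain X where X: "\<forall>g m n A. A \<subseteq> {0..<int m} \<and> B_star g A \<and> 0 < m \<and> X \<le> real n / real m \<longrightarrow>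
           (1 - \<epsilon>) * real (card A) * sqrt (real n / real m) \<le> real (R (2 * g) n)"
    using R_lower[OF e(1,2)] by (elim exE)
  let ?f = "\<lambda>x::real. (11 * x / 6 - 13 / 6) / sqrt ((8 * x / 3 + 5 / 3) * (2 * x + 1))"
  have "\<forall>\<^sub>F x in at_top. c - \<delta> / 2 < ?f x"
    by (rule order_tendstoD(1)[OF block_ratio_limit]) (use d in \<open>simp add: c_def\<close>)
  then obtain Y where Y: "\<And>x. x \<ge> Y \<Longrightarrow> c - \<delta> / 2 < ?f x" unfolding eventually_at_top_linorder by blast
  have main: "real (R g n) > (c - \<delta>) * sqrt (real g * real n)"
    if g: "g \<ge> 1" and n: "n \<ge> 1" and gG: "real g \<ge> 2 * max 2 Y + 2" and nK: "real n / real g \<ge> 4 * max X 0" for g n :: nat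
  proof -
    define h where "h = g div 2"
    have h: "2 * h \<le> g" "g \<le> 2 * h + 1" by (auto simp: h_def)
    have hY: "real h \<ge> Y" "real h \<ge> 2" using h(2) gG by (auto simp: max_def split: if_splits)
    have sq: "sqrt (real g * real n) > 0" using g n by simp
    show ?thesis
    proof (cases "c - \<delta> / 2 \<le> 0")
      case True
      then have "(c - \<delta>) * sqrt (real g * real n) < 0" using d sq by (intro mult_neg_pos) auto
      then show ?thesis by (rule less_le_trans) simp
    next
      case False
      define a m where "a = card (block_set h)" and "m = 3 * h - h div 3 + 1"
      have m0: "m > 0" by (simp add: m_def)
      have "real m = 3 * real h - real (h div 3) + 1" unfolding m_def by (simp add: of_nat_diff)
      moreover have "real h - 2 \<le> 3 * real (h div 3)" by linarith
      ultimately have m1: "real m \<le> 8 * real h / 3 + 5 / 3" by linarith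
      have "real a = real h + 2 * real (h div 3) + real (h div 6)" unfolding a_def block_set_size(2) by simp
      moreover have "real h - 5 \<le> 6 * real (h div 6)" by linarith
      ultimately have a1: "11 * real h / 6 - 13 / 6 \<le> real a" using \<open>real h - 2 \<le> 3 * real (h div 3)\<close> by linarith
      have "real m \<le> 4 * real g" using m1 hY(2) h(1) by linarith
      then have "real n / (4 * real g) \<le> real n / real m" using m0 g by (intro divide_left_mono) auto
      moreover have "x \<le> real n / (4 * real g)" if "4 * x \<le> real n / real g" for x
        using that g by (simp add: field_simps)
      from order_trans[OF max.cobounded1 this[OF nK]] have "X \<le> real n / (4 * real g)" .
      ultimately have "X \<le> real n / real m" by linarith
      then have "block_set h \<subseteq> {0..<int m} \<and> B_star h (block_set h) \<and> 0 < m \<and> X \<le> real n / real m"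
        using block_set_size(1)[of h] block_set_B_star[of h] m0 unfolding m_def by (intro conjI)
      from X[rule_format, OF this]
      have "(1 - \<epsilon>) * real a * sqrt (real n / real m) \<le> real (R (2 * h) n)"
        unfolding a_def .
      also have "\<dots> \<le> real (R g n)" using R_mono[OF h(1)] by simp
      finally have R: "(1 - \<epsilon>) * real a * sqrt (real n / real m) \<le> real (R g n)" .
      have "real m * real g \<le> (8 * real h / 3 + 5 / 3) * (2 * real h + 1)"
        using m1 h(2) by (intro mult_mono) auto
      then have "sqrt (real m * real g) \<le> sqrt ((8 * real h / 3 + 5 / 3) * (2 * real h + 1))" by simp
      moreover have "0 < sqrt (real m * real g)" using m0 g by simp
      ultimately have "?f (real h) \<le> real a / sqrt (real m * real g)"
        using a1 hY(2) by (intro frac_le) auto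
      with Y[OF hY(1)] have q: "c - \<delta> / 2 < real a / sqrt (real m * real g)" by linarith
      have "\<epsilon> * (c - \<delta> / 2) \<le> (\<delta> / 2) * 1" using e c d False by (intro mult_mono) auto
      then have "c - \<delta> \<le> (1 - \<epsilon>) * (c - \<delta> / 2)" unfolding left_diff_distrib mult_1 by linarith
      also have "\<dots> < (1 - \<epsilon>) * (real a / sqrt (real m * real g))" using q e by (intro mult_strict_left_mono) auto
      finally have "(c - \<delta>) * sqrt (real g * real n) < (1 - \<epsilon>) * (real a / sqrt (real m * real g)) * sqrt (real g * real n)"
        using sq by (rule mult_strict_right_mono)
      also have "\<dots> = (1 - \<epsilon>) * real a * sqrt (real n / real m)"
        using m0 g by (simp add: real_sqrt_mult real_sqrt_divide field_simps)
      finally show ?thesis using R by linarith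
    qed
  qed
  show ?thesis unfolding c_def[symmetric]
    by (intro exI[of _ "2 * max 2 Y + 2"] exI[of _ "4 * max X 0"] allI impI) (elim conjE, rule main)
qed

theorem theorem1p3:
  shows "(rho_lower 4 \<ge> ereal (2 / sqrt 7) \<and> 2 / sqrt 7 > (0.755::real)) \<and>
         (rho_lower 6 \<ge> ereal (2 * sqrt 2 / sqrt 15) \<and> 2 * sqrt 2 / sqrt 15 > (0.730::real)) \<and>
         (rho_lower 8 \<ge> ereal (2 / sqrt 7) \<and> 2 / sqrt 7 > (0.755::real)) \<and>
         (rho_lower 10 \<ge> ereal (7 / (3 * sqrt 10)) \<and> 7 / (3 * sqrt 10) > (0.737::real)) \<and>
         (rho_lower 12 \<ge> ereal (sqrt 3 / sqrt 5) \<and> sqrt 3 / sqrt 5 > (0.774::real)) \<and>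
         (rho_lower 14 \<ge> ereal (11 / sqrt 210) \<and> 11 / sqrt 210 > (0.759::real)) \<and>
         (rho_lower 16 \<ge> ereal (17 / (4 * sqrt 30)) \<and> 17 / (4 * sqrt 30) > (0.775::real)) \<and>
         (rho_lower 18 \<ge> ereal (4 / (3 * sqrt 3)) \<and> 4 / (3 * sqrt 3) > (0.769::real)) \<and>
         (rho_lower 20 \<ge> ereal (2 * sqrt 5 / sqrt 33) \<and> 2 * sqrt 5 / sqrt 33 > (0.778::real)) \<and>
         (rho_lower 22 \<ge> ereal (18 / (5 * sqrt 22)) \<and> 18 / (5 * sqrt 22) > (0.767::real)) \<and>
         (\<forall>g::nat. g \<ge> 12 \<longrightarrow>
            rho_lower (2 * g) \<ge>
              ereal ((real g + 2 * real_of_int \<lfloor>real g / 3\<rfloor> + real_of_int \<lfloor>real g / 6\<rfloor>) /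
                     sqrt (6 * (real g)^2 - 2 * real g * real_of_int \<lfloor>real g / 3\<rfloor> + 2 * real g))) \<and>
         (\<forall>\<delta>::real. \<delta> > 0 \<longrightarrow>
            (\<exists>G K :: real. \<forall>g n :: nat. g \<ge> 1 \<and> n \<ge> 1 \<and> real g \<ge> G \<and> real n / real g \<ge> K \<longrightarrow>
               real (R g n) > (11 / (8 * sqrt 3) - \<delta>) * sqrt (real g * real n)))"
proof (intro conjI)
  show "rho_lower 4 \<ge> ereal (2 / sqrt 7)" by (rule rho_lower_4)
  show "2 / sqrt 7 > (0.755::real)"
    by (rule power2_less_imp_less) (simp_all add: power_divide power_mult_distrib)
  show "rho_lower 6 \<ge> ereal (2 * sqrt 2 / sqrt 15)" by (rule rho_lower_6)
  show "2 * sqrt 2 / sqrt 15 > (0.730::real)"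
    by (rule power2_less_imp_less) (simp_all add: power_divide power_mult_distrib)
  show "rho_lower 8 \<ge> ereal (2 / sqrt 7)" by (rule rho_lower_8)
  show "2 / sqrt 7 > (0.755::real)"
    by (rule power2_less_imp_less) (simp_all add: power_divide power_mult_distrib)
  show "rho_lower 10 \<ge> ereal (7 / (3 * sqrt 10))" by (rule rho_lower_10)
  show "7 / (3 * sqrt 10) > (0.737::real)"
    by (rule power2_less_imp_less) (simp_all add: power_divide power_mult_distrib)
  show "rho_lower 12 \<ge> ereal (sqrt 3 / sqrt 5)" by (rule rho_lower_12)
  show "sqrt 3 / sqrt 5 > (0.774::real)"
    by (rule power2_less_imp_less) (simp_all add: power_divide power_mult_distrib)
  show "rho_lower 14 \<ge> ereal (11 / sqrt 210)" by (rule rho_lower_14)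
  show "11 / sqrt 210 > (0.759::real)"
    by (rule power2_less_imp_less) (simp_all add: power_divide power_mult_distrib)
  show "rho_lower 16 \<ge> ereal (17 / (4 * sqrt 30))" by (rule rho_lower_16)
  show "17 / (4 * sqrt 30) > (0.775::real)"
    by (rule power2_less_imp_less) (simp_all add: power_divide power_mult_distrib)
  show "rho_lower 18 \<ge> ereal (4 / (3 * sqrt 3))" by (rule rho_lower_18)
  show "4 / (3 * sqrt 3) > (0.769::real)"
    by (rule power2_less_imp_less) (simp_all add: power_divide power_mult_distrib)
  show "rho_lower 20 \<ge> ereal (2 * sqrt 5 / sqrt 33)" by (rule rho_lower_20)
  show "2 * sqrt 5 / sqrt 33 > (0.778::real)"
    by (rule power2_less_imp_less) (simp_all add: power_divide power_mult_distrib)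
  show "rho_lower 22 \<ge> ereal (18 / (5 * sqrt 22))" by (rule rho_lower_22)
  show "18 / (5 * sqrt 22) > (0.767::real)"
    by (rule power2_less_imp_less) (simp_all add: power_divide power_mult_distrib)
qed (intro allI impI, rule rho_lower_block, simp, intro allI impI, rule R_uniform_lower_bound, assumption)

end
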